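(* Let $\phi\in\mathrm{Bir}(\mathbb{P}^2)$ be a birational self-map of the complex projective plane which preserves a rational fibration fibre by fibre. If $\phi$ has linear growth, then the centraliser $\mathrm{C}(\phi)$ of $\phi$ in $\mathrm{Bir}(\mathbb{P}^2)$ is a finite extension of $\mathrm{Ab}(\phi)$.
   Context: $\mathrm{Bir}(\mathbb{P}^2)$ is the group of birational self-maps of $\mathbb{P}^2(\mathbb{C})$. Each $\phi$ is written $(x:y:z)\dashrightarrow(\phi_0:\phi_1:\phi_2)$ with $\phi_i$ homogeneous polynomials of the same degree without common factor, and $\deg\phi$ is this common degree. $\phi$ has linear growth if $\deg\phi^n\sim n$, i.e. there are constants $0<c\le C$ with $cn\le\deg\phi^n\le Cn$ for all large $n$. The centraliser is $\mathrm{C}(\phi)=\{\psi\in\mathrm{Bir}(\mathbb{P}^2)\mid\psi\phi=\phi\psi\}$. A rational fibration $\mathcal{F}$ is a pencil of rational curves, i.e. the level curves of a dominant rational map $f\colon\mathbb{P}^2\dashrightarrow\mathbb{P}^1$ with irreducible rational generic fibre; $\phi$ preserves $\mathcal{F}$ fibre by fibre if $f\circ\phi=f$. Up to birational conjugacy $\mathcal{F}$ is the fibration $y=\text{const}$ in an affine chart $(x,y)$, and the group of birational maps preserving it fibre by fibre is $\mathrm{J}_0=\left\{\left(\frac{A(y)x+B(y)}{C(y)x+D(y)},y\right)\right\}\simeq\mathrm{PGL}_2(\mathbb{C}(y))$. $\mathrm{Ab}(\phi)$ denotes the maximal infinite abelian subgroup, containing $\phi$, of the group of birational maps preserving $\mathcal{F}$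 fibre by fibre. Up to conjugacy in $\mathrm{J}_0$ it is one of $\mathrm{J}_a=\{(x+a(y),y)\mid a\in\mathbb{C}(y)\}$, $\mathrm{J}_m=\{(b(y)x,y)\mid b\in\mathbb{C}(y)^*\}$, or $\mathrm{J}_F=\left\{(x,y),\left(\frac{c(y)x+F(y)}{x+c(y)},y\right)\,\middle|\, c\in\mathbb{C}(y)\right\}$, where $F\in\mathbb{C}[y]$ is not a square. "Finite extension of $\mathrm{Ab}(\phi)$" means that $\mathrm{Ab}(\phi)$ is a normal subgroup of finite index in $\mathrm{C}(\phi)$. *)

theory Defs
  imports Complex_Main "HOL-Computational_Algebra.Computational_Algebra" "HOL-Algebra.Coset"
begin

section \<open>Polynomials in two and three variables\<close>

text \<open>
  A bivariate polynomial in \<open>s, t\<close> is an element of \<open>\<complex>[s][t]\<close>, a trivariate one in \<open>x, y, z\<close> an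
  element of \<open>\<complex>[x][y][z]\<close>.  The innermost variable comes first, so the coefficient of
  \<open>x^i y^j z^k\<close> in \<open>p\<close> is \<open>coeff (coeff (coeff p k) j) i\<close>.
\<close>

type_synonym poly2 = "complex poly poly"
type_synonym poly3 = "complex poly poly poly"

definition const2 :: "complex \<Rightarrow> poly2" where "const2 c = [:[:c:]:]"
definition varS :: poly2 where "varS = [:[:0, 1:]:]"
definition varT :: poly2 where "varT = [:0, 1:]"

definition const3 :: "complex \<Rightarrow> poly3" where "const3 c = [:[:[:c:]:]:]"
definition varX :: poly3 where "varX = [:[:[:0, 1:]:]:]"
definition varY :: poly3 where "varY = [:[:0, 1:]:]"
definition varZ :: poly3 where "varZ = [:0, 1:]"

text \<open>Evaluation in a commutative ring into which \<open>h\<close> maps the coefficients.\<close>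

definition eval1 :: "(complex \<Rightarrow> 'r::comm_ring_1) \<Rightarrow> 'r \<Rightarrow> complex poly \<Rightarrow> 'r" where
  "eval1 h a p = poly (map_poly h p) a"

definition eval2 :: "(complex \<Rightarrow> 'r::comm_ring_1) \<Rightarrow> 'r \<times> 'r \<Rightarrow> poly2 \<Rightarrow> 'r" where
  "eval2 h = (\<lambda>(a, b) p. poly (map_poly (eval1 h a) p) b)"

definition eval3 :: "(complex \<Rightarrow> 'r::comm_ring_1) \<Rightarrow> 'r \<times> 'r \<times> 'r \<Rightarrow> poly3 \<Rightarrow> 'r" where
  "eval3 h = (\<lambda>(a, b, c) p. poly (map_poly (eval2 h (a, b)) p) c)"

text \<open>The zero polynomial counts as homogeneous of every degree.\<close>

definition homog2 :: "nat \<Rightarrow> poly2 \<Rightarrow> bool" where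
  "homog2 d p \<longleftrightarrow> (\<forall>i j. coeff (coeff p j) i \<noteq> 0 \<longrightarrow> i + j = d)"

definition homog3 :: "nat \<Rightarrow> poly3 \<Rightarrow> bool" where
  "homog3 d p \<longleftrightarrow> (\<forall>i j k. coeff (coeff (coeff p k) j) i \<noteq> 0 \<longrightarrow> i + j + k = d)"

definition proportional2 :: "'r::comm_ring_1 \<times> 'r \<Rightarrow> 'r \<times> 'r \<Rightarrow> bool" where
  "proportional2 = (\<lambda>(a0, a1) (b0, b1). a0 * b1 = a1 * b0)"

definition proportional3 :: "'r::comm_ring_1 \<times> 'r \<times> 'r \<Rightarrow> 'r \<times> 'r \<times> 'r \<Rightarrow> bool" where
  "proportional3 = (\<lambda>(a0, a1, a2) (b0, b1, b2).
     a0 * b1 = a1 * b0 \<and> a0 * b2 = a2 * b0 \<and> a1 * b2 = a2 * b1)"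


section \<open>The group of birational self-maps of the complex projective plane\<close>

definition form_triple :: "nat \<Rightarrow> poly3 \<times> poly3 \<times> poly3 \<Rightarrow> bool" where
  "form_triple d = (\<lambda>(f0, f1, f2).
     homog3 d f0 \<and> homog3 d f1 \<and> homog3 d f2 \<and> (f0, f1, f2) \<noteq> (0, 0, 0))"

text \<open>
  A rational self-map of the plane is the set of all the triples \<open>(f0 : f1 : f2)\<close> of forms of one
  degree which represent it, common factors allowed.
\<close>

type_synonym rmap = "(poly3 \<times> poly3 \<times> poly3) set"

definition rmap_of :: "poly3 \<times> poly3 \<times> poly3 \<Rightarrow> rmap" where
  "rmap_of f = {g. (\<exists>d. form_triple d g) \<and> proportional3 f g}"

definition rational_maps :: "rmap set" where
  "rational_maps = {rmap_of f | f. \<exists>d. form_triple d f}"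

definition subst3 :: "poly3 \<times> poly3 \<times> poly3 \<Rightarrow> poly3 \<times> poly3 \<times> poly3 \<Rightarrow> poly3 \<times> poly3 \<times> poly3" where
  "subst3 = (\<lambda>(f0, f1, f2) g. (eval3 const3 g f0, eval3 const3 g f1, eval3 const3 g f2))"

text \<open>
  \<open>rmap_comp F G\<close> is \<open>F\<close> after \<open>G\<close>.  It is the empty set, which is not a rational map, if the
  composite is undefined.
\<close>

definition rmap_comp :: "rmap \<Rightarrow> rmap \<Rightarrow> rmap" where
  "rmap_comp F G = (\<Union>f\<in>F. \<Union>g\<in>G. if subst3 f g = (0, 0, 0) then {} else rmap_of (subst3 f g))"

definition rmap_id :: rmap where
  "rmap_id = rmap_of (varX, varY, varZ)"

definition birational :: "rmap \<Rightarrow> bool" where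
  "birational F \<longleftrightarrow> F \<in> rational_maps \<and>
     (\<exists>G\<in>rational_maps. rmap_comp F G = rmap_id \<and> rmap_comp G F = rmap_id)"

definition BirP2 :: "rmap monoid" where
  "BirP2 = \<lparr>carrier = {F. birational F}, mult = rmap_comp, one = rmap_id\<rparr>"

definition no_common_factor :: "poly3 \<times> poly3 \<times> poly3 \<Rightarrow> bool" where
  "no_common_factor = (\<lambda>(f0, f1, f2). \<forall>p. p dvd f0 \<and> p dvd f1 \<and> p dvd f2 \<longrightarrow> is_unit p)"

definition rmap_degree :: "rmap \<Rightarrow> nat" where
  "rmap_degree F = (THE d. \<exists>f\<in>F. form_triple d f \<and> no_common_factor f)"

definition linear_growth :: "rmap \<Rightarrow> bool" where
  "linear_growth \<phi> \<longleftrightarrow> (\<exists>c C::real. 0 < c \<and> c \<le> C \<and>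
     (\<forall>\<^sub>F n in sequentially.
        c * real n \<le> real (rmap_degree (\<phi> [^]\<^bsub>BirP2\<^esub> n)) \<and>
        real (rmap_degree (\<phi> [^]\<^bsub>BirP2\<^esub> n)) \<le> C * real n))"


section \<open>Rational fibrations\<close>

text \<open>
  The plane curve \<open>G = 0\<close>, for an irreducible form \<open>G\<close>, is rational: there are mutually inverse
  rational maps \<open>u\<close> from the projective line to the curve and \<open>v\<close> from the curve to the line.
  A polynomial vanishes on the curve iff it is divisible by \<open>G\<close>.
\<close>

definition rational_curve :: "poly3 \<Rightarrow> bool" where
  "rational_curve G \<longleftrightarrow> (\<exists>d e u0 u1 u2 v0 v1.
     homog2 d u0 \<and> homog2 d u1 \<and> homog2 d u2 \<and> (u0, u1, u2) \<noteq> (0, 0, 0) \<and>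
     eval3 const2 (u0, u1, u2) G = 0 \<and>
     homog3 e v0 \<and> homog3 e v1 \<and> \<not> (G dvd v0 \<and> G dvd v1) \<and>
     (let w0 = eval3 const2 (u0, u1, u2) v0;
          w1 = eval3 const2 (u0, u1, u2) v1
      in (w0, w1) \<noteq> (0, 0) \<and> proportional2 (w0, w1) (varS, varT)) \<and>
     (let w0 = eval2 const3 (v0, v1) u0;
          w1 = eval2 const3 (v0, v1) u1;
          w2 = eval2 const3 (v0, v1) u2
      in \<not> (G dvd w0 \<and> G dvd w1 \<and> G dvd w2) \<and>
         G dvd w0 * varY - w1 * varX \<and>
         G dvd w0 * varZ - w2 * varX \<and>
         G dvd w1 * varZ - w2 * varY))"

text \<open>
  A rational fibration is given by a rational map \<open>(P : Q)\<close> from the plane to the projective line,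
  in lowest terms.  It is dominant if no nonzero form vanishes on its image.  The fibre over
  \<open>(c : 1)\<close> is the curve \<open>P - c Q = 0\<close>; the generic fibre is taken to be all but finitely many of
  these, so that the fibre over \<open>(1 : 0)\<close> plays no role.
\<close>

definition rational_fibration :: "poly3 \<times> poly3 \<Rightarrow> bool" where
  "rational_fibration = (\<lambda>(P, Q).
     (\<exists>d. homog3 d P \<and> homog3 d Q) \<and> coprime P Q \<and>
     (\<forall>d h. homog2 d h \<and> eval2 const3 (P, Q) h = 0 \<longrightarrow> h = 0) \<and>
     (\<forall>\<^sub>F c in cofinite. irreducible (P - const3 c * Q) \<and> rational_curve (P - const3 c * Q)))"

text \<open>The equality \<open>f \<circ> F = f\<close> of rational maps to the projective line.\<close>

definition preserves_fibre_by_fibre :: "poly3 \<times> poly3 \<Rightarrow> rmap \<Rightarrow> bool" where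
  "preserves_fibre_by_fibre = (\<lambda>(P, Q) F. \<exists>g\<in>F.
     (eval3 const3 g P, eval3 const3 g Q) \<noteq> (0, 0) \<and>
     proportional2 (eval3 const3 g P, eval3 const3 g Q) (P, Q))"

definition fibre_group :: "poly3 \<times> poly3 \<Rightarrow> rmap monoid" where
  "fibre_group f = BirP2\<lparr>carrier := {F \<in> carrier BirP2. preserves_fibre_by_fibre f F}\<rparr>"


section \<open>The groups in the statement\<close>

definition infinite_abelian_subgroup_containing ::
  "('a, 'b) monoid_scheme \<Rightarrow> 'a \<Rightarrow> 'a set \<Rightarrow> bool" where
  "infinite_abelian_subgroup_containing G g A \<longleftrightarrow>
     subgroup A G \<and> infinite A \<and> (\<forall>a\<in>A. \<forall>b\<in>A. a \<otimes>\<^bsub>G\<^esub> b = b \<otimes>\<^bsub>G\<^esub> a) \<and> g \<in> A"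

definition Ab :: "poly3 \<times> poly3 \<Rightarrow> rmap \<Rightarrow> rmap set" where
  "Ab f \<phi> = (THE A. infinite_abelian_subgroup_containing (fibre_group f) \<phi> A \<and>
     (\<forall>B. infinite_abelian_subgroup_containing (fibre_group f) \<phi> B \<and> A \<subseteq> B \<longrightarrow> B = A))"

definition centraliser :: "('a, 'b) monoid_scheme \<Rightarrow> 'a \<Rightarrow> ('a, 'b) monoid_scheme" where
  "centraliser G g = G\<lparr>carrier := {h \<in> carrier G. h \<otimes>\<^bsub>G\<^esub> g = g \<otimes>\<^bsub>G\<^esub> h}\<rparr>"

definition finite_extension :: "('a, 'b) monoid_scheme \<Rightarrow> 'a set \<Rightarrow> bool" where
  "finite_extension G N \<longleftrightarrow> N \<lhd> G \<and> finite (rcosets\<^bsub>G\<^esub> N)"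

end

theory Submission
  imports Defs "HOL-Analysis.Continuum_Not_Denumerable" "HOL-Computational_Algebra.Field_as_Ring"
begin

text \<open>
  Write \<open>f = (P : Q)\<close> and let \<open>C\<^sub>c\<close> be the fibre \<open>P - c Q = 0\<close>.  The classical argument conjugates \<open>f\<close> to
  the projection \<open>(x, y) \<mapsto> y\<close>, represents \<open>\<phi>\<close> by a matrix \<open>M\<close> over \<open>\<complex>(y)\<close> and shows that linear growth
  makes \<open>tr(M)\<^sup>2 / det(M)\<close> a nonconstant function of \<open>y\<close>; the action of a map commuting with \<open>\<phi>\<close> on the base
  preserves this function and so belongs to a finite group.  The proof below keeps this idea but works
  on individual fibres, so that no section of \<open>f\<close> has to be found.  Almost every \<open>C\<^sub>c\<close> is an irreducible
  rational curve with a parametrisation \<open>u\<close> by binary forms, and \<open>\<phi>\<close> restricts to it as a Moebius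
  transformation (\<open>fibre_moebius\<close>).

  \<^emph>\<open>The group \<open>Ab(\<phi>)\<close>.\<close>  In \<open>PGL\<^sub>2(\<complex>)\<close> the elements commuting with a transformation that is not of order at
  most two commute with one another.  Applied on infinitely many fibres, this shows that the fibrewise
  maps commuting with \<open>\<phi>\<close> form an abelian group (\<open>fibrewise_centraliser_commutative\<close>).  It contains every
  abelian group of fibrewise maps through \<open>\<phi>\<close>, and hence is \<open>Ab(\<phi>)\<close>.

  \<^emph>\<open>The centraliser acts on the base.\<close>  Let \<open>\<psi>\<close> commute with \<open>\<phi>\<close>.  The function \<open>f \<circ> \<psi>\<close> is invariant under \<open>\<phi>\<close>,
  which on all but countably many fibres is a Moebius transformation of infinite order; therefore
  \<open>f \<circ> \<psi>\<close> is constant on these fibres (\<open>pullback_constant_on_fibres\<close>).  A count of coefficients turns this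
  into \<open>f \<circ> \<psi> = h \<circ> f\<close> for a rational function \<open>h\<close> (\<open>constant_on_fibres_imp_base_function\<close>), and since the
  same holds for the inverse of \<open>\<psi>\<close>, \<open>h\<close> is a Moebius transformation (\<open>centraliser_acts\<close>).  Thus \<open>Ab(\<phi>)\<close> is
  the kernel of an action of \<open>C(\<phi>)\<close> on the base.

  \<^emph>\<open>The image is finite.\<close>  Otherwise there are \<open>\<psi>\<^sub>n\<close> in \<open>C(\<phi>)\<close> inducing distinct \<open>h\<^sub>n\<close>.  Fix one very general
  fibre \<open>C\<^sub>c\<close> with parametrisation \<open>u\<close>, on which \<open>\<phi>\<close> is given by the matrix \<open>M\<close>.  The curves
  \<open>\<psi>\<^sub>n \<circ> u\<close> parametrise infinitely many distinct fibres, and on each of them \<open>\<phi>\<close> is given by the same \<open>M\<close>.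
  By Cayley-Hamilton \<open>M\<^sup>k\<close> is, for \<open>k \<ge> 2\<close>, proportional to \<open>1 + t\<^sub>k M\<close>, so on all these curves the coordinates of
  \<open>\<phi>\<^sup>k\<close> are fractions whose numerators and denominators depend on \<open>k\<close> only through the
  powers of the number \<open>t\<^sub>k\<close>, and the degrees of these fractions are bounded independently of \<open>n\<close>
  (\<open>coordinate_degree_le\<close>).  Since a rational function on the plane is determined by its
  restrictions to infinitely many fibres, linear algebra over the function field of the plane shows that
  the iterates \<open>\<phi>\<^sup>k\<close> have bounded degree (\<open>bounded_denominator\<close>, \<open>iterates_bounded\<close>), contrary
  to linear growth.  This replaces the invariant \<open>tr(M)\<^sup>2 / det(M)\<close>.
\<close>

section \<open>Evaluation homomorphisms\<close>

definition rhom :: "('a::comm_ring_1 \<Rightarrow> 'b::comm_ring_1) \<Rightarrow> bool" where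
  "rhom h \<longleftrightarrow> h 0 = 0 \<and> h 1 = 1 \<and> (\<forall>a b. h (a + b) = h a + h b) \<and> (\<forall>a b. h (a * b) = h a * h b)"

lemma rhomD:
  assumes "rhom h"
  shows "h 0 = 0" "h 1 = 1" "h (a + b) = h a + h b" "h (a * b) = h a * h b"
    "h (- a) = - h a" "h (a - b) = h a - h b" "h (a ^ n) = h a ^ n"
proof -
  show *: "h 0 = 0" "h 1 = 1" and add: "\<And>a b. h (a + b) = h a + h b"
    and mult: "\<And>a b. h (a * b) = h a * h b"
    using assms by (auto simp: rhom_def)
  show uminus: "h (- a) = - h a" for a
    using add[of a "- a"] *(1) by (simp add: eq_neg_iff_add_eq_0 add.commute)
  show "h (a - b) = h a - h b"
    using add[of a "- b"] uminus[of b] by simp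
  show "h (a ^ n) = h a ^ n"
    by (induction n) (simp_all add: * mult)
qed

lemma rhom_sum: "rhom h \<Longrightarrow> h (sum f A) = (\<Sum>x\<in>A. h (f x))"
  by (induction A rule: infinite_finite_induct) (simp_all add: rhomD)

lemma rhom_comp: "rhom e \<Longrightarrow> rhom h \<Longrightarrow> rhom (\<lambda>x. e (h x))"
  by (simp add: rhom_def)

lemma poly_map_poly_pCons:
  "h 0 = 0 \<Longrightarrow> poly (map_poly h (pCons c p)) a = h c + a * poly (map_poly h p) (a::'b::comm_ring_1)"
  by (simp add: map_poly_pCons)

lemma rhom_poly_map_poly:
  fixes h :: "'a::comm_ring_1 \<Rightarrow> 'b::comm_ring_1"
  assumes "rhom h"
  shows "rhom (\<lambda>p. poly (map_poly h p) a)"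
proof -
  have h0: "h 0 = 0" using assms by (simp add: rhomD)
  have add: "poly (map_poly h (p + q)) a = poly (map_poly h p) a + poly (map_poly h q) a" for p q
    by (induction p q rule: poly_induct2)
      (simp_all add: poly_map_poly_pCons h0 rhomD[OF assms] algebra_simps)
  have smult: "poly (map_poly h (smult c p)) a = h c * poly (map_poly h p) a" for c p
    by (induction p) (simp_all add: poly_map_poly_pCons h0 rhomD[OF assms] algebra_simps)
  have "poly (map_poly h (p * q)) a = poly (map_poly h p) a * poly (map_poly h q) a" for p q
    by (induction p)
      (simp_all add: poly_map_poly_pCons h0 rhomD[OF assms] add smult algebra_simps)
  then show ?thesis
    using add by (simp add: rhom_def rhomD[OF assms])
qed

text \<open>A ring homomorphism on a polynomial ring is determined on constants and variables.\<close>

lemma rhom_pCons_ext: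
  assumes "rhom e" "rhom e'" and c: "\<And>c. e [:c:] = e' [:c:]" and x: "e [:0, 1:] = e' [:0, 1:]"
  shows "e p = e' p"
proof (induction p)
  case 0
  then show ?case using assms by (simp add: rhomD)
next
  case (pCons c p)
  have *: "pCons c p = [:c:] + [:0, 1:] * p" by simp
  show ?case
    unfolding * using pCons by (simp only: rhomD[OF assms(1)] rhomD[OF assms(2)] c x)
qed

lemma rhom_const: "rhom (\<lambda>c. [:c:])"
  by (simp add: rhom_def)

lemma rhom_const2 [simp]: "rhom const2" and rhom_const3 [simp]: "rhom const3"
  and rhom_id [simp]: "rhom (\<lambda>c. c)"
  by (simp_all add: rhom_def const2_def const3_def one_pCons)

lemma rhom_eval1: "rhom h \<Longrightarrow> rhom (eval1 h a)"
  unfolding eval1_def by (rule rhom_poly_map_poly)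

lemma rhom_eval2 [simp]: "rhom h \<Longrightarrow> rhom (eval2 h g)"
  unfolding eval2_def by (cases g) (simp add: rhom_poly_map_poly rhom_eval1)

lemma rhom_eval3 [simp]: "rhom h \<Longrightarrow> rhom (eval3 h g)"
  unfolding eval3_def by (cases g) (simp add: rhom_poly_map_poly)

lemmas eval2_simps [simp] = rhomD[OF rhom_eval2]
lemmas eval3_simps [simp] = rhomD[OF rhom_eval3]

lemma eval1_const: "rhom h \<Longrightarrow> eval1 h a [:c:] = h c"
  and eval1_var: "rhom h \<Longrightarrow> eval1 h a [:0, 1:] = a"
  by (simp_all add: eval1_def map_poly_pCons rhomD)

lemma eval2_const1: "rhom h \<Longrightarrow> eval2 h (a, b) [:p:] = eval1 h a p"
  by (simp add: eval2_def map_poly_pCons rhomD rhom_eval1)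

lemma eval2_gens [simp]:
  assumes "rhom h"
  shows "eval2 h g (const2 c) = h c" "eval2 h g varS = fst g" "eval2 h g varT = snd g"
  using assms by (cases g; simp add: const2_def varS_def varT_def eval2_const1 eval1_const eval1_var;
    simp add: eval2_def map_poly_pCons rhomD rhom_eval1)+

lemma eval3_const2: "rhom h \<Longrightarrow> eval3 h (a, b, c) [:p:] = eval2 h (a, b) p"
  by (simp add: eval3_def map_poly_pCons rhomD rhom_eval1)

lemma eval3_gens [simp]:
  assumes "rhom h"
  shows "eval3 h g (const3 c) = h c" "eval3 h g varX = fst g" "eval3 h g varY = fst (snd g)"
    "eval3 h g varZ = snd (snd g)"
proof -
  obtain a b d where g: "g = (a, b, d)" by (cases g)
  show "eval3 h g (const3 c) = h c" "eval3 h g varX = fst g" "eval3 h g varY = fst (snd g)"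
    using eval2_gens[OF assms, of "(a, b)"] assms
    by (simp_all add: g const3_def varX_def varY_def eval3_const2 const2_def varS_def varT_def)
  show "eval3 h g varZ = snd (snd g)"
    using assms by (simp add: g varZ_def eval3_def map_poly_pCons rhomD)
qed

lemma rhom_poly2_ext:
  assumes "rhom e" "rhom e'" "\<And>c. e (const2 c) = e' (const2 c)" "e varS = e' varS" "e varT = e' varT"
  shows "e F = e' F"
proof (rule rhom_pCons_ext[OF assms(1,2)])
  show "e [:0, 1:] = e' [:0, 1:]" using assms(5) by (simp add: varT_def)
  show "e [:p:] = e' [:p:]" for p
    by (rule rhom_pCons_ext[where e = "\<lambda>p. e [:p:]" and e' = "\<lambda>p. e' [:p:]"])
      (use assms(3,4) in \<open>auto intro!: rhom_comp[OF _ rhom_const] assms(1,2) simp: const2_def varS_def\<close>)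
qed

lemma rhom_poly3_ext:
  assumes "rhom e" "rhom e'" "\<And>c. e (const3 c) = e' (const3 c)"
    "e varX = e' varX" "e varY = e' varY" "e varZ = e' varZ"
  shows "e F = e' F"
proof (rule rhom_pCons_ext[OF assms(1,2)])
  show "e [:0, 1:] = e' [:0, 1:]" using assms(6) by (simp add: varZ_def)
  show "e [:p:] = e' [:p:]" for p
    by (rule rhom_poly2_ext[where e = "\<lambda>p. e [:p:]" and e' = "\<lambda>p. e' [:p:]"])
      (use assms(3-5) in \<open>auto intro!: rhom_comp[OF _ rhom_const] assms(1,2)
         simp: const2_def varS_def const3_def varX_def varY_def varT_def\<close>)
qed

definition map_triple :: "('a \<Rightarrow> 'b) \<Rightarrow> 'a \<times> 'a \<times> 'a \<Rightarrow> 'b \<times> 'b \<times> 'b" where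
  "map_triple e g = (e (fst g), e (fst (snd g)), e (snd (snd g)))"

definition map_pair :: "('a \<Rightarrow> 'b) \<Rightarrow> 'a \<times> 'a \<Rightarrow> 'b \<times> 'b" where
  "map_pair e g = (e (fst g), e (snd g))"

lemma map_triple_simps [simp]: "map_triple e (a, b, c) = (e a, e b, e c)"
  "fst (map_triple e g) = e (fst g)" "fst (snd (map_triple e g)) = e (fst (snd g))"
  "snd (snd (map_triple e g)) = e (snd (snd g))"
  by (simp_all add: map_triple_def)

lemma map_pair_simps [simp]: "map_pair e (a, b) = (e a, e b)"
  "fst (map_pair e g) = e (fst g)" "snd (map_pair e g) = e (snd g)"
  by (simp_all add: map_pair_def)

lemma map_triple_map_triple: "map_triple e (map_triple e' g) = map_triple (\<lambda>x. e (e' x)) g"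
  and map_pair_map_pair: "map_pair e (map_pair e' v) = map_pair (\<lambda>x. e (e' x)) v"
  by (simp_all add: map_triple_def map_pair_def)

lemma subst3_eq: "subst3 f g = map_triple (eval3 const3 g) f"
  by (cases f) (simp add: subst3_def)

text \<open>
  All composition laws between rational maps, curves and linear substitutions are instances of one
  fact: a ring homomorphism may be pushed through an evaluation.
\<close>

lemma hom_eval2:
  assumes "rhom e" "rhom h"
  shows "e (eval2 h g F) = eval2 (\<lambda>c. e (h c)) (map_pair e g) F"
  by (rule rhom_poly2_ext[where F = F]) (use assms in \<open>simp_all add: rhom_comp\<close>)

lemma hom_eval3:
  assumes "rhom e" "rhom h"
  shows "e (eval3 h g F) = eval3 (\<lambda>c. e (h c)) (map_triple e g) F"
  by (rule rhom_poly3_ext[where F = F]) (use assms in \<open>simp_all add: rhom_comp\<close>)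

lemma eval2_eval2: "rhom h \<Longrightarrow> rhom h' \<Longrightarrow> (\<And>c. eval2 h g (h' c) = h'' c) \<Longrightarrow>
    eval2 h g (eval2 h' g' F) = eval2 h'' (map_pair (eval2 h g) g') F"
  by (subst hom_eval2) simp_all

lemma eval2_eval3: "rhom h \<Longrightarrow> rhom h' \<Longrightarrow> (\<And>c. eval2 h g (h' c) = h'' c) \<Longrightarrow>
    eval2 h g (eval3 h' g' F) = eval3 h'' (map_triple (eval2 h g) g') F"
  by (subst hom_eval3) simp_all

lemma eval3_eval2: "rhom h \<Longrightarrow> rhom h' \<Longrightarrow> (\<And>c. eval3 h g (h' c) = h'' c) \<Longrightarrow>
    eval3 h g (eval2 h' g' F) = eval2 h'' (map_pair (eval3 h g) g') F"
  by (subst hom_eval2) simp_all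

lemma eval3_eval3: "rhom h \<Longrightarrow> rhom h' \<Longrightarrow> (\<And>c. eval3 h g (h' c) = h'' c) \<Longrightarrow>
    eval3 h g (eval3 h' g' F) = eval3 h'' (map_triple (eval3 h g) g') F"
  by (subst hom_eval3) simp_all

lemma eval3_vars: "eval3 const3 (varX, varY, varZ) F = F"
  by (rule rhom_poly3_ext[where e' = "\<lambda>F. F" and F = F]) simp_all

lemma eval2_vars: "eval2 const2 (varS, varT) F = F"
  by (rule rhom_poly2_ext[where e' = "\<lambda>F. F" and F = F]) simp_all

section \<open>Homogeneity\<close>

lemma poly_map_poly_sum:
  fixes x :: "'b::comm_ring_1"
  shows "f 0 = 0 \<Longrightarrow> poly (map_poly f p) x = (\<Sum>i\<le>degree p. f (coeff p i) * x ^ i)"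
proof -
  assume f0: "f 0 = 0"
  have "poly (map_poly f p) x = (\<Sum>i\<le>degree (map_poly f p). coeff (map_poly f p) i * x ^ i)"
    by (rule poly_altdef)
  also have "\<dots> = (\<Sum>i\<le>degree p. coeff (map_poly f p) i * x ^ i)"
    by (rule sum.mono_neutral_left) (auto simp: map_poly_degree_leq coeff_eq_0)
  finally show ?thesis using f0 by (simp add: coeff_map_poly)
qed

lemma eval2_sum:
  assumes "rhom h"
  shows "eval2 h (a, b) F =
    (\<Sum>j\<le>degree F. \<Sum>i\<le>degree (coeff F j). h (coeff (coeff F j) i) * a ^ i * b ^ j)"
  using assms by (simp add: eval2_def poly_map_poly_sum rhomD rhom_eval1 sum_distrib_right)
    (simp add: eval1_def poly_map_poly_sum rhomD sum_distrib_right)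

lemma eval3_sum:
  assumes "rhom h"
  shows "eval3 h (a, b, c) F =
    (\<Sum>k\<le>degree F. \<Sum>j\<le>degree (coeff F k). \<Sum>i\<le>degree (coeff (coeff F k) j).
       h (coeff (coeff (coeff F k) j) i) * a ^ i * b ^ j * c ^ k)"
  using assms by (simp add: eval3_def poly_map_poly_sum rhomD sum_distrib_right)
    (simp add: eval2_sum sum_distrib_right)

lemma homog2_scale:
  assumes "homog2 d F" "rhom h"
  shows "eval2 h (r * a, r * b) F = r ^ d * eval2 h (a, b) F"
proof -
  have "h (coeff (coeff F j) i) * (r * a) ^ i * (r * b) ^ j =
      r ^ d * (h (coeff (coeff F j) i) * a ^ i * b ^ j)" for i j
  proof (cases "coeff (coeff F j) i = 0")
    case False
    then have "i + j = d" using assms(1) by (auto simp: homog2_def)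
    then show ?thesis by (auto simp: power_mult_distrib power_add)
  qed (use assms in \<open>simp add: rhomD\<close>)
  then show ?thesis
    using assms(2) by (simp add: eval2_sum sum_distrib_left)
qed

lemma homog3_scale:
  assumes "homog3 d F" "rhom h"
  shows "eval3 h (r * a, r * b, r * c) F = r ^ d * eval3 h (a, b, c) F"
proof -
  have "h (coeff (coeff (coeff F k) j) i) * (r * a) ^ i * (r * b) ^ j * (r * c) ^ k =
      r ^ d * (h (coeff (coeff (coeff F k) j) i) * a ^ i * b ^ j * c ^ k)" for i j k
  proof (cases "coeff (coeff (coeff F k) j) i = 0")
    case False
    then have "i + j + k = d" using assms(1) by (auto simp: homog3_def)
    then show ?thesis by (auto simp: power_mult_distrib power_add)
  qed (use assms in \<open>simp add: rhomD\<close>)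
  then show ?thesis
    using assms(2) by (simp add: eval3_sum sum_distrib_left)
qed

text \<open>
  The grading of a polynomial ring is read off from \<open>F(wX, wY, wZ)\<close> as a polynomial in the new
  variable \<open>w\<close>: its coefficients are the homogeneous components.  This turns statements about
  homogeneity into identities between ring homomorphisms.
\<close>

definition grade2 :: "poly2 \<Rightarrow> poly2 poly" where
  "grade2 = eval2 (\<lambda>c. [:const2 c:]) ([:0, varS:], [:0, varT:])"

definition grade3 :: "poly3 \<Rightarrow> poly3 poly" where
  "grade3 = eval3 (\<lambda>c. [:const3 c:]) ([:0, varX:], [:0, varY:], [:0, varZ:])"

lemma rhom_const2_poly [simp]: "rhom (\<lambda>c. [:const2 c:])"
  and rhom_const3_poly [simp]: "rhom (\<lambda>c. [:const3 c:])"
  by (simp_all add: rhom_def const2_def const3_def one_pCons)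

lemma rhom_grade2: "rhom grade2" and rhom_grade3: "rhom grade3"
  unfolding grade2_def grade3_def by simp_all

lemmas grade3_simps [simp] = rhomD[OF rhom_grade3]
lemmas grade2_simps [simp] = rhomD[OF rhom_grade2]

lemma monom_pow: "[:0, a:] ^ n = monom (a ^ n) n" for a :: "'a::comm_ring_1"
  by (induction n) (simp_all add: monom_altdef algebra_simps power_commutes)

lemma mono2: "const2 c * varS ^ i * varT ^ j = monom (monom c i) j"
proof -
  have "varS ^ i = [:monom 1 i:]"
    unfolding varS_def by (induction i) (simp_all add: monom_altdef one_pCons)
  moreover have "varT ^ j = monom 1 j"
    unfolding varT_def by (simp add: monom_altdef)
  ultimately show ?thesis
    by (simp add: const2_def smult_monom)
qed

lemma mono3: "const3 c * varX ^ i * varY ^ j * varZ ^ k = monom (monom (monom c i) j) k"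
proof -
  have "varX ^ i = [:[:monom 1 i:]:]"
    unfolding varX_def by (induction i) (simp_all add: monom_altdef one_pCons)
  moreover have "varY ^ j = [:monom 1 j:]"
    unfolding varY_def by (induction j) (simp_all add: monom_altdef one_pCons)
  moreover have "varZ ^ k = monom 1 k"
    unfolding varZ_def by (simp add: monom_altdef)
  ultimately show ?thesis
    by (simp add: const3_def smult_monom)
qed

lemma coeff_grade2:
  "coeff (coeff (coeff (grade2 F) n) j) i = (if i + j = n then coeff (coeff F j) i else 0)"
proof -
  have "grade2 F = (\<Sum>j\<le>degree F. \<Sum>i\<le>degree (coeff F j).
      monom (monom (monom (coeff (coeff F j) i) i) j) (i + j))"
    unfolding grade2_def eval2_sum[OF rhom_const2_poly]
    by (intro sum.cong refl) (simp add: monom_pow mult_monom smult_monom mono2[symmetric] algebra_simps)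
  then have "coeff (coeff (coeff (grade2 F) n) j) i =
    (\<Sum>j'\<le>degree F. \<Sum>i'\<le>degree (coeff F j').
       if j' = j then if i' = i then if i + j = n then coeff (coeff F j) i else 0 else 0 else 0)"
    by (auto simp: coeff_sum intro!: sum.cong)
  also have "\<dots> = (\<Sum>j'\<le>degree F. if j' = j then
      if i \<le> degree (coeff F j) \<and> i + j = n then coeff (coeff F j) i else 0 else 0)"
    by (intro sum.cong refl, rename_tac j', case_tac "j' = j") auto
  also have "\<dots> = (if i + j = n then coeff (coeff F j) i else 0)"
    by (auto simp: coeff_eq_0 not_le)
  finally show ?thesis .
qed

lemma coeff_grade3:
  "coeff (coeff (coeff (coeff (grade3 F) n) k) j) i =
     (if i + j + k = n then coeff (coeff (coeff F k) j) i else 0)"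
proof -
  have "grade3 F = (\<Sum>k\<le>degree F. \<Sum>j\<le>degree (coeff F k). \<Sum>i\<le>degree (coeff (coeff F k) j).
      monom (monom (monom (monom (coeff (coeff (coeff F k) j) i) i) j) k) (i + j + k))"
    unfolding grade3_def eval3_sum[OF rhom_const3_poly]
    by (intro sum.cong refl) (simp add: monom_pow mult_monom smult_monom mono3[symmetric] algebra_simps)
  then have "coeff (coeff (coeff (coeff (grade3 F) n) k) j) i =
    (\<Sum>k'\<le>degree F. \<Sum>j'\<le>degree (coeff F k'). \<Sum>i'\<le>degree (coeff (coeff F k') j').
       if k' = k then if j' = j then if i' = i then if i + j + k = n then coeff (coeff (coeff F k) j) i
         else 0 else 0 else 0 else 0)"
    by (auto simp: coeff_sum intro!: sum.cong)
  also have "\<dots> = (\<Sum>k'\<le>degree F. \<Sum>j'\<le>degree (coeff F k').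
      if k' = k then if j' = j then if i \<le> degree (coeff (coeff F k) j) \<and> i + j + k = n
        then coeff (coeff (coeff F k) j) i else 0 else 0 else 0)"
    by (intro sum.cong refl, rename_tac k' j', case_tac "k' = k \<and> j' = j") auto
  also have "\<dots> = (\<Sum>k'\<le>degree F. if k' = k then
      if j \<le> degree (coeff F k) \<and> i \<le> degree (coeff (coeff F k) j) \<and> i + j + k = n
        then coeff (coeff (coeff F k) j) i else 0 else 0)"
    by (intro sum.cong refl, rename_tac k', case_tac "k' = k") auto
  also have "\<dots> = (if i + j + k = n then coeff (coeff (coeff F k) j) i else 0)"
    by (auto simp: coeff_eq_0 not_le)
  finally show ?thesis .
qed

lemma homog2_iff: "homog2 d F \<longleftrightarrow> grade2 F = monom F d"
proof
  assume "homog2 d F"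
  then show "grade2 F = monom F d"
    by (intro poly_eqI) (auto simp: coeff_grade2 homog2_def)
next
  assume *: "grade2 F = monom F d"
  show "homog2 d F"
    unfolding homog2_def
  proof (intro allI impI)
    fix i j assume "coeff (coeff F j) i \<noteq> 0"
    with coeff_grade2[of F "i + j" j i] * show "i + j = d" by (auto split: if_splits)
  qed
qed

lemma homog3_iff: "homog3 d F \<longleftrightarrow> grade3 F = monom F d"
proof
  assume "homog3 d F"
  then show "grade3 F = monom F d"
    by (intro poly_eqI) (auto simp: coeff_grade3 homog3_def)
next
  assume *: "grade3 F = monom F d"
  show "homog3 d F"
    unfolding homog3_def
  proof (intro allI impI)
    fix i j k assume "coeff (coeff (coeff F k) j) i \<noteq> 0"
    with coeff_grade3[of F "i + j + k" k j i] * show "i + j + k = d" by (auto split: if_splits)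
  qed
qed

lemma homog3_coeff_grade3: "homog3 n (coeff (grade3 F) n)"
  by (auto simp: homog3_def coeff_grade3)

lemma poly_grade3: "poly (grade3 F) 1 = F"
proof -
  have *: "rhom (\<lambda>p. poly p (1::poly3))" by (simp add: rhom_def)
  show ?thesis
    by (rule rhom_poly3_ext[where e' = "\<lambda>F. F" and F = F])
      (simp_all add: rhom_comp[OF * rhom_grade3], simp_all add: grade3_def)
qed

lemma grade3_eq_0_iff [simp]: "grade3 F = 0 \<longleftrightarrow> F = 0"
  using poly_grade3[of F] by auto

lemma homog3_0 [simp]: "homog3 d 0" and homog2_0 [simp]: "homog2 d 0"
  by (simp_all add: homog3_def homog2_def)

lemma homog3_const3 [simp]: "homog3 0 (const3 c)" and homog2_const2 [simp]: "homog2 0 (const2 c)"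
  by (simp_all add: homog3_iff homog2_iff grade3_def grade2_def monom_0)

lemma homog3_vars [simp]: "homog3 1 varX" "homog3 1 varY" "homog3 1 varZ"
  by (simp_all add: homog3_iff grade3_def monom_altdef)

lemma homog2_vars [simp]: "homog2 1 varS" "homog2 1 varT"
  by (simp_all add: homog2_iff grade2_def monom_altdef)

lemma homog3_add: "homog3 d F \<Longrightarrow> homog3 d G \<Longrightarrow> homog3 d (F + G)"
  and homog3_diff: "homog3 d F \<Longrightarrow> homog3 d G \<Longrightarrow> homog3 d (F - G)"
  and homog3_mult: "homog3 d F \<Longrightarrow> homog3 e G \<Longrightarrow> homog3 (d + e) (F * G)"
  by (simp_all add: homog3_iff add_monom diff_monom mult_monom)

lemma homog2_add: "homog2 d A \<Longrightarrow> homog2 d B \<Longrightarrow> homog2 d (A + B)"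
  and homog2_diff: "homog2 d A \<Longrightarrow> homog2 d B \<Longrightarrow> homog2 d (A - B)"
  and homog2_mult: "homog2 d A \<Longrightarrow> homog2 e B \<Longrightarrow> homog2 (d + e) (A * B)"
  by (simp_all add: homog2_iff add_monom diff_monom mult_monom)

lemma homog3_power: "homog3 d F \<Longrightarrow> homog3 (n * d) (F ^ n)"
  by (induction n) (use homog3_const3[of 1] in \<open>simp_all add: homog3_mult const3_def one_pCons\<close>)

lemma homog2_power: "homog2 d F \<Longrightarrow> homog2 (n * d) (F ^ n)"
  by (induction n) (use homog2_const2[of 1] in \<open>simp_all add: homog2_mult const2_def one_pCons\<close>)

lemma homog3_cmult: "homog3 d F \<Longrightarrow> homog3 d (const3 c * F)"
  using homog3_mult[OF homog3_const3, of d F c] by simp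

lemma homog2_cmult: "homog2 d F \<Longrightarrow> homog2 d (const2 c * F)"
  using homog2_mult[OF homog2_const2, of d F c] by simp

lemma homog3_sum: "(\<And>i. i \<in> A \<Longrightarrow> homog3 d (F i)) \<Longrightarrow> homog3 d (sum F A)"
  by (induction A rule: infinite_finite_induct) (simp_all add: homog3_add)

lemma homog2_sum: "(\<And>i. i \<in> A \<Longrightarrow> homog2 d (F i)) \<Longrightarrow> homog2 d (sum F A)"
  by (induction A rule: infinite_finite_induct) (simp_all add: homog2_add)

lemma homog_eval3_const3:
  assumes "homog3 d F" "homog3 e a" "homog3 e b" "homog3 e c"
  shows "homog3 (d * e) (eval3 const3 (a, b, c) F)"
proof -
  have "homog3 (d * e) (const3 z * a ^ i * b ^ j * c ^ k)" if "i + j + k = d" for i j k z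
    using homog3_mult[OF homog3_mult[OF homog3_mult[OF homog3_const3[of z] homog3_power[OF assms(2), of i]]
      homog3_power[OF assms(3), of j]] homog3_power[OF assms(4), of k]] that
    by (simp add: algebra_simps flip: that)
  then have "homog3 (d * e) (const3 (coeff (coeff (coeff F k) j) i) * a ^ i * b ^ j * c ^ k)" for i j k
    using assms(1)[unfolded homog3_def]
    by (cases "coeff (coeff (coeff F k) j) i = 0") (simp add: const3_def, blast)
  then show ?thesis
    by (auto simp: eval3_sum intro!: homog3_sum)
qed

lemma homog_eval2_const3:
  assumes "homog2 d F" "homog3 e a" "homog3 e b"
  shows "homog3 (d * e) (eval2 const3 (a, b) F)"
proof -
  have "homog3 (d * e) (const3 z * a ^ i * b ^ j)" if "i + j = d" for i j z
    using homog3_mult[OF homog3_mult[OF homog3_const3[of z] homog3_power[OF assms(2), of i]]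
      homog3_power[OF assms(3), of j]] that
    by (simp add: algebra_simps flip: that)
  then have "homog3 (d * e) (const3 (coeff (coeff F j) i) * a ^ i * b ^ j)" for i j
    using assms(1)[unfolded homog2_def]
    by (cases "coeff (coeff F j) i = 0") (simp add: const3_def, blast)
  then show ?thesis
    by (auto simp: eval2_sum intro!: homog3_sum)
qed

lemma homog_eval3_const2:
  assumes "homog3 d F" "homog2 e a" "homog2 e b" "homog2 e c"
  shows "homog2 (d * e) (eval3 const2 (a, b, c) F)"
proof -
  have "homog2 (d * e) (const2 z * a ^ i * b ^ j * c ^ k)" if "i + j + k = d" for i j k z
    using homog2_mult[OF homog2_mult[OF homog2_mult[OF homog2_const2[of z] homog2_power[OF assms(2), of i]]
      homog2_power[OF assms(3), of j]] homog2_power[OF assms(4), of k]] that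
    by (simp add: algebra_simps flip: that)
  then have "homog2 (d * e) (const2 (coeff (coeff (coeff F k) j) i) * a ^ i * b ^ j * c ^ k)" for i j k
    using assms(1)[unfolded homog3_def]
    by (cases "coeff (coeff (coeff F k) j) i = 0") (simp add: const2_def, blast)
  then show ?thesis
    by (auto simp: eval3_sum intro!: homog2_sum)
qed

lemma homog_eval2_const2:
  assumes "homog2 d F" "homog2 e a" "homog2 e b"
  shows "homog2 (d * e) (eval2 const2 (a, b) F)"
proof -
  have "homog2 (d * e) (const2 z * a ^ i * b ^ j)" if "i + j = d" for i j z
    using homog2_mult[OF homog2_mult[OF homog2_const2[of z] homog2_power[OF assms(2), of i]]
      homog2_power[OF assms(3), of j]] that
    by (simp add: algebra_simps flip: that)
  then have "homog2 (d * e) (const2 (coeff (coeff F j) i) * a ^ i * b ^ j)" for i j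
    using assms(1)[unfolded homog2_def]
    by (cases "coeff (coeff F j) i = 0") (simp add: const2_def, blast)
  then show ?thesis
    by (auto simp: eval2_sum intro!: homog2_sum)
qed

definition tdeg :: "poly3 \<Rightarrow> nat" where "tdeg F = degree (grade3 F)"

lemma tdeg_mult: "F \<noteq> 0 \<Longrightarrow> G \<noteq> 0 \<Longrightarrow> tdeg (F * G) = tdeg F + tdeg G"
  by (simp add: tdeg_def degree_mult_eq)

lemma tdeg_homog: "homog3 d F \<Longrightarrow> F \<noteq> 0 \<Longrightarrow> tdeg F = d"
  by (simp add: tdeg_def homog3_iff degree_monom_eq)

lemma tdeg_dvd: "F dvd G \<Longrightarrow> G \<noteq> 0 \<Longrightarrow> tdeg F \<le> tdeg G"
  by (auto simp: tdeg_mult)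

text \<open>In a graded domain the factors of a form are forms: a product of two polynomials in the
  grading variable \<open>w\<close> is a monomial only if both are.\<close>

lemma homog3_dvd:
  assumes "homog3 d F" "F \<noteq> 0" "G dvd F"
  shows "\<exists>e\<le>d. homog3 e G"
proof -
  obtain K where F: "F = G * K" using assms(3) by blast
  have eq: "grade3 G * grade3 K = monom F d"
    using assms(1) unfolding homog3_iff F by simp
  have nz: "grade3 G \<noteq> 0" "grade3 K \<noteq> 0" using assms(2) F by auto
  have "\<exists>c e. e \<le> d \<and> grade3 G = monom c e"
  proof -
    have ord: "Polynomial.order 0 (grade3 G) + Polynomial.order 0 (grade3 K) = d"
      using eq nz assms(2) by (metis order_mult mult_eq_0_iff order_0_monom)
    have deg: "degree (grade3 G) + degree (grade3 K) = d"
      using eq nz assms(2) by (metis degree_mult_eq degree_monom_eq)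
    have le: "Polynomial.order 0 (grade3 G) \<le> degree (grade3 G)" "Polynomial.order 0 (grade3 K) \<le> degree (grade3 K)"
      using nz by (auto intro: order_degree)
    have e: "Polynomial.order 0 (grade3 G) = degree (grade3 G)" using ord deg le by linarith
    have "monom 1 (degree (grade3 G)) dvd grade3 G"
      using order_1[of 0 "grade3 G"] e by (simp add: monom_altdef)
    then obtain q where q: "grade3 G = monom 1 (degree (grade3 G)) * q" by blast
    then have "degree (grade3 G) = degree (grade3 G) + degree q"
      using nz by (metis degree_mult_eq degree_monom_eq mult_eq_0_iff one_neq_zero)
    then obtain c where "q = [:c:]" using degree_eq_zeroE by auto
    then have "grade3 G = monom c (degree (grade3 G))"
      using q by (simp add: smult_monom mult.commute)
    then show ?thesis using deg by (metis le_add1)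
  qed
  then obtain c e where e: "e \<le> d" "grade3 G = monom c e" by blast
  then have "G = c" using poly_grade3[of G] by (simp add: poly_monom)
  then show ?thesis using e by (auto simp: homog3_iff)
qed

section \<open>Projective equality\<close>

text \<open>
  The relation \<^const>\<open>proportional3\<close> survives every ring homomorphism but is not transitive at the zero
  triple; equality up to nonzero factors is an equivalence and is compatible with substitution into
  forms.  Both notions agree on nonzero triples.
\<close>

definition sim3 :: "'r::idom \<times> 'r \<times> 'r \<Rightarrow> 'r \<times> 'r \<times> 'r \<Rightarrow> bool" where
  "sim3 x y \<longleftrightarrow> (\<exists>r s. r \<noteq> 0 \<and> s \<noteq> 0 \<and> map_triple ((*) r) x = map_triple ((*) s) y)"

definition sim2 :: "'r::idom \<times> 'r \<Rightarrow> 'r \<times> 'r \<Rightarrow> bool" where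
  "sim2 x y \<longleftrightarrow> (\<exists>r s. r \<noteq> 0 \<and> s \<noteq> 0 \<and> map_pair ((*) r) x = map_pair ((*) s) y)"

lemma sim3_refl [simp]: "sim3 x x"
  unfolding sim3_def by (metis one_neq_zero)

lemma sim2_refl [simp]: "sim2 x x"
  unfolding sim2_def by (metis one_neq_zero)

lemma sim3_sym: "sim3 x y \<Longrightarrow> sim3 y x"
  unfolding sim3_def by metis

lemma sim2_sym: "sim2 x y \<Longrightarrow> sim2 y x"
  unfolding sim2_def by metis

lemma sim3_trans:
  assumes "sim3 x y" "sim3 y z"
  shows "sim3 x z"
proof -
  obtain r s where 1: "r \<noteq> 0" "s \<noteq> 0" "map_triple ((*) r) x = map_triple ((*) s) y"
    using assms(1) by (auto simp: sim3_def)
  obtain p q where 2: "p \<noteq> 0" "q \<noteq> 0" "map_triple ((*) p) y = map_triple ((*) q) z"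
    using assms(2) by (auto simp: sim3_def)
  have "map_triple ((*) (p * r)) x = map_triple ((*) p) (map_triple ((*) r) x)" by (simp add: map_triple_def mult.assoc)
  also have "\<dots> = map_triple ((*) s) (map_triple ((*) p) y)" unfolding 1 by (simp add: map_triple_def mult.left_commute)
  also have "\<dots> = map_triple ((*) (s * q)) z" unfolding 2 by (simp add: map_triple_def mult.assoc)
  finally show ?thesis using 1(1,2) 2(1,2) unfolding sim3_def by (metis mult_eq_0_iff)
qed

lemma sim2_trans:
  assumes "sim2 x y" "sim2 y z"
  shows "sim2 x z"
proof -
  obtain r s where 1: "r \<noteq> 0" "s \<noteq> 0" "map_pair ((*) r) x = map_pair ((*) s) y"
    using assms(1) by (auto simp: sim2_def)
  obtain p q where 2: "p \<noteq> 0" "q \<noteq> 0" "map_pair ((*) p) y = map_pair ((*) q) z"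
    using assms(2) by (auto simp: sim2_def)
  have "map_pair ((*) (p * r)) x = map_pair ((*) p) (map_pair ((*) r) x)" by (simp add: map_pair_def mult.assoc)
  also have "\<dots> = map_pair ((*) s) (map_pair ((*) p) y)" unfolding 1 by (simp add: map_pair_def mult.left_commute)
  also have "\<dots> = map_pair ((*) (s * q)) z" unfolding 2 by (simp add: map_pair_def mult.assoc)
  finally show ?thesis using 1(1,2) 2(1,2) unfolding sim2_def by (metis mult_eq_0_iff)
qed

lemma sim3_nz: "sim3 x y \<Longrightarrow> x = (0, 0, 0) \<longleftrightarrow> y = (0, 0, 0)"
  by (cases x; cases y) (auto simp: sim3_def)

lemma sim2_nz: "sim2 x y \<Longrightarrow> x = (0, 0) \<longleftrightarrow> y = (0, 0)"
  by (cases x; cases y) (auto simp: sim2_def)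

lemma sim3_smult: "r \<noteq> 0 \<Longrightarrow> sim3 (map_triple ((*) r) x) x"
  unfolding sim3_def by (rule exI[of _ 1], rule exI[of _ r]) (simp add: map_triple_map_triple)

lemma sim2_smult: "r \<noteq> 0 \<Longrightarrow> sim2 (map_pair ((*) r) x) x"
  unfolding sim2_def by (rule exI[of _ 1], rule exI[of _ r]) (simp add: map_pair_map_pair)

lemma proportional3_of_sim3: "sim3 x y \<Longrightarrow> proportional3 x y"
proof -
  assume "sim3 x y"
  then obtain r s where rs: "r \<noteq> 0" "s \<noteq> 0" "map_triple ((*) r) x = map_triple ((*) s) y"
    by (auto simp: sim3_def)
  obtain x0 x1 x2 y0 y1 y2 where xy: "x = (x0, x1, x2)" "y = (y0, y1, y2)"
    by (cases x; cases y)
  have e: "r * x0 = s * y0" "r * x1 = s * y1" "r * x2 = s * y2" using rs by (simp_all add: xy)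
  have *: "a * d = b * c" if "r * a = s * c" "r * b = s * d" for a b c d
  proof -
    have "r * (a * d) = s * d * c" using that(1) by (simp add: algebra_simps)
    also have "\<dots> = r * (b * c)" using that(2) by (simp add: algebra_simps)
    finally show ?thesis using rs(1) by simp
  qed
  show ?thesis by (simp add: proportional3_def xy *[OF e(1,2)] *[OF e(1,3)] *[OF e(2,3)])
qed

lemma proportional2_of_sim2: "sim2 x y \<Longrightarrow> proportional2 x y"
proof -
  assume "sim2 x y"
  then obtain r s where rs: "r \<noteq> 0" "s \<noteq> 0" "map_pair ((*) r) x = map_pair ((*) s) y"
    by (auto simp: sim2_def)
  obtain a b c d where xy: "x = (a, b)" "y = (c, d)"
    by (cases x; cases y)
  have e: "r * a = s * c" "r * b = s * d" using rs by (simp_all add: xy)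
  have "r * (a * d) = s * d * c" using e(1) by (simp add: algebra_simps)
  also have "\<dots> = r * (b * c)" using e(2) by (simp add: algebra_simps)
  finally show ?thesis using rs(1) by (simp add: proportional2_def xy)
qed

lemma sim3_iff:
  assumes "x \<noteq> (0, 0, 0)" "y \<noteq> (0, 0, 0)"
  shows "sim3 x y \<longleftrightarrow> proportional3 x y"
proof
  assume p: "proportional3 x y"
  obtain x0 x1 x2 y0 y1 y2 where xy: "x = (x0, x1, x2)" "y = (y0, y1, y2)"
    by (cases x; cases y)
  have e: "x0 * y1 = x1 * y0" "x0 * y2 = x2 * y0" "x1 * y2 = x2 * y1"
    using p by (simp_all add: proportional3_def xy)
  have e0: "y0 * x0 = x0 * y0" "y0 * x1 = x0 * y1" "y0 * x2 = x0 * y2"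
    and e1: "y1 * x0 = x1 * y0" "y1 * x1 = x1 * y1" "y1 * x2 = x1 * y2"
    and e2: "y2 * x0 = x2 * y0" "y2 * x1 = x2 * y1" "y2 * x2 = x2 * y2"
    using e by (simp_all add: mult.commute)
  show "sim3 x y"
    unfolding sim3_def xy
  proof (cases "y0 \<noteq> 0"; cases "y1 \<noteq> 0")
    assume "y0 \<noteq> 0"
    moreover have "x0 \<noteq> 0" using calculation e0 assms(1) by (auto simp: xy)
    ultimately show "\<exists>r s. r \<noteq> 0 \<and> s \<noteq> 0 \<and> map_triple ((*) r) (x0, x1, x2) = map_triple ((*) s) (y0, y1, y2)"
      using e0 by (intro exI[of _ y0] exI[of _ x0]) simp
    then show "\<exists>r s. r \<noteq> 0 \<and> s \<noteq> 0 \<and> map_triple ((*) r) (x0, x1, x2) = map_triple ((*) s) (y0, y1, y2)" .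
  next
    assume "y1 \<noteq> 0"
    moreover have "x1 \<noteq> 0" using calculation e1 assms(1) by (auto simp: xy)
    ultimately show "\<exists>r s. r \<noteq> 0 \<and> s \<noteq> 0 \<and> map_triple ((*) r) (x0, x1, x2) = map_triple ((*) s) (y0, y1, y2)"
      using e1 by (intro exI[of _ y1] exI[of _ x1]) simp
  next
    assume "\<not> y0 \<noteq> 0" "\<not> y1 \<noteq> 0"
    then have "y2 \<noteq> 0" using assms(2) xy by auto
    moreover have "x2 \<noteq> 0" using calculation e2 assms(1) by (auto simp: xy)
    ultimately show "\<exists>r s. r \<noteq> 0 \<and> s \<noteq> 0 \<and> map_triple ((*) r) (x0, x1, x2) = map_triple ((*) s) (y0, y1, y2)"
      using e2 by (intro exI[of _ y2] exI[of _ x2]) simp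
  qed
qed (rule proportional3_of_sim3)

lemma sim2_iff:
  assumes "x \<noteq> (0, 0)" "y \<noteq> (0, 0)"
  shows "sim2 x y \<longleftrightarrow> proportional2 x y"
proof
  assume p: "proportional2 x y"
  obtain a b c d where xy: "x = (a, b)" "y = (c, d)" by (cases x; cases y)
  have e: "a * d = b * c" using p by (simp add: proportional2_def xy)
  show "sim2 x y"
  proof (cases "c = 0")
    case False
    moreover have "a \<noteq> 0" using calculation e assms(1) by (auto simp: xy)
    ultimately show ?thesis
      unfolding sim2_def xy using e by (intro exI[of _ c] exI[of _ a]) (simp add: mult.commute)
  next
    case True
    then have "d \<noteq> 0" "a = 0" using e assms xy by auto
    moreover have "b \<noteq> 0" using calculation assms(1) by (auto simp: xy)
    ultimately show ?thesis
      unfolding sim2_def xy using True by (intro exI[of _ d] exI[of _ b]) (simp add: mult.commute)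
  qed
qed (rule proportional2_of_sim2)

lemma proportional3_trans:
  fixes x y z :: "'r::idom \<times> 'r \<times> 'r"
  assumes "proportional3 x y" "proportional3 y z" "y \<noteq> (0, 0, 0)"
  shows "proportional3 x z"
proof (cases "x = (0, 0, 0) \<or> z = (0, 0, 0)")
  case True
  then show ?thesis by (cases x; cases z) (auto simp: proportional3_def)
next
  case False
  then show ?thesis using assms sim3_iff sim3_trans by blast
qed

lemma proportional3_hom: "rhom e \<Longrightarrow> proportional3 x y \<Longrightarrow> proportional3 (map_triple e x) (map_triple e y)"
  by (cases x; cases y) (simp add: proportional3_def flip: rhomD)

lemma proportional2_hom: "rhom e \<Longrightarrow> proportional2 x y \<Longrightarrow> proportional2 (map_pair e x) (map_pair e y)"
  by (cases x; cases y) (simp add: proportional2_def flip: rhomD)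

lemma sim3_hom:
  assumes "rhom e" "\<And>r. r \<noteq> 0 \<Longrightarrow> e r \<noteq> 0" "sim3 x y"
  shows "sim3 (map_triple e x) (map_triple e y)"
proof -
  obtain r s where rs: "r \<noteq> 0" "s \<noteq> 0" "map_triple ((*) r) x = map_triple ((*) s) y"
    using assms(3) by (auto simp: sim3_def)
  then have "map_triple ((*) (e r)) (map_triple e x) = map_triple ((*) (e s)) (map_triple e y)"
    by (cases x; cases y) (simp flip: rhomD[OF assms(1)])
  then show ?thesis using rs assms(2) by (auto simp: sim3_def)
qed

lemma sim2_hom:
  assumes "rhom e" "\<And>r. r \<noteq> 0 \<Longrightarrow> e r \<noteq> 0" "sim2 x y"
  shows "sim2 (map_pair e x) (map_pair e y)"
proof -
  obtain r s where rs: "r \<noteq> 0" "s \<noteq> 0" "map_pair ((*) r) x = map_pair ((*) s) y"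
    using assms(3) by (auto simp: sim2_def)
  then have "map_pair ((*) (e r)) (map_pair e x) = map_pair ((*) (e s)) (map_pair e y)"
    by (cases x; cases y) (simp flip: rhomD[OF assms(1)])
  then show ?thesis using rs assms(2) by (auto simp: sim2_def)
qed

definition homogs3 :: "nat \<Rightarrow> poly3 \<times> poly3 \<times> poly3 \<Rightarrow> bool" where
  "homogs3 d g \<longleftrightarrow> homog3 d (fst g) \<and> homog3 d (fst (snd g)) \<and> homog3 d (snd (snd g))"

definition homogs2 :: "nat \<Rightarrow> poly2 \<times> poly2 \<times> poly2 \<Rightarrow> bool" where
  "homogs2 d g \<longleftrightarrow> homog2 d (fst g) \<and> homog2 d (fst (snd g)) \<and> homog2 d (snd (snd g))"

definition homogp3 :: "nat \<Rightarrow> poly3 \<times> poly3 \<Rightarrow> bool" where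
  "homogp3 d v \<longleftrightarrow> homog3 d (fst v) \<and> homog3 d (snd v)"

definition homogp2 :: "nat \<Rightarrow> poly2 \<times> poly2 \<Rightarrow> bool" where
  "homogp2 d v \<longleftrightarrow> homog2 d (fst v) \<and> homog2 d (snd v)"

lemma form_triple_iff: "form_triple d g \<longleftrightarrow> homogs3 d g \<and> g \<noteq> (0, 0, 0)"
  by (cases g) (simp add: form_triple_def homogs3_def)

lemma sim3_form_scale:
  assumes "homog3 d F" "rhom h" "map_triple ((*) r) x = map_triple ((*) s) y"
  shows "r ^ d * eval3 h x F = s ^ d * eval3 h y F"
proof -
  have "r ^ d * eval3 h x F = eval3 h (map_triple ((*) r) x) F"
    using homog3_scale[OF assms(1,2)] by (cases x) simp
  also have "\<dots> = s ^ d * eval3 h y F"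
    using homog3_scale[OF assms(1,2)] unfolding assms(3) by (cases y) simp
  finally show ?thesis .
qed

lemma sim2_form_scale:
  assumes "homog2 d F" "rhom h" "map_pair ((*) r) x = map_pair ((*) s) y"
  shows "r ^ d * eval2 h x F = s ^ d * eval2 h y F"
proof -
  have "r ^ d * eval2 h x F = eval2 h (map_pair ((*) r) x) F"
    using homog2_scale[OF assms(1,2)] by (cases x) simp
  also have "\<dots> = s ^ d * eval2 h y F"
    using homog2_scale[OF assms(1,2)] unfolding assms(3) by (cases y) simp
  finally show ?thesis .
qed

lemma sim3_form_eq_0:
  "homog3 d F \<Longrightarrow> rhom h \<Longrightarrow> sim3 x y \<Longrightarrow> eval3 h x F = 0 \<longleftrightarrow> eval3 h y F = 0"
  unfolding sim3_def
  by (metis sim3_form_scale mult_eq_0_iff power_not_zero)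

lemma sim3_eval3:
  assumes "homogs3 d g" "rhom h" "sim3 x y"
  shows "sim3 (map_triple (eval3 h x) g) (map_triple (eval3 h y) g)"
proof -
  obtain r s where rs: "r \<noteq> 0" "s \<noteq> 0" "map_triple ((*) r) x = map_triple ((*) s) y"
    using assms(3) by (auto simp: sim3_def)
  have "map_triple ((*) (r ^ d)) (map_triple (eval3 h x) g) = map_triple ((*) (s ^ d)) (map_triple (eval3 h y) g)"
    using assms(1) by (simp add: map_triple_def homogs3_def sim3_form_scale[OF _ assms(2) rs(3)])
  then show ?thesis using rs unfolding sim3_def by (metis power_not_zero)
qed

lemma sim2_eval3:
  assumes "homogp3 d g" "rhom h" "sim3 x y"
  shows "sim2 (map_pair (eval3 h x) g) (map_pair (eval3 h y) g)"
proof -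
  obtain r s where rs: "r \<noteq> 0" "s \<noteq> 0" "map_triple ((*) r) x = map_triple ((*) s) y"
    using assms(3) by (auto simp: sim3_def)
  have "map_pair ((*) (r ^ d)) (map_pair (eval3 h x) g) = map_pair ((*) (s ^ d)) (map_pair (eval3 h y) g)"
    using assms(1) by (simp add: map_pair_def homogp3_def sim3_form_scale[OF _ assms(2) rs(3)])
  then show ?thesis using rs unfolding sim2_def by (metis power_not_zero)
qed

lemma sim3_eval2:
  assumes "homogs2 d g" "rhom h" "sim2 x y"
  shows "sim3 (map_triple (eval2 h x) g) (map_triple (eval2 h y) g)"
proof -
  obtain r s where rs: "r \<noteq> 0" "s \<noteq> 0" "map_pair ((*) r) x = map_pair ((*) s) y"
    using assms(3) by (auto simp: sim2_def)
  have "map_triple ((*) (r ^ d)) (map_triple (eval2 h x) g) = map_triple ((*) (s ^ d)) (map_triple (eval2 h y) g)"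
    using assms(1) by (simp add: map_triple_def homogs2_def sim2_form_scale[OF _ assms(2) rs(3)])
  then show ?thesis using rs unfolding sim3_def by (metis power_not_zero)
qed

lemma sim2_eval2:
  assumes "homogp2 d g" "rhom h" "sim2 x y"
  shows "sim2 (map_pair (eval2 h x) g) (map_pair (eval2 h y) g)"
proof -
  obtain r s where rs: "r \<noteq> 0" "s \<noteq> 0" "map_pair ((*) r) x = map_pair ((*) s) y"
    using assms(3) by (auto simp: sim2_def)
  have "map_pair ((*) (r ^ d)) (map_pair (eval2 h x) g) = map_pair ((*) (s ^ d)) (map_pair (eval2 h y) g)"
    using assms(1) by (simp add: map_pair_def homogp2_def sim2_form_scale[OF _ assms(2) rs(3)])
  then show ?thesis using rs unfolding sim2_def by (metis power_not_zero)
qed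

lemma homogs3_subst3: "homogs3 d f \<Longrightarrow> homogs3 e g \<Longrightarrow> homogs3 (d * e) (subst3 f g)"
  by (cases f; cases g) (simp add: subst3_eq homogs3_def homog_eval3_const3)

lemma homogs2_eval3: "homogs3 d f \<Longrightarrow> homogs2 e u \<Longrightarrow> homogs2 (d * e) (map_triple (eval3 const2 u) f)"
  by (cases f; cases u) (simp add: homogs2_def homogs3_def homog_eval3_const2)

lemma eval3_subst3:
  assumes "rhom h"
  shows "map_triple (eval3 h p) (subst3 f g) = map_triple (eval3 h (map_triple (eval3 h p) g)) f"
  using assms by (simp add: subst3_eq map_triple_map_triple eval3_eval3[where h'' = h])

section \<open>The plane Cremona group\<close>

text \<open>Density of the image, stated for the forms vanishing on it; it keeps all composites defined.\<close>

definition dominant :: "poly3 \<times> poly3 \<times> poly3 \<Rightarrow> bool" where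
  "dominant g \<longleftrightarrow> (\<exists>d. form_triple d g) \<and> (\<forall>F k. homog3 k F \<and> eval3 const3 g F = 0 \<longrightarrow> F = 0)"

lemma rmap_of_cong:
  assumes "sim3 x y"
  shows "rmap_of x = rmap_of y"
proof (cases "x = (0, 0, 0)")
  case True
  then show ?thesis using sim3_nz[OF assms] by simp
next
  case False
  then have "y \<noteq> (0, 0, 0)" using sim3_nz[OF assms] by simp
  then show ?thesis
    using False assms proportional3_trans proportional3_of_sim3 sim3_sym unfolding rmap_of_def by blast
qed

lemma form_triple_self: "form_triple d f \<Longrightarrow> f \<in> rmap_of f"
  unfolding rmap_of_def by (auto simp: proportional3_of_sim3)

lemma rational_mapsD:
  assumes "F \<in> rational_maps" "f \<in> F"
  shows "\<exists>d. form_triple d f" "F = rmap_of f" "g \<in> F \<longleftrightarrow> (\<exists>d. form_triple d g) \<and> sim3 f g"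
proof -
  obtain f0 d where f0: "form_triple d f0" "F = rmap_of f0"
    using assms(1) by (auto simp: rational_maps_def)
  show f: "\<exists>d. form_triple d f" using assms(2) f0 by (simp add: rmap_of_def)
  have "sim3 f0 f"
    using assms(2) f0 by (auto simp: rmap_of_def sim3_iff form_triple_iff)
  then show F: "F = rmap_of f" using f0 by (metis rmap_of_cong)
  show "g \<in> F \<longleftrightarrow> (\<exists>d. form_triple d g) \<and> sim3 f g"
    using f unfolding F rmap_of_def form_triple_iff by (auto simp: sim3_iff)
qed

lemma rational_maps_nonempty: "F \<in> rational_maps \<Longrightarrow> \<exists>f. f \<in> F"
  unfolding rational_maps_def using form_triple_self by blast

lemma dominant_cong:
  assumes "dominant f" "sim3 f g" "form_triple d g"
  shows "dominant g"
  using assms unfolding dominant_def by (metis sim3_form_eq_0 rhom_const3)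

definition dominant_maps :: "rmap set" where
  "dominant_maps = {F \<in> rational_maps. \<forall>f\<in>F. dominant f}"

lemma dominant_mapsI: "F \<in> rational_maps \<Longrightarrow> f \<in> F \<Longrightarrow> dominant f \<Longrightarrow> F \<in> dominant_maps"
  unfolding dominant_maps_def using rational_mapsD(3) dominant_cong by blast

lemma subst3_nz:
  assumes "form_triple d f" "dominant g"
  shows "\<exists>k. form_triple k (subst3 f g)"
proof -
  obtain e where "form_triple e g" using assms(2) by (auto simp: dominant_def)
  then have "homogs3 (d * e) (subst3 f g)"
    using assms(1) by (simp add: form_triple_iff homogs3_subst3)
  moreover have "subst3 f g \<noteq> (0, 0, 0)"
  proof
    assume "subst3 f g = (0, 0, 0)"
    then have "f = (0, 0, 0)"
      using assms by (cases f) (auto simp: subst3_eq dominant_def form_triple_iff homogs3_def)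
    then show False using assms(1) by (simp add: form_triple_iff)
  qed
  ultimately show ?thesis by (auto simp: form_triple_iff)
qed

lemma subst3_cong:
  assumes "form_triple d f" "form_triple d' f'" "dominant g" "dominant g'" "sim3 f f'" "sim3 g g'"
  shows "sim3 (subst3 f g) (subst3 f' g')"
proof (rule sim3_trans)
  have "subst3 f g \<noteq> (0, 0, 0)" "subst3 f' g \<noteq> (0, 0, 0)"
    using assms subst3_nz form_triple_iff by metis+
  moreover have "proportional3 (subst3 f g) (subst3 f' g)"
    using assms(5) by (simp add: subst3_eq proportional3_hom proportional3_of_sim3)
  ultimately show "sim3 (subst3 f g) (subst3 f' g)" by (simp add: sim3_iff)
  show "sim3 (subst3 f' g) (subst3 f' g')"
    using assms by (auto simp: subst3_eq form_triple_iff intro: sim3_eval3)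
qed

lemma rmap_comp_eq:
  assumes "F \<in> rational_maps" "G \<in> dominant_maps" "f \<in> F" "g \<in> G"
  shows "rmap_comp F G = rmap_of (subst3 f g)" "rmap_comp F G \<in> rational_maps"
    "subst3 f g \<in> rmap_comp F G"
proof -
  have G: "G \<in> rational_maps" "\<And>g. g \<in> G \<Longrightarrow> dominant g"
    using assms(2) by (auto simp: dominant_maps_def)
  have fg: "\<exists>k. form_triple k (subst3 f' g')" if "f' \<in> F" "g' \<in> G" for f' g'
    using that rational_mapsD(1)[OF assms(1)] G subst3_nz by blast
  have eq: "(if subst3 f' g' = (0, 0, 0) then {} else rmap_of (subst3 f' g')) = rmap_of (subst3 f g)"
    if f': "f' \<in> F" and g': "g' \<in> G" for f' g'
  proof -
    have "sim3 f f'" "sim3 g g'"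
      using rational_mapsD(3)[OF assms(1,3)] rational_mapsD(3)[OF G(1) assms(4)] f' g' by auto
    moreover obtain d d' where "form_triple d f" "form_triple d' f'"
      using rational_mapsD(1)[OF assms(1)] f' assms(3) by blast
    ultimately have "sim3 (subst3 f g) (subst3 f' g')"
      using G(2)[OF assms(4)] G(2)[OF g'] by (intro subst3_cong)
    then show ?thesis using fg[OF f' g'] rmap_of_cong[of "subst3 f g" "subst3 f' g'"]
      by (auto simp: form_triple_iff)
  qed
  have "rmap_comp F G = (\<Union>f'\<in>F. \<Union>g'\<in>G. rmap_of (subst3 f g))"
    unfolding rmap_comp_def by (intro SUP_cong refl eq)
  also have "\<dots> = rmap_of (subst3 f g)"
    using assms(3,4) by blast
  finally show eq: "rmap_comp F G = rmap_of (subst3 f g)" .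
  show "rmap_comp F G \<in> rational_maps" "subst3 f g \<in> rmap_comp F G"
    unfolding eq rational_maps_def using fg[OF assms(3,4)] form_triple_self by blast+
qed

lemma subst3_vars: "subst3 f (varX, varY, varZ) = f" "subst3 (varX, varY, varZ) g = g"
  by (cases f, simp add: subst3_eq eval3_vars) (cases g, simp add: subst3_eq)

lemma subst3_assoc: "subst3 (subst3 f g) k = subst3 f (subst3 g k)"
  by (simp add: subst3_eq map_triple_map_triple eval3_eval3[where h'' = const3])

lemma dominant_subst3:
  assumes "dominant f" "dominant g"
  shows "dominant (subst3 f g)"
proof -
  obtain d e where de: "form_triple d f" "form_triple e g"
    using assms by (auto simp: dominant_def)
  have "F = 0" if F: "homog3 k F" "eval3 const3 (subst3 f g) F = 0" for F k
  proof -
    have "eval3 const3 g (eval3 const3 f F) = 0"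
      using F(2) by (simp add: eval3_eval3[where h'' = const3] subst3_eq)
    moreover have "homog3 (k * d) (eval3 const3 f F)"
      using de(1) F(1) by (cases f) (simp add: form_triple_iff homogs3_def homog_eval3_const3)
    ultimately show ?thesis using assms F(1) unfolding dominant_def by blast
  qed
  then show ?thesis using subst3_nz[OF de(1) assms(2)] by (auto simp: dominant_def)
qed

lemma varX_nz [simp]: "varX \<noteq> 0" and varY_nz [simp]: "varY \<noteq> 0" and varZ_nz [simp]: "varZ \<noteq> 0"
  and varS_nz [simp]: "varS \<noteq> 0" and varT_nz [simp]: "varT \<noteq> 0"
  by (simp_all add: varX_def varY_def varZ_def varS_def varT_def)

lemma dominant_vars: "dominant (varX, varY, varZ)"
proof -
  have "form_triple 1 (varX, varY, varZ)" by (simp add: form_triple_def del: One_nat_def)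
  then show ?thesis by (auto simp: dominant_def eval3_vars)
qed

lemma rmap_id_dominant: "rmap_id \<in> dominant_maps" "(varX, varY, varZ) \<in> rmap_id"
proof -
  have f: "form_triple 1 (varX, varY, varZ)" by (simp add: form_triple_def del: One_nat_def)
  then show 1: "(varX, varY, varZ) \<in> rmap_id" unfolding rmap_id_def by (rule form_triple_self)
  show "rmap_id \<in> dominant_maps"
    by (rule dominant_mapsI[OF _ 1 dominant_vars]) (use f in \<open>auto simp: rational_maps_def rmap_id_def\<close>)
qed

text \<open>
  Composition is associative on dominant rational maps, where no composite is undefined; the
  birational maps are the units of this monoid.
\<close>

definition DomP2 :: "rmap monoid" where
  "DomP2 = \<lparr>carrier = dominant_maps, mult = rmap_comp, one = rmap_id\<rparr>"

lemma rmap_comp_dominant: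
  assumes "F \<in> dominant_maps" "G \<in> dominant_maps"
  shows "rmap_comp F G \<in> dominant_maps"
proof -
  have FG: "F \<in> rational_maps" "G \<in> rational_maps" using assms by (auto simp: dominant_maps_def)
  obtain f g where fg: "f \<in> F" "g \<in> G"
    using rational_maps_nonempty[OF FG(1)] rational_maps_nonempty[OF FG(2)] by blast
  then have "dominant (subst3 f g)" using assms dominant_subst3 by (auto simp: dominant_maps_def)
  then show ?thesis using rmap_comp_eq[OF FG(1) assms(2) fg] dominant_mapsI by blast
qed

lemma rational_maps_eqI:
  "F \<in> rational_maps \<Longrightarrow> G \<in> rational_maps \<Longrightarrow> f \<in> F \<Longrightarrow> f \<in> G \<Longrightarrow> F = G"
  using rational_mapsD(2)[of F f] rational_mapsD(2)[of G f] by simp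

lemma monoid_DomP2: "monoid DomP2"
proof (rule monoidI; simp add: DomP2_def rmap_comp_dominant rmap_id_dominant)
  fix F G K assume FGK: "F \<in> dominant_maps" "G \<in> dominant_maps" "K \<in> dominant_maps"
  then have r: "F \<in> rational_maps" "G \<in> rational_maps" "K \<in> rational_maps"
    by (auto simp: dominant_maps_def)
  obtain f g k where m: "f \<in> F" "g \<in> G" "k \<in> K"
    using rational_maps_nonempty[OF r(1)] rational_maps_nonempty[OF r(2)] rational_maps_nonempty[OF r(3)]
    by blast
  have 1: "subst3 (subst3 f g) k \<in> rmap_comp (rmap_comp F G) K"
    "rmap_comp (rmap_comp F G) K \<in> rational_maps"
    by (rule rmap_comp_eq(2,3)[OF rmap_comp_eq(2)[OF r(1) FGK(2) m(1,2)] FGK(3)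
      rmap_comp_eq(3)[OF r(1) FGK(2) m(1,2)] m(3)])+
  have 2: "subst3 f (subst3 g k) \<in> rmap_comp F (rmap_comp G K)"
    "rmap_comp F (rmap_comp G K) \<in> rational_maps"
    by (rule rmap_comp_eq(2,3)[OF r(1) rmap_comp_dominant[OF FGK(2,3)] m(1)
      rmap_comp_eq(3)[OF r(2) FGK(3) m(2,3)]])+
  show "rmap_comp (rmap_comp F G) K = rmap_comp F (rmap_comp G K)"
    by (rule rational_maps_eqI[OF 1(2) 2(2) 1(1)]) (use 2(1) in \<open>simp only: subst3_assoc\<close>)
next
  fix F assume F: "F \<in> dominant_maps"
  then have r: "F \<in> rational_maps" by (auto simp: dominant_maps_def)
  then obtain f where f: "f \<in> F" using rational_maps_nonempty by blast
  have i: "rmap_id \<in> rational_maps" using rmap_id_dominant by (auto simp: dominant_maps_def)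
  show "rmap_comp rmap_id F = F"
    using rmap_comp_eq(1)[OF i F rmap_id_dominant(2) f] rational_mapsD(2)[OF r f]
    by (simp add: subst3_vars)
  show "rmap_comp F rmap_id = F"
    using rmap_comp_eq(1)[OF r rmap_id_dominant(1) f rmap_id_dominant(2)] rational_mapsD(2)[OF r f]
    by (simp add: subst3_vars)
qed

text \<open>A form vanishing on the image of \<open>F\<close> pulls back to zero under \<open>F \<circ> G\<close>, which is the identity.\<close>

lemma dominant_of_right_inverse:
  assumes "F \<in> rational_maps" "rmap_comp F G = rmap_id"
  shows "F \<in> dominant_maps"
proof -
  obtain f g where fg: "f \<in> F" "g \<in> G" "subst3 f g \<noteq> (0, 0, 0)"
    "(varX, varY, varZ) \<in> rmap_of (subst3 f g)"
    using assms(2) rmap_id_dominant(2) unfolding rmap_comp_def by (fastforce split: if_splits)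
  obtain d where d: "form_triple d f" using rational_mapsD(1)[OF assms(1) fg(1)] by blast
  have sim: "sim3 (subst3 f g) (varX, varY, varZ)"
    using fg(3,4) by (simp add: rmap_of_def sim3_iff)
  have "F' = 0" if F': "homog3 k F'" "eval3 const3 f F' = 0" for F' k
  proof -
    have "eval3 const3 (subst3 f g) F' = eval3 const3 g (eval3 const3 f F')"
      by (simp add: eval3_eval3[where h'' = const3] subst3_eq)
    then have "eval3 const3 (varX, varY, varZ) F' = 0"
      using F' sim3_form_eq_0[OF F'(1) rhom_const3 sim] by simp
    then show ?thesis by (simp add: eval3_vars)
  qed
  then show ?thesis using d by (intro dominant_mapsI[OF assms(1) fg(1)]) (auto simp: dominant_def)
qed

lemma BirP2_units: "BirP2 = units_of DomP2"
proof -
  have "birational F \<longleftrightarrow> F \<in> Units DomP2" for F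
  proof
    assume "birational F"
    then obtain G where G: "F \<in> rational_maps" "G \<in> rational_maps" "rmap_comp F G = rmap_id"
      "rmap_comp G F = rmap_id" by (auto simp: birational_def)
    then show "F \<in> Units DomP2"
      using dominant_of_right_inverse by (auto simp: Units_def DomP2_def)
  next
    assume "F \<in> Units DomP2"
    then show "birational F" by (auto simp: Units_def DomP2_def birational_def dominant_maps_def)
  qed
  then show ?thesis by (simp add: BirP2_def units_of_def DomP2_def)
qed

lemma group_BirP2: "group BirP2"
  unfolding BirP2_units by (rule monoid.units_group[OF monoid_DomP2])

lemma BirP2_carrier:
  assumes "F \<in> carrier BirP2"
  shows "F \<in> rational_maps" "F \<in> dominant_maps"
  using assms by (auto simp: BirP2_units units_of_def Units_def DomP2_def dominant_maps_def)

lemma BirP2_rep: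
  assumes "F \<in> carrier BirP2"
  obtains f d where "f \<in> F" "homogs3 d f" "f \<noteq> (0, 0, 0)"
  using rational_maps_nonempty[OF BirP2_carrier(1)[OF assms]]
    rational_mapsD(1)[OF BirP2_carrier(1)[OF assms]] form_triple_iff by blast

lemma BirP2_form:
  assumes "F \<in> carrier BirP2" "f \<in> F"
  obtains d where "homogs3 d f" "f \<noteq> (0, 0, 0)"
  using rational_mapsD(1)[OF BirP2_carrier(1)[OF assms(1)] assms(2)] form_triple_iff by blast

lemma BirP2_dominant:
  "F \<in> carrier BirP2 \<Longrightarrow> f \<in> F \<Longrightarrow> homog3 k H \<Longrightarrow> eval3 const3 f H = 0 \<Longrightarrow> H = 0"
  using BirP2_carrier(2) by (auto simp: dominant_maps_def dominant_def)

lemma BirP2_mult: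
  "F \<in> carrier BirP2 \<Longrightarrow> G \<in> carrier BirP2 \<Longrightarrow> f \<in> F \<Longrightarrow> g \<in> G \<Longrightarrow> subst3 f g \<in> F \<otimes>\<^bsub>BirP2\<^esub> G"
  using rmap_comp_eq(3) BirP2_carrier by (simp add: BirP2_def)

lemma BirP2_one: "(varX, varY, varZ) \<in> \<one>\<^bsub>BirP2\<^esub>"
  using rmap_id_dominant(2) by (simp add: BirP2_def)

lemma BirP2_sim: "F \<in> carrier BirP2 \<Longrightarrow> f \<in> F \<Longrightarrow> g \<in> F \<Longrightarrow> sim3 f g"
  using rational_mapsD(3)[OF BirP2_carrier(1)] by blast

lemma BirP2_eqI:
  assumes "F \<in> carrier BirP2" "G \<in> carrier BirP2" "f \<in> F" "g \<in> G" "proportional3 f g"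
  shows "F = G"
proof -
  have "f \<noteq> (0, 0, 0)" "g \<noteq> (0, 0, 0)"
    using BirP2_form[OF assms(1,3)] BirP2_form[OF assms(2,4)] by blast+
  then have "sim3 f g" using assms(5) by (simp add: sim3_iff)
  then show ?thesis
    using rational_mapsD(2)[OF BirP2_carrier(1)[OF assms(1)] assms(3)]
      rational_mapsD(2)[OF BirP2_carrier(1)[OF assms(2)] assms(4)] rmap_of_cong by simp
qed

lemma BirP2_inv:
  assumes "F \<in> carrier BirP2" "f \<in> F" "g \<in> inv\<^bsub>BirP2\<^esub> F"
  shows "sim3 (subst3 f g) (varX, varY, varZ)" "sim3 (subst3 g f) (varX, varY, varZ)"
proof -
  interpret group BirP2 by (rule group_BirP2)
  have 1: "\<one>\<^bsub>BirP2\<^esub> \<in> carrier BirP2" by simp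
  show "sim3 (subst3 f g) (varX, varY, varZ)"
    using BirP2_mult[OF assms(1) _ assms(2,3)] BirP2_sim[OF 1 _ BirP2_one] assms(1) by simp
  show "sim3 (subst3 g f) (varX, varY, varZ)"
    using BirP2_mult[OF _ assms(1) assms(3,2)] BirP2_sim[OF 1 _ BirP2_one] assms(1) by simp
qed

section \<open>The degree of a rational map\<close>

lemma no_common_factor_dvd:
  assumes "no_common_factor (g0, g1, g2)" "x dvd g0 * y" "x dvd g1 * y" "x dvd g2 * y"
  shows "x dvd y"
proof -
  define D where "D = gcd g0 (gcd g1 g2)"
  have "D dvd g0" "D dvd g1" "D dvd g2"
    unfolding D_def by (rule gcd_dvd1 dvd_trans[OF gcd_dvd2 gcd_dvd1] dvd_trans[OF gcd_dvd2 gcd_dvd2])+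
  then have "is_unit D"
    using assms(1)[unfolded no_common_factor_def prod.case] by blast
  have "x dvd gcd (y * g1) (y * g2)" using assms(3,4) by (simp add: mult.commute)
  then have "x dvd y * gcd g1 g2" by (simp only: gcd_mult_left dvd_normalize_iff)
  then have "x dvd gcd (y * g0) (y * gcd g1 g2)" using assms(2) by (simp only: gcd_greatest_iff mult.commute)
  then have "x dvd y * D" unfolding D_def by (simp only: gcd_mult_left dvd_normalize_iff)
  then show ?thesis using \<open>is_unit D\<close> by (simp only: dvd_mult_unit_iff)
qed

text \<open>
  Two proportional triples without common factor have associated entries, so the description
  operator in \<^const>\<open>rmap_degree\<close> names an existing and unique number.
\<close>

lemma reduced_degree_unique:
  assumes "form_triple d f" "form_triple e g" "no_common_factor f" "no_common_factor g" "proportional3 f g"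
  shows "d = e"
proof -
  obtain f0 f1 f2 g0 g1 g2 where fg: "f = (f0, f1, f2)" "g = (g0, g1, g2)" by (cases f; cases g)
  have p: "f0 * g1 = f1 * g0" "f0 * g2 = f2 * g0" "f1 * g2 = f2 * g1"
    using assms(5) by (simp_all add: fg proportional3_def)
  have "f0 dvd g0" "f1 dvd g1" "f2 dvd g2" "g0 dvd f0" "g1 dvd f1" "g2 dvd f2"
  proof -
    have q: "g1 * f0 = f1 * g0" "g2 * f0 = f2 * g0" "g2 * f1 = f2 * g1"
      "g0 * f1 = f0 * g1" "g0 * f2 = f0 * g2" "g1 * f2 = f1 * g2" using p by (simp_all add: mult.commute)
    note F = no_common_factor_dvd[OF assms(3)[unfolded fg]]
    note G = no_common_factor_dvd[OF assms(4)[unfolded fg]]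
    show "f0 dvd g0" by (rule F) (use q in \<open>metis dvd_triv_left dvd_triv_right\<close>)+
    show "f1 dvd g1" by (rule F) (use q in \<open>metis dvd_triv_left dvd_triv_right\<close>)+
    show "f2 dvd g2" by (rule F) (use q in \<open>metis dvd_triv_left dvd_triv_right\<close>)+
    show "g0 dvd f0" by (rule G) (use q in \<open>metis dvd_triv_left dvd_triv_right\<close>)+
    show "g1 dvd f1" by (rule G) (use q in \<open>metis dvd_triv_left dvd_triv_right\<close>)+
    show "g2 dvd f2" by (rule G) (use q in \<open>metis dvd_triv_left dvd_triv_right\<close>)+
  qed
  moreover have "tdeg a = tdeg b" if "a dvd b" "b dvd a" "a \<noteq> 0" "b \<noteq> 0" for a b
    using tdeg_dvd[OF that(1,4)] tdeg_dvd[OF that(2,3)] by simp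
  moreover have "(f0 \<noteq> 0 \<and> g0 \<noteq> 0) \<or> (f1 \<noteq> 0 \<and> g1 \<noteq> 0) \<or> (f2 \<noteq> 0 \<and> g2 \<noteq> 0)"
    using assms(1) calculation by (auto simp: form_triple_iff fg)
  ultimately have "tdeg f0 = tdeg g0 \<and> f0 \<noteq> 0 \<and> g0 \<noteq> 0 \<or> tdeg f1 = tdeg g1 \<and> f1 \<noteq> 0 \<and> g1 \<noteq> 0 \<or>
    tdeg f2 = tdeg g2 \<and> f2 \<noteq> 0 \<and> g2 \<noteq> 0" by blast
  then show ?thesis
    using assms(1,2) tdeg_homog by (auto simp: form_triple_def fg)
qed

lemma reduced_exists:
  assumes "F \<in> rational_maps"
  shows "\<exists>g\<in>F. \<exists>d. form_triple d g \<and> no_common_factor g"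
proof -
  obtain f where f: "f \<in> F" using assms rational_maps_nonempty by blast
  then obtain d where d: "form_triple d f" using rational_mapsD(1)[OF assms] by blast
  obtain f0 f1 f2 where f012: "f = (f0, f1, f2)" by (cases f)
  define D where "D = gcd f0 (gcd f1 f2)"
  have nz: "D \<noteq> 0" using d by (auto simp: D_def form_triple_def f012)
  have "D dvd f0" "D dvd f1" "D dvd f2"
    unfolding D_def by (rule gcd_dvd1 dvd_trans[OF gcd_dvd2 gcd_dvd1] dvd_trans[OF gcd_dvd2 gcd_dvd2])+
  then obtain g0 g1 g2 where g: "f0 = D * g0" "f1 = D * g1" "f2 = D * g2" by (elim dvdE)
  have "\<exists>e. homog3 e D"
    using d homog3_dvd[of d _ D] \<open>D dvd f0\<close> \<open>D dvd f1\<close> \<open>D dvd f2\<close> unfolding form_triple_def f012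
    by auto
  then obtain e where e: "homog3 e D" by blast
  have h: "homog3 (d - e) b" if Db: "homog3 d (D * b)" for b
  proof (cases "b = 0")
    case False
    then obtain k where hk: "homog3 k b" using homog3_dvd[OF Db, of b] nz by auto
    have "k = d - e"
      using tdeg_homog[OF Db] tdeg_mult[OF nz False] tdeg_homog[OF hk False] tdeg_homog[OF e nz] nz False
      by simp
    then show ?thesis using hk by simp
  qed simp
  have ft: "form_triple (d - e) (g0, g1, g2)"
    using d h by (auto simp: form_triple_def f012 g)
  moreover have "no_common_factor (g0, g1, g2)"
    unfolding no_common_factor_def
  proof (intro case_prodI2 allI impI, clarsimp)
    fix p assume p: "p dvd g0" "p dvd g1" "p dvd g2"
    then have "D * p dvd f0" "D * p dvd f1" "D * p dvd f2"
      unfolding g by (simp_all add: mult_dvd_mono)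
    then have "D * p dvd D * 1" unfolding mult_1_right by (subst (2) D_def) (intro gcd_greatest)
    then show "is_unit p" using nz by (simp only: dvd_mult_cancel_left) simp
  qed
  moreover have "map_triple ((*) D) (g0, g1, g2) = f" by (simp add: f012 g)
  then have "sim3 f (g0, g1, g2)" using sim3_smult[OF nz] by metis
  ultimately show ?thesis using rational_mapsD(3)[OF assms f] by blast
qed

lemma rmap_degree_rep:
  assumes "F \<in> rational_maps"
  shows "\<exists>g\<in>F. form_triple (rmap_degree F) g \<and> no_common_factor g"
proof -
  obtain g d where g: "g \<in> F" "form_triple d g" "no_common_factor g"
    using reduced_exists[OF assms] by blast
  have "\<exists>f\<in>F. form_triple (THE d. \<exists>f\<in>F. form_triple d f \<and> no_common_factor f) f \<and> no_common_factor f"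
  proof (rule theI[of "\<lambda>d. \<exists>f\<in>F. form_triple d f \<and> no_common_factor f"])
    show "\<exists>f\<in>F. form_triple d f \<and> no_common_factor f" using g by blast
    fix e assume "\<exists>f\<in>F. form_triple e f \<and> no_common_factor f"
    then show "e = d"
      using g reduced_degree_unique rational_mapsD(3)[OF assms] proportional3_of_sim3 by metis
  qed
  then show ?thesis by (simp add: rmap_degree_def)
qed

section \<open>Rational functions of one variable\<close>

text \<open>
  A reduced fraction of degree \<open>m\<close> takes almost every value \<open>m\<close> times: a value \<open>\<xi>\<close> taken with
  multiplicity is the value at a zero of the Wronskian.
\<close>

lemma finite_small_fibres:
  fixes p q :: "complex poly"
  assumes "coprime p q"
  defines "m \<equiv> max (degree p) (degree q)"
  shows "finite {\<xi>. card {s. poly q s = \<xi> * poly p s} < m}"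
proof (cases "m = 0")
  case False
  define W where "W = p * pderiv q - q * pderiv p"
  have pq0: "\<not> (poly p a = 0 \<and> poly q a = 0)" for a
    using coprime_poly_0[OF assms(1), of a] by auto
  have "W \<noteq> 0"
  proof
    assume "W = 0"
    then have e: "p * pderiv q = q * pderiv p" by (simp add: W_def)
    have *: "degree a = 0" if "coprime a b" "a * pderiv b = b * pderiv a" for a b :: "complex poly"
    proof -
      have "a dvd b * pderiv a" using that(2) by (metis dvd_triv_left)
      then have "a dvd pderiv a" using that(1) by (simp add: coprime_dvd_mult_right_iff)
      then show ?thesis using not_dvd_pderiv by blast
    qed
    have "degree p = 0" "degree q = 0"
      using *[OF assms(1) e] *[of q p] assms(1) e by (simp_all add: coprime_commute)
    then show False using False by (simp add: m_def)
  qed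
  have "{\<xi>. card {s. poly q s = \<xi> * poly p s} < m} \<subseteq>
      (\<lambda>a. poly q a / poly p a) ` {a. poly W a = 0} \<union> {coeff q m / coeff p m}"
  proof (rule subsetI, rule ccontr)
    fix \<xi> assume small: "\<xi> \<in> {\<xi>. card {s. poly q s = \<xi> * poly p s} < m}"
      and n: "\<xi> \<notin> (\<lambda>a. poly q a / poly p a) ` {a. poly W a = 0} \<union> {coeff q m / coeff p m}"
    define g where "g = q - smult \<xi> p"
    have "coeff g m \<noteq> 0"
    proof
      assume *: "coeff g m = 0"
      have "coeff p m \<noteq> 0 \<or> coeff q m \<noteq> 0"
        using False by (cases "degree p \<le> degree q") (auto simp: m_def max_def leading_coeff_0_iff)
      with * have "coeff p m \<noteq> 0" by (auto simp: g_def)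
      then have "\<xi> = coeff q m / coeff p m" using * by (simp add: g_def)
      then show False using n by simp
    qed
    moreover have "degree g \<le> m"
      unfolding g_def m_def by (intro degree_diff_le order_trans[OF degree_smult_le]) auto
    ultimately have dg: "degree g = m" "g \<noteq> 0" using le_degree[of g m] by auto
    have "rsquarefree g"
      unfolding rsquarefree_roots
    proof (intro allI notI, elim conjE)
      fix a assume a: "poly g a = 0" "poly (pderiv g) a = 0"
      then have q: "poly q a = \<xi> * poly p a" "poly (pderiv q) a = \<xi> * poly (pderiv p) a"
        by (simp_all add: g_def pderiv_diff pderiv_smult)
      then have "poly W a = 0" by (simp add: W_def)
      moreover have "poly p a \<noteq> 0" using pq0[of a] q by auto
      ultimately show False using n q by force
    qed
    then have "g = smult (lead_coeff g) (\<Prod>z|poly g z = 0. [:-z, 1:])"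
      using complex_poly_decompose_rsquarefree[of g] by simp
    then have "degree g = degree (\<Prod>z|poly g z = 0. [:-z, 1:])"
      using dg(2) by (metis degree_smult_eq leading_coeff_0_iff)
    also have "\<dots> = card {s. poly g s = 0}"
      by (subst degree_prod_eq_sum_degree) auto
    finally have "card {s. poly g s = 0} = m" using dg(1) by simp
    then show False using small by (simp add: g_def)
  qed
  moreover have "finite \<dots>"
    using poly_roots_finite[OF \<open>W \<noteq> 0\<close>] by simp
  ultimately show ?thesis by (rule finite_subset)
qed simp

text \<open>
  The degree of a fraction is bounded by the number of points in its general fibres.  The polynomial
  \<open>b\<close> allows for finitely many parameter values at which a fibre cannot be controlled.
\<close>

lemma reduced_fraction_degree_le:
  fixes m0 m1 b :: "complex poly"
  assumes "\<not> (m0 = 0 \<and> m1 = 0)" "b \<noteq> 0" "finite B"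
    and small: "\<And>\<xi>. \<xi> \<notin> B \<Longrightarrow> finite {s. poly b s \<noteq> 0 \<and> poly m1 s = \<xi> * poly m0 s} \<and>
      card {s. poly b s \<noteq> 0 \<and> poly m1 s = \<xi> * poly m0 s} \<le> D"
  shows "\<exists>p q. coprime p q \<and> degree p \<le> D \<and> degree q \<le> D \<and> m0 * q = m1 * p"
proof -
  define g where "g = gcd m0 m1"
  have g0: "g \<noteq> 0" using assms(1) by (simp add: g_def)
  define p q where "p = m0 div g" and "q = m1 div g"
  have pq: "m0 = g * p" "m1 = g * q" by (simp_all add: p_def q_def g_def)
  have cop: "coprime p q"
    unfolding p_def q_def g_def using assms(1) by (intro div_gcd_coprime) auto
  define m where "m = max (degree p) (degree q)"
  define B' where "B' = B \<union> {\<xi>. card {s. poly q s = \<xi> * poly p s} < m} \<union>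
    (\<lambda>a. poly q a / poly p a) ` {a. poly b a = 0}"
  have "finite B'"
    unfolding B'_def m_def using assms(3) finite_small_fibres[OF cop] poly_roots_finite[OF assms(2)] by simp
  then obtain \<xi> where xi: "\<xi> \<notin> B'"
    using ex_new_if_finite infinite_UNIV_char_0 by blast
  have "{s. poly q s = \<xi> * poly p s} \<subseteq> {s. poly b s \<noteq> 0 \<and> poly m1 s = \<xi> * poly m0 s}"
  proof safe
    fix s assume s: "poly q s = \<xi> * poly p s"
    then show "poly m1 s = \<xi> * poly m0 s" by (simp add: pq)
    assume "poly b s = 0"
    moreover have "poly p s \<noteq> 0" using coprime_poly_0[OF cop, of s] s by auto
    ultimately show False using xi s by (force simp: B'_def)
  qed
  then have "card {s. poly q s = \<xi> * poly p s} \<le> D"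
    using small[of \<xi>] xi card_mono[of "{s. poly b s \<noteq> 0 \<and> poly m1 s = \<xi> * poly m0 s}"
      "{s. poly q s = \<xi> * poly p s}"] by (simp add: B'_def)
  moreover have "m \<le> card {s. poly q s = \<xi> * poly p s}" using xi by (simp add: B'_def)
  ultimately have "m \<le> D" by simp
  then show ?thesis using cop by (intro exI[of _ p] exI[of _ q]) (simp add: pq m_def)
qed

section \<open>Binary forms and linear substitutions\<close>

definition dehomog :: "poly2 \<Rightarrow> complex poly" where
  "dehomog = eval2 (\<lambda>c. [:c:]) ([:0, 1:], 1)"

definition homogenise :: "nat \<Rightarrow> complex poly \<Rightarrow> poly2" where
  "homogenise D p = (\<Sum>i\<le>D. const2 (coeff p i) * varS ^ i * varT ^ (D - i))"

lemma rhom_pConst [simp]: "rhom (\<lambda>c::complex. [:c:])"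
  by (rule rhom_const)

lemma rhom_dehomog: "rhom dehomog"
  by (simp add: dehomog_def)

lemmas dehomog_simps [simp] = rhomD[OF rhom_dehomog]

lemma dehomog_gens [simp]: "dehomog (const2 c) = [:c:]" "dehomog varS = [:0, 1:]" "dehomog varT = 1"
  by (simp_all add: dehomog_def)

lemma poly_dehomog: "poly (dehomog F) s = eval2 (\<lambda>c. c) (s, 1) F"
proof -
  have "rhom (\<lambda>p. poly p s)" by (simp add: rhom_def)
  then show ?thesis
    unfolding dehomog_def by (subst hom_eval2) (simp_all add: map_pair_def)
qed

lemma coeff_dehomog:
  assumes "homog2 d F"
  shows "coeff (dehomog F) i = (if i \<le> d then coeff (coeff F (d - i)) i else 0)"
proof -
  have "coeff (dehomog F) i =
      (\<Sum>j\<le>degree F. \<Sum>i'\<le>degree (coeff F j). if i' = i then coeff (coeff F j) i else 0)"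
    unfolding dehomog_def eval2_sum[OF rhom_pConst] coeff_sum
    by (intro sum.cong refl) (simp add: monom_pow)
  also have "\<dots> = (\<Sum>j\<le>degree F. coeff (coeff F j) i)"
    by (intro sum.cong refl) (auto simp: coeff_eq_0 not_le)
  also have "\<dots> = (\<Sum>j\<le>degree F. if j = d - i then if i \<le> d then coeff (coeff F (d - i)) i else 0 else 0)"
  proof (intro sum.cong refl)
    fix j
    show "coeff (coeff F j) i = (if j = d - i then if i \<le> d then coeff (coeff F (d - i)) i else 0 else 0)"
    proof (cases "coeff (coeff F j) i = 0")
      case False
      then have "i + j = d" using assms by (simp add: homog2_def)
      then show ?thesis by auto
    qed auto
  qed
  also have "\<dots> = (if i \<le> d then coeff (coeff F (d - i)) i else 0)"
    by (auto simp: coeff_eq_0 not_le)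
  finally show ?thesis .
qed

lemma dehomog_eq_0_iff:
  assumes "homog2 d F"
  shows "dehomog F = 0 \<longleftrightarrow> F = 0"
proof
  assume 0: "dehomog F = 0"
  show "F = 0"
  proof (intro poly_eqI, rule ccontr)
    fix i j assume *: "coeff (coeff F j) i \<noteq> coeff (coeff 0 j) i"
    then have "i + j = d" using assms by (simp add: homog2_def)
    then show False using * coeff_dehomog[OF assms, of i] 0 by auto
  qed
qed simp

lemma dehomog_inj: "homog2 d F \<Longrightarrow> homog2 d G \<Longrightarrow> dehomog F = dehomog G \<Longrightarrow> F = G"
  using dehomog_eq_0_iff[OF homog2_diff, of d F G] by simp

lemma homog2_homogenise: "homog2 D (homogenise D p)"
  unfolding homogenise_def
proof (rule homog2_sum)
  fix i assume "i \<in> {..D}"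
  then show "homog2 D (const2 (coeff p i) * varS ^ i * varT ^ (D - i))"
    using homog2_mult[OF homog2_cmult[OF homog2_power[OF homog2_vars(1), of i]]
      homog2_power[OF homog2_vars(2), of "D - i"]] by simp
qed

lemma dehomog_homogenise: "degree p \<le> D \<Longrightarrow> dehomog (homogenise D p) = p"
proof -
  assume "degree p \<le> D"
  have "dehomog (homogenise D p) = (\<Sum>i\<le>D. monom (coeff p i) i)"
    unfolding homogenise_def by (simp add: rhom_sum[OF rhom_dehomog] monom_pow smult_monom)
  also have "\<dots> = (\<Sum>i\<le>degree p. monom (coeff p i) i)"
    using \<open>degree p \<le> D\<close> by (intro sum.mono_neutral_right) (auto simp: coeff_eq_0)
  also have "\<dots> = p" by (rule poly_as_sum_of_monoms)
  finally show ?thesis .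
qed

type_synonym mat = "complex \<times> complex \<times> complex \<times> complex"

definition lin :: "mat \<Rightarrow> poly2 \<times> poly2" where
  "lin = (\<lambda>(a, b, c, d). (const2 a * varS + const2 b * varT, const2 c * varS + const2 d * varT))"

definition mdet :: "mat \<Rightarrow> complex" where "mdet = (\<lambda>(a, b, c, d). a * d - b * c)"

definition mmul :: "mat \<Rightarrow> mat \<Rightarrow> mat" where
  "mmul = (\<lambda>(a, b, c, d) (a', b', c', d').
     (a * a' + b * c', a * b' + b * d', c * a' + d * c', c * b' + d * d'))"

definition mscal :: "complex \<Rightarrow> mat \<Rightarrow> mat" where
  "mscal r = (\<lambda>(a, b, c, d). (r * a, r * b, r * c, r * d))"

definition scalar :: "mat \<Rightarrow> bool" where "scalar = (\<lambda>(a, b, c, d). b = 0 \<and> c = 0 \<and> a = d)"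

fun mpow :: "mat \<Rightarrow> nat \<Rightarrow> mat" where
  "mpow M 0 = (1, 0, 0, 1)"
| "mpow M (Suc n) = mmul M (mpow M n)"

definition app :: "mat \<Rightarrow> complex \<times> complex \<Rightarrow> complex \<times> complex" where
  "app = (\<lambda>(a, b, c, d) (s, t). (a * s + b * t, c * s + d * t))"

lemma mmul_assoc: "mmul (mmul A B) C = mmul A (mmul B C)"
  by (cases A; cases B; cases C) (simp add: mmul_def algebra_simps)

lemma mdet_mmul: "mdet (mmul A B) = mdet A * mdet B"
  by (cases A; cases B) (simp add: mmul_def mdet_def algebra_simps)

lemma mdet_mscal: "mdet (mscal r A) = r\<^sup>2 * mdet A"
  by (cases A) (simp add: mscal_def mdet_def algebra_simps power2_eq_square)

lemma mdet_mpow: "mdet (mpow M n) = mdet M ^ n"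
  by (induction n) (simp_all add: mdet_mmul, simp add: mdet_def)

lemma mpow_add: "mpow M (i + j) = mmul (mpow M i) (mpow M j)"
  by (induction i) (simp_all add: mmul_assoc, simp add: mmul_def split: prod.splits)

lemma app_mmul: "app (mmul A B) z = app A (app B z)"
  by (cases A; cases B; cases z) (simp add: app_def mmul_def algebra_simps)

text \<open>The powers of \<open>M\<close> lie in the plane spanned by \<open>1\<close> and \<open>M\<close>.\<close>

lemma mpow_linear: "\<exists>x y. mpow M n = (x * fst M + y, x * fst (snd M), x * fst (snd (snd M)), x * snd (snd (snd M)) + y)"
proof (induction n)
  case 0
  show ?case by (intro exI[of _ 0] exI[of _ 1]) simp
next
  case (Suc n)
  then obtain x y where xy: "mpow M n = (x * fst M + y, x * fst (snd M), x * fst (snd (snd M)),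
    x * snd (snd (snd M)) + y)" by blast
  obtain a b c d where M: "M = (a, b, c, d)" by (cases M)
  \<comment> \<open>by Cayley-Hamilton, \<open>M\<^sup>2 = (a + d) M - (a d - b c)\<close>\<close>
  show ?case
    by (intro exI[of _ "x * (a + d) + y"] exI[of _ "- x * (a * d - b * c)"])
      (simp add: xy[unfolded M] M mmul_def algebra_simps)
qed

lemma const2_simps: "const2 (a + b) = const2 a + const2 b" "const2 (a * b) = const2 a * const2 b"
  "const2 (a - b) = const2 a - const2 b" "const2 0 = 0" "const2 1 = 1" "const2 (- a) = - const2 a"
  by (simp_all add: rhomD[OF rhom_const2])

lemma const2_eq_0_iff [simp]: "const2 a = 0 \<longleftrightarrow> a = 0"
  by (simp add: const2_def)

lemma homogp2_lin: "homogp2 1 (lin A)"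
proof -
  obtain a b c d where A: "A = (a, b, c, d)" by (cases A)
  have "homog2 1 (const2 x * varS + const2 y * varT)" for x y
    by (intro homog2_add homog2_cmult homog2_vars)
  then show ?thesis unfolding A lin_def homogp2_def prod.case fst_conv snd_conv by blast
qed

lemma lin_lin: "map_pair (eval2 const2 (lin B)) (lin A) = lin (mmul A B)"
  by (cases A; cases B) (simp add: lin_def mmul_def const2_simps algebra_simps)

lemma lin_one: "lin (1, 0, 0, 1) = (varS, varT)"
  by (simp add: lin_def const2_simps)

lemma eval2_lin_lin: "eval2 const2 (lin B) (eval2 const2 (lin A) F) = eval2 const2 (lin (mmul A B)) F"
  by (simp add: eval2_eval2[where h'' = const2] lin_lin)

lemma eval2_lin_eq_0:
  assumes "mdet A \<noteq> 0" "eval2 const2 (lin A) F = 0"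
  shows "F = 0"
proof -
  obtain a b c d where A: "A = (a, b, c, d)" by (cases A)
  define q where "q = inverse (a * d - b * c)"
  have q: "q * (a * d - b * c) = 1" using assms(1) by (simp add: q_def A mdet_def)
  define B where "B = (q * d, - q * b, - q * c, q * a)"
  have "mmul A B = (q * (a * d - b * c), 0, 0, q * (a * d - b * c))"
    by (simp add: A B_def mmul_def algebra_simps)
  then have "mmul A B = (1, 0, 0, 1)" by (simp only: q)
  then have "F = eval2 const2 (lin B) (eval2 const2 (lin A) F)"
    by (simp add: eval2_lin_lin lin_one eval2_vars)
  then show ?thesis using assms(2) by simp
qed

lemma eval_point_lin: "eval2 (\<lambda>c. c) z (eval2 const2 (lin A) F) = eval2 (\<lambda>c. c) (app A z) F"
proof -
  have "map_pair (eval2 (\<lambda>c. c) z) (lin A) = app A z"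
    by (cases A; cases z) (simp add: lin_def app_def)
  then show ?thesis by (simp add: eval2_eval2[where h'' = "\<lambda>c. c"])
qed

lemma linear_form_eqD:
  assumes "const2 a * varS ^ 2 + const2 b * (varS * varT) + const2 c * varT ^ 2 = 0"
  shows "a = 0" "b = 0" "c = 0"
proof -
  have "dehomog (const2 a * varS ^ 2 + const2 b * (varS * varT) + const2 c * varT ^ 2) = 0"
    using assms by simp
  then have *: "[:c, b, a:] = 0" by (simp add: power2_eq_square)
  then show "a = 0" "b = 0" "c = 0" by auto
qed

lemma lin_sim2:
  assumes "sim2 (lin A) (lin B)" "mdet A \<noteq> 0" "mdet B \<noteq> 0"
  shows "\<exists>r. r \<noteq> 0 \<and> A = mscal r B"
proof -
  obtain a b c d where A: "A = (a, b, c, d)" by (cases A)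
  obtain a' b' c' d' where B: "B = (a', b', c', d')" by (cases B)
  have "proportional2 (lin A) (lin B)" using assms(1) by (rule proportional2_of_sim2)
  then have "const2 (a * c' - c * a') * varS ^ 2 + const2 (a * d' + b * c' - c * b' - d * a') * (varS * varT)
      + const2 (b * d' - d * b') * varT ^ 2 = 0"
    by (simp add: A B lin_def proportional2_def const2_simps algebra_simps power2_eq_square)
  from linear_form_eqD[OF this] have e: "a * c' = c * a'" "a * d' + b * c' = c * b' + d * a'" "b * d' = d * b'"
    by (simp_all add: algebra_simps)
  have dB: "a' * d' - b' * c' \<noteq> 0" and dA: "a * d - b * c \<noteq> 0" using assms by (simp_all add: A B mdet_def)
  have "a' \<noteq> 0 \<or> c' \<noteq> 0" "b' \<noteq> 0 \<or> d' \<noteq> 0" using dB by auto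
  have par: "\<exists>r. x = r * x' \<and> y = r * y'" if "x * y' = y * x'" "x' \<noteq> 0 \<or> y' \<noteq> 0" for x x' y y' :: complex
  proof (cases "x' = 0")
    case True
    then show ?thesis using that by (intro exI[of _ "y / y'"]) simp
  next
    case False
    then show ?thesis using that by (intro exI[of _ "x / x'"]) (simp add: field_simps)
  qed
  have "\<exists>r. a = r * a' \<and> c = r * c'"
    using e(1) \<open>a' \<noteq> 0 \<or> c' \<noteq> 0\<close> by (rule par)
  then obtain r where r: "a = r * a'" "c = r * c'" by blast
  have "\<exists>q. b = q * b' \<and> d = q * d'"
    using e(3) \<open>b' \<noteq> 0 \<or> d' \<noteq> 0\<close> by (rule par)
  then obtain q where q: "b = q * b'" "d = q * d'" by blast
  have "(r - q) * (a' * d' - b' * c') = 0"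
    using e(2) unfolding r q by (simp add: algebra_simps)
  then have "r = q" using dB by simp
  moreover have "r \<noteq> 0" using dA r by auto
  ultimately show ?thesis by (intro exI[of _ r]) (simp add: A B mscal_def r q)
qed

text \<open>
  The next two lemmas show that in \<open>PGL\<^sub>2\<close> the elements commuting with an \<open>M\<close> of nontrivial square commute
  with one another.  If \<open>M\<close> had trace zero, its square would be scalar; comparing the traces of \<open>M\<close> and of
  its conjugate by \<open>N\<close> then shows that commutation up to a factor is honest commutation.  And the
  matrices commuting with a nonscalar matrix are polynomials in it.
\<close>

lemma commute_of_projectively_commute:
  assumes "mdet N \<noteq> 0" "mdet M \<noteq> 0" "mmul N M = mscal r (mmul M N)" "\<not> scalar (mmul M M)"
  shows "mmul N M = mmul M N"
proof -
  obtain a b c d where N: "N = (a, b, c, d)" by (cases N)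
  obtain p q s t where M: "M = (p, q, s, t)" by (cases M)
  have e: "a * p + b * s = r * (p * a + q * c)" "a * q + b * t = r * (p * b + q * d)"
    "c * p + d * s = r * (s * a + t * c)" "c * q + d * t = r * (s * b + t * d)"
    using assms(3) by (simp_all add: N M mmul_def mscal_def)
  have dN: "a * d - b * c \<noteq> 0" using assms(1) by (simp add: N mdet_def)
  have tr: "p + t \<noteq> 0"
  proof
    assume "p + t = 0"
    then have "t = - p" by (simp add: eq_neg_iff_add_eq_0 add.commute)
    then show False using assms(4) by (simp add: M scalar_def mmul_def algebra_simps)
  qed
  have "(p + t) * (a * d - b * c) = (a * p + b * s) * d - (a * q + b * t) * c
      + (c * q + d * t) * a - (c * p + d * s) * b" by algebra
  also have "\<dots> = r * ((p + t) * (a * d - b * c))" unfolding e by algebra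
  finally have "r = 1" using tr dN by simp
  then show ?thesis using assms(3) by (cases M; cases N) (simp add: mscal_def mmul_def)
qed

lemma commute_of_common_commute:
  assumes "mmul N M = mmul M N" "mmul N' M = mmul M N'" "\<not> scalar M"
  shows "mmul N N' = mmul N' N"
proof -
  obtain a b c d where N: "N = (a, b, c, d)" by (cases N)
  obtain a' b' c' d' where N': "N' = (a', b', c', d')" by (cases N')
  obtain p q s t where M: "M = (p, q, s, t)" by (cases M)
  have f: "a * p + b * s = p * a + q * c" "a * q + b * t = p * b + q * d"
    "c * p + d * s = s * a + t * c"
    using assms(1) by (simp_all add: N M mmul_def)
  have e: "b * s = q * c" "q * (a - d) = b * (p - t)" "s * (a - d) = c * (p - t)"
    using f by algebra+
  have f': "a' * p + b' * s = p * a' + q * c'" "a' * q + b' * t = p * b' + q * d'"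
    "c' * p + d' * s = s * a' + t * c'"
    using assms(2) by (simp_all add: N' M mmul_def)
  have e': "b' * s = q * c'" "q * (a' - d') = b' * (p - t)" "s * (a' - d') = c' * (p - t)"
    using f' by algebra+
  have nz: "q \<noteq> 0 \<or> s \<noteq> 0 \<or> p - t \<noteq> 0" using assms(3) by (auto simp: M scalar_def)
  have 1: "q * (b * c' - c * b') = 0" "s * (b * c' - c * b') = 0" "(p - t) * (b * c' - c * b') = 0"
    using e e' by algebra+
  have 2: "q * (b * (a' - d') - b' * (a - d)) = 0" "s * (b * (a' - d') - b' * (a - d)) = 0"
    "(p - t) * (b * (a' - d') - b' * (a - d)) = 0"
    using e e' by algebra+
  have 3: "q * (c * (a' - d') - c' * (a - d)) = 0" "s * (c * (a' - d') - c' * (a - d)) = 0"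
    "(p - t) * (c * (a' - d') - c' * (a - d)) = 0"
    using e e' by algebra+
  have "b * c' - c * b' = 0" "b * (a' - d') - b' * (a - d) = 0" "c * (a' - d') - c' * (a - d) = 0"
    using 1 2 3 nz by (metis mult_eq_0_iff)+
  then show ?thesis by (simp add: N N' mmul_def algebra_simps)
qed

text \<open>A constant point of the line is not its generic point \<open>(S : T)\<close>.\<close>

lemma const_pair_not_vars:
  assumes "const2 x * varT = const2 y * varS"
  shows "x = 0 \<and> y = 0"
  using assms by (simp add: const2_def varT_def varS_def)

text \<open>
  Having a left inverse, the map is injective off a finite set, whereas a reduced fraction of degree
  \<open>m\<close> is generically \<open>m\<close>-to-one; so it has degree one.
\<close>

lemma moebius_of_left_inverse:
  assumes m: "homogp2 k m" and m': "homogp2 k' m'"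
    and nz: "map_pair (eval2 const2 m) m' \<noteq> (0, 0)"
    and inv: "proportional2 (map_pair (eval2 const2 m) m') (varS, varT)"
  shows "\<exists>A. mdet A \<noteq> 0 \<and> sim2 m (lin A)"
proof -
  obtain m0 m1 where m01: "m = (m0, m1)" by (cases m)
  obtain n0 n1 where n: "map_pair (eval2 const2 m) m' = (n0, n1)" by (cases "map_pair (eval2 const2 m) m'")
  have n01: "n0 = eval2 const2 m (fst m')" "n1 = eval2 const2 m (snd m')"
    using n by (simp_all add: map_pair_def)
  have nST: "n0 * varT = n1 * varS" using inv n by (simp add: proportional2_def)
  then have n1: "n1 \<noteq> 0" using nz n by auto
  have const: False if "sim2 m (const2 x, const2 y) \<or> m = (const2 x, const2 y)" for x y
  proof -
    have "sim2 m (const2 x, const2 y)" using that by auto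
    then have s: "sim2 (n0, n1) (map_pair (eval2 const2 (const2 x, const2 y)) m')"
      unfolding n[symmetric] by (rule sim2_eval2[OF m' rhom_const2])
    have ev: "eval2 const2 (const2 x, const2 y) F = const2 (eval2 (\<lambda>c. c) (x, y) F)" for F
      by (simp add: hom_eval2)
    have "sim2 (map_pair (eval2 const2 (const2 x, const2 y)) m') (n0, n1)" using s by (rule sim2_sym)
    moreover have "sim2 (n0, n1) (varS, varT)"
      using nz n inv by (simp add: sim2_iff)
    ultimately have "sim2 (map_pair (eval2 const2 (const2 x, const2 y)) m') (varS, varT)"
      by (rule sim2_trans)
    then have "proportional2 (map_pair (eval2 const2 (const2 x, const2 y)) m') (varS, varT)"
      by (rule proportional2_of_sim2)
    then have "map_pair (eval2 const2 (const2 x, const2 y)) m' = (0, 0)"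
      using const_pair_not_vars by (auto simp: map_pair_def ev proportional2_def)
    then have "(n0, n1) = (0, 0)" using sim2_nz[OF s] by blast
    then show False using n1 by simp
  qed
  have mnz: "m \<noteq> (0, 0)" using const[of 0 0] by (auto simp: const2_simps)
  define d0 d1 b where "d0 = dehomog m0" and "d1 = dehomog m1" and "b = dehomog n1"
  have hm: "homog2 k m0" "homog2 k m1" using m by (simp_all add: m01 homogp2_def)
  have d: "\<not> (d0 = 0 \<and> d1 = 0)"
    using mnz hm by (auto simp: d0_def d1_def m01 dehomog_eq_0_iff)
  have "homog2 (k' * k) n1"
    using m' hm by (simp add: n01 m01 homogp2_def homog_eval2_const2)
  then have b: "b \<noteq> 0" using n1 by (simp add: b_def dehomog_eq_0_iff)
  have sub: "{s. poly b s \<noteq> 0 \<and> poly d1 s = \<xi> * poly d0 s} \<subseteq>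
      {eval2 (\<lambda>c. c) (1, \<xi>) (fst m') / eval2 (\<lambda>c. c) (1, \<xi>) (snd m')}" for \<xi>
  proof safe
    fix s assume s: "poly b s \<noteq> 0" "poly d1 s = \<xi> * poly d0 s"
    have *: "eval2 (\<lambda>c. c) (s, 1) (eval2 const2 m F) = poly d0 s ^ k' * eval2 (\<lambda>c. c) (1, \<xi>) F"
      if "homog2 k' F" for F
    proof -
      have "map_pair (eval2 (\<lambda>c. c) (s, 1)) m = (poly d0 s * 1, poly d0 s * \<xi>)"
        using s(2) by (simp add: m01 d0_def d1_def poly_dehomog mult.commute)
      then show ?thesis
        using homog2_scale[OF that rhom_id, of "poly d0 s" 1 \<xi>]
        by (simp add: eval2_eval2[where h'' = "\<lambda>c. c"])
    qed
    have e0: "poly (dehomog n0) s = poly d0 s ^ k' * eval2 (\<lambda>c. c) (1, \<xi>) (fst m')"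
      and e1: "poly b s = poly d0 s ^ k' * eval2 (\<lambda>c. c) (1, \<xi>) (snd m')"
      using m' by (simp_all add: b_def n01 poly_dehomog * homogp2_def)
    have "poly (dehomog (n0 * varT)) s = poly (dehomog (n1 * varS)) s" using nST by simp
    then have "poly (dehomog n0) s = poly b s * s" by (simp add: b_def mult.commute)
    then show "s = eval2 (\<lambda>c. c) (1, \<xi>) (fst m') / eval2 (\<lambda>c. c) (1, \<xi>) (snd m')"
      using s(1) e0 e1 by (auto simp: nonzero_eq_divide_eq)
  qed
  have "\<exists>p q. coprime p q \<and> degree p \<le> 1 \<and> degree q \<le> 1 \<and> d0 * q = d1 * p"
  proof (rule reduced_fraction_degree_le[OF d b, of "{}"], simp, intro conjI)
    fix \<xi>
    show "finite {s. poly b s \<noteq> 0 \<and> poly d1 s = \<xi> * poly d0 s}"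
      using sub[of \<xi>] by (rule finite_subset) simp
    show "card {s. poly b s \<noteq> 0 \<and> poly d1 s = \<xi> * poly d0 s} \<le> 1"
      using card_mono[OF _ sub[of \<xi>]] by simp
  qed
  then obtain p q where pq: "coprime p q" "degree p \<le> 1" "degree q \<le> 1" "d0 * q = d1 * p" by blast
  define A where "A = (coeff p 1, coeff p 0, coeff q 1, coeff q 0)"
  have lA: "lin A = (homogenise 1 p, homogenise 1 q)"
    by (simp add: A_def lin_def homogenise_def add.commute)
  have "m0 * homogenise 1 q = m1 * homogenise 1 p"
  proof (rule dehomog_inj)
    show "homog2 (k + 1) (m0 * homogenise 1 q)" "homog2 (k + 1) (m1 * homogenise 1 p)"
      using hm by (intro homog2_mult homog2_homogenise; simp)+
    show "dehomog (m0 * homogenise 1 q) = dehomog (m1 * homogenise 1 p)"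
      using pq by (simp add: dehomog_homogenise d0_def d1_def)
  qed
  moreover have lnz: "lin A \<noteq> (0, 0)"
  proof
    assume "lin A = (0, 0)"
    then have "p = 0" "q = 0" using pq dehomog_homogenise[of p 1] dehomog_homogenise[of q 1] by (auto simp: lA)
    then show False using pq(1) by simp
  qed
  ultimately have sim: "sim2 m (lin A)"
    using mnz by (simp add: sim2_iff proportional2_def lA m01)
  have "mdet A \<noteq> 0"
  proof
    assume det: "mdet A = 0"
    obtain a b c e where A': "A = (a, b, c, e)" by (cases A)
    have ae: "a * e = b * c" using det by (simp add: mdet_def A')
    \<comment> \<open>a singular matrix describes a constant map\<close>
    have "\<exists>x y. sim2 (lin A) (const2 x, const2 y)"
    proof (cases "a = 0 \<and> c = 0")
      case True
      then have "lin A = map_pair ((*) varT) (const2 b, const2 e)"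
        by (simp add: A' lin_def const2_simps mult.commute)
      then show ?thesis using sim2_smult[of varT] by (metis varT_nz)
    next
      case False
      have "proportional2 (lin A) (const2 a, const2 c)"
        using ae by (simp add: A' lin_def proportional2_def algebra_simps flip: const2_simps)
      then show ?thesis
        using False lnz sim2_iff[of "lin A" "(const2 a, const2 c)"] by auto
    qed
    then show False using const sim sim2_trans by blast
  qed
  then show ?thesis using sim by blast
qed

section \<open>Invariant rational functions on the line\<close>

text \<open>
  The function \<open>r\<^sub>0 / r\<^sub>1\<close> is constant along every orbit of \<open>M\<close>, and a very general orbit is infinite: the
  points with finite orbit are fixed points of powers of \<open>M\<close>, and these are countably many.
\<close>

lemma invariant_ratio_constant:
  assumes r: "homogp2 k (r0, r1)" "(r0, r1) \<noteq> (0, 0)"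
    and M: "mdet M \<noteq> 0" "\<And>j. j \<ge> 1 \<Longrightarrow> \<not> scalar (mpow M j)"
    and inv: "eval2 const2 (lin M) r0 * r1 = eval2 const2 (lin M) r1 * r0"
  shows "\<exists>x y. (x, y) \<noteq> (0, 0) \<and> const2 x * r0 = const2 y * r1"
proof -
  have hr: "homog2 k r0" "homog2 k r1" using r by (simp_all add: homogp2_def)
  define B1 where "B1 j = {s. poly (dehomog (eval2 const2 (lin (mpow M j)) r0)) s = 0 \<and>
    poly (dehomog (eval2 const2 (lin (mpow M j)) r1)) s = 0}" for j
  define cr where "cr j = (case mpow M j of (a, b, c, d) \<Rightarrow> [:b, a - d, - c:])" for j
  define B2 where "B2 j = {s. j \<ge> 1 \<and> poly (cr j) s = 0}" for j
  have hl: "homog2 k (eval2 const2 (lin A) F)" if "homog2 k F" for A F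
    using homog_eval2_const2[OF that, of 1 "fst (lin A)" "snd (lin A)"] homogp2_lin[of A]
    by (simp add: homogp2_def)
  have dn: "mdet (mpow M j) \<noteq> 0" for j using M(1) by (simp add: mdet_mpow)
  have "finite (B1 j)" for j
  proof -
    have "finite {s. poly (dehomog (eval2 const2 (lin (mpow M j)) F)) s = 0}" if "homog2 k F" "F \<noteq> 0" for F
      using that by (intro poly_roots_finite) (auto simp: dehomog_eq_0_iff[OF hl] dest: eval2_lin_eq_0[OF dn])
    then show ?thesis
      using r(2) hr unfolding B1_def by (cases "r0 = 0") (auto intro: rev_finite_subset)
  qed
  moreover have "finite (B2 j)" for j
  proof (cases "j \<ge> 1")
    case True
    then have "cr j \<noteq> 0" using M(2)[OF True] by (auto simp: cr_def scalar_def split: prod.splits)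
    then show ?thesis using True by (simp add: B2_def poly_roots_finite)
  qed (simp add: B2_def)
  ultimately have "countable (\<Union>j. B1 j \<union> B2 j)" by (intro countable_UN) (auto intro: countable_finite)
  then obtain s0 where s0: "s0 \<notin> (\<Union>j. B1 j \<union> B2 j)"
    using uncountable_UNIV_complex by (metis UNIV_eq_I)
  define z where "z j = app (mpow M j) (s0, 1)" for j
  define R0 R1 where "R0 j = eval2 (\<lambda>c. c) (z j) r0" and "R1 j = eval2 (\<lambda>c. c) (z j) r1" for j
  have Rnz: "\<not> (R0 j = 0 \<and> R1 j = 0)" for j
    using s0 by (auto simp: B1_def R0_def R1_def z_def poly_dehomog eval_point_lin)
  have zS: "z (Suc j) = app M (z j)" for j by (simp add: z_def app_mmul)
  have step: "R0 (Suc j) * R1 j = R1 (Suc j) * R0 j" for j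
  proof -
    have "eval2 (\<lambda>c. c) (z j) (eval2 const2 (lin M) r0 * r1) = eval2 (\<lambda>c. c) (z j) (eval2 const2 (lin M) r1 * r0)"
      using inv by simp
    then show ?thesis by (simp add: R0_def R1_def zS eval_point_lin)
  qed
  have orb: "R0 j * R1 0 = R1 j * R0 0" for j
  proof (induction j)
    case (Suc j)
    have "R0 j * (R0 (Suc j) * R1 0 - R1 (Suc j) * R0 0) = 0"
      "R1 j * (R0 (Suc j) * R1 0 - R1 (Suc j) * R0 0) = 0"
      using Suc step[of j] by algebra+
    then show ?case using Rnz[of j] by auto
  qed simp
  define F where "F = const2 (R1 0) * r0 - const2 (R0 0) * r1"
  have hF: "homog2 k F" unfolding F_def by (intro homog2_diff homog2_cmult hr)
  have Fz: "eval2 (\<lambda>c. c) (z j) F = 0" for j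
    using orb[of j] by (simp add: F_def R0_def R1_def mult.commute)
  define cross where "cross u v = fst u * snd v - snd u * fst v" for u v :: "complex \<times> complex"
  have cross_app: "cross (app A u) (app A v) = mdet A * cross u v" for A u v
    by (cases A; cases u; cases v) (simp add: cross_def app_def mdet_def algebra_simps)
  have c0: "cross (z l) (z 0) \<noteq> 0" if "l \<ge> 1" for l
  proof -
    obtain a b c d where A: "mpow M l = (a, b, c, d)" by (cases "mpow M l")
    have "poly (cr l) s0 \<noteq> 0" using s0 that by (auto simp: B2_def)
    then show ?thesis by (simp add: cr_def A cross_def z_def app_def algebra_simps)
  qed
  have cij: "cross (z j) (z i) \<noteq> 0" if "i < j" for i j
  proof -
    have "mpow M j = mmul (mpow M i) (mpow M (j - i))" using mpow_add[of M i "j - i"] that by simp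
    then have "z j = app (mpow M i) (z (j - i))" by (simp add: z_def app_mmul)
    moreover have "z 0 = (s0, 1)" by (simp add: z_def app_def)
    then have "z i = app (mpow M i) (z 0)" by (simp add: z_def)
    ultimately have "z j = app (mpow M i) (z (j - i))" "z i = app (mpow M i) (z 0)" .
    then show ?thesis using cross_app c0[of "j - i"] dn[of i] that by simp
  qed
  define J where "J = {j. snd (z j) \<noteq> 0}"
  have "finite (- J)"
  proof -
    have "i = j" if "i \<in> - J" "j \<in> - J" for i j
      using that cij[of i j] cij[of j i] by (cases i j rule: linorder_cases) (auto simp: J_def cross_def)
    then have "\<exists>i. - J \<subseteq> {i}" by blast
    then show ?thesis by (auto intro: finite_subset)
  qed
  have "infinite J"
  proof
    assume "finite J"
    with \<open>finite (- J)\<close> have "finite (J \<union> - J)" by simp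
    then show False by simp
  qed
  moreover have "inj_on (\<lambda>j. fst (z j) / snd (z j)) J"
  proof (rule inj_onI)
    fix i j assume ij: "i \<in> J" "j \<in> J" "fst (z i) / snd (z i) = fst (z j) / snd (z j)"
    then have "cross (z i) (z j) = 0" "cross (z j) (z i) = 0"
      by (auto simp: J_def cross_def field_simps)
    then show "i = j" using cij[of i j] cij[of j i] by (cases i j rule: linorder_cases) auto
  qed
  ultimately have inf: "infinite ((\<lambda>j. fst (z j) / snd (z j)) ` J)" using finite_imageD by blast
  have "poly (dehomog F) (fst (z j) / snd (z j)) = 0" if "j \<in> J" for j
  proof -
    have t: "snd (z j) \<noteq> 0" using that by (simp add: J_def)
    have "0 = eval2 (\<lambda>c. c) (snd (z j) * (fst (z j) / snd (z j)), snd (z j) * 1) F"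
      using Fz[of j] t by simp
    also have "\<dots> = snd (z j) ^ k * poly (dehomog F) (fst (z j) / snd (z j))"
      unfolding poly_dehomog by (rule homog2_scale[OF hF rhom_id])
    finally show ?thesis using t by simp
  qed
  then have "(\<lambda>j. fst (z j) / snd (z j)) ` J \<subseteq> {s. poly (dehomog F) s = 0}" by auto
  then have "dehomog F = 0" using inf poly_roots_finite finite_subset by blast
  then have "F = 0" using dehomog_eq_0_iff[OF hF] by simp
  then show ?thesis
    using Rnz[of 0] by (intro exI[of _ "R1 0"] exI[of _ "R0 0"]) (auto simp: F_def)
qed

section \<open>Linear algebra\<close>

text \<open>Gaussian elimination, one equation at a time.\<close>

lemma underdetermined_system:
  fixes e :: "'i \<Rightarrow> 'j \<Rightarrow> 'k::field"
  assumes "finite J" "finite I" "card J < card I"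
  shows "\<exists>t. (\<exists>i\<in>I. t i \<noteq> 0) \<and> (\<forall>j\<in>J. (\<Sum>i\<in>I. t i * e i j) = 0)"
  using assms
proof (induction J arbitrary: I e rule: finite_induct)
  case empty
  then have "I \<noteq> {}" by auto
  then show ?case by (intro exI[of _ "\<lambda>_. 1"]) auto
next
  case (insert j0 J)
  show ?case
  proof (cases "\<forall>i\<in>I. e i j0 = 0")
    case True
    obtain t where "(\<exists>i\<in>I. t i \<noteq> 0) \<and> (\<forall>j\<in>J. (\<Sum>i\<in>I. t i * e i j) = 0)"
      using insert.IH[of I e] insert.prems insert.hyps by auto
    then show ?thesis using True by (intro exI[of _ t]) (auto intro!: sum.neutral)
  next
    case False
    then obtain i0 where i0: "i0 \<in> I" "e i0 j0 \<noteq> 0" by auto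
    define I' where "I' = I - {i0}"
    have I: "I = insert i0 I'" "finite I'" "i0 \<notin> I'" using i0 insert.prems by (auto simp: I'_def)
    define e' where "e' i j = e i j - e i j0 / e i0 j0 * e i0 j" for i j
    have "card J < card I'" using insert.prems insert.hyps I by simp
    from insert.IH[OF I(2) this, of e'] obtain t where
      t: "\<exists>i\<in>I'. t i \<noteq> 0" "\<forall>j\<in>J. (\<Sum>i\<in>I'. t i * e' i j) = 0" by blast
    define t' where "t' = t(i0 := - (\<Sum>i\<in>I'. t i * e i j0) / e i0 j0)"
    have t'I: "t' i = t i" if "i \<in> I'" for i using that I(3) by (auto simp: t'_def)
    have "(\<Sum>i\<in>I. t' i * e i j) = (\<Sum>i\<in>I'. t i * e' i j)" for j
    proof -
      have "(\<Sum>i\<in>I. t' i * e i j) = t' i0 * e i0 j + (\<Sum>i\<in>I'. t i * e i j)"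
        using I t'I by simp
      also have "\<dots> = (\<Sum>i\<in>I'. t i * e i j - t i * e i j0 / e i0 j0 * e i0 j)"
        by (simp add: t'_def sum_subtractf sum_distrib_right sum_divide_distrib)
      finally show ?thesis by (simp add: e'_def algebra_simps)
    qed
    moreover have "(\<Sum>i\<in>I'. t i * e' i j0) = 0" using i0 by (simp add: e'_def)
    moreover have "\<exists>i\<in>I. t' i \<noteq> 0" using t(1) t'I I(1) by (metis insertCI)
    ultimately show ?thesis using t(2) by (intro exI[of _ t']) auto
  qed
qed

text \<open>
  Relations, valid for almost all \<open>n\<close>, between finitely many sequences with coefficients from a
  domain that acts on them through homomorphisms \<open>E n\<close>.  Over the field of fractions the sequences
  span a finite-dimensional space, so the relations are the kernel of a finite matrix.
\<close>

lemma eventual_relations_matrix: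
  fixes E :: "nat \<Rightarrow> 'r::idom \<Rightarrow> 'b::idom" and w :: "'i \<Rightarrow> nat \<Rightarrow> 'b"
  assumes E: "\<And>n. rhom (E n)" "\<And>r. r \<noteq> 0 \<Longrightarrow> \<forall>\<^sub>F n in sequentially. E n r \<noteq> 0"
    and "finite I"
  shows "\<exists>rows::('i \<Rightarrow> 'r) set. finite rows \<and>
    (\<forall>t. (\<forall>\<^sub>F n in sequentially. (\<Sum>i\<in>I. E n (t i) * w i n) = 0) \<longleftrightarrow>
      (\<forall>l\<in>rows. (\<Sum>i\<in>I. t i * l i) = 0))"
  using assms(3)
proof (induction I rule: finite_induct)
  case empty
  show ?case by (intro exI[of _ "{}"]) simp
next
  case (insert a I)
  then obtain R :: "('i \<Rightarrow> 'r) set" where R: "finite R"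
    "\<And>t. (\<forall>\<^sub>F n in sequentially. (\<Sum>i\<in>I. E n (t i) * w i n) = 0) \<longleftrightarrow> (\<forall>l\<in>R. (\<Sum>i\<in>I. t i * l i) = 0)"
    by blast
  note Es = rhomD[OF E(1)]
  show ?case
  proof (cases "\<exists>s. (\<forall>\<^sub>F n in sequentially. (\<Sum>i\<in>insert a I. E n (s i) * w i n) = 0) \<and> s a \<noteq> 0")
    case True
    then obtain s where s: "\<forall>\<^sub>F n in sequentially. (\<Sum>i\<in>insert a I. E n (s i) * w i n) = 0" "s a \<noteq> 0"
      by blast
    define ext where "ext l = (\<lambda>i. if i = a then - (\<Sum>i\<in>I. s i * l i) else s a * l i)" for l :: "'i \<Rightarrow> 'r"
    have "(\<forall>\<^sub>F n in sequentially. (\<Sum>i\<in>insert a I. E n (t i) * w i n) = 0) \<longleftrightarrow>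
      (\<forall>l\<in>ext ` R. (\<Sum>i\<in>insert a I. t i * l i) = 0)" for t
    proof -
      have key: "(\<Sum>i\<in>I. E n (s a * t i - t a * s i) * w i n) =
        E n (s a) * (\<Sum>i\<in>insert a I. E n (t i) * w i n) - E n (t a) * (\<Sum>i\<in>insert a I. E n (s i) * w i n)" for n
        using insert.hyps by (simp add: Es algebra_simps sum_subtractf sum_distrib_left)
      have "(\<forall>\<^sub>F n in sequentially. (\<Sum>i\<in>insert a I. E n (t i) * w i n) = 0) \<longleftrightarrow>
        (\<forall>\<^sub>F n in sequentially. (\<Sum>i\<in>I. E n (s a * t i - t a * s i) * w i n) = 0)"
        by (rule eventually_subst, use s(1) E(2)[OF s(2)] in eventually_elim) (simp add: key)
      also have "\<dots> \<longleftrightarrow> (\<forall>l\<in>R. (\<Sum>i\<in>I. (s a * t i - t a * s i) * l i) = 0)" by (rule R(2))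
      also have "\<dots> \<longleftrightarrow> (\<forall>l\<in>ext ` R. (\<Sum>i\<in>insert a I. t i * l i) = 0)"
      proof -
        have "(\<Sum>i\<in>insert a I. t i * ext l i) = (\<Sum>i\<in>I. (s a * t i - t a * s i) * l i)" for l
        proof -
          have "(\<Sum>i\<in>insert a I. t i * ext l i) = - t a * (\<Sum>i\<in>I. s i * l i) + (\<Sum>i\<in>I. t i * (s a * l i))"
            using insert.hyps by (auto simp: ext_def intro!: sum.cong)
          then show ?thesis by (simp add: algebra_simps sum_subtractf sum_distrib_left sum_negf)
        qed
        then show ?thesis by simp
      qed
      finally show ?thesis .
    qed
    then show ?thesis using R(1) by (intro exI[of _ "ext ` R"]) simp
  next
    case False
    define ext where "ext l = l(a := 0)" for l :: "'i \<Rightarrow> 'r"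
    define ua where "ua = (\<lambda>i. if i = a then 1 else 0 :: 'r)"
    have "(\<forall>\<^sub>F n in sequentially. (\<Sum>i\<in>insert a I. E n (t i) * w i n) = 0) \<longleftrightarrow>
      (\<forall>l\<in>insert ua (ext ` R). (\<Sum>i\<in>insert a I. t i * l i) = 0)" for t
    proof -
      have ua: "(\<Sum>i\<in>insert a I. t i * ua i) = t a"
      proof -
        have "(\<Sum>i\<in>I. t i * ua i) = 0" using insert.hyps by (intro sum.neutral) (auto simp: ua_def)
        then show ?thesis using insert.hyps by (simp add: ua_def)
      qed
      have ext: "(\<Sum>i\<in>insert a I. t i * ext l i) = (\<Sum>i\<in>I. t i * l i)" for l
        using insert.hyps by (auto simp: ext_def intro!: sum.cong)
      have "(\<Sum>i\<in>insert a I. E n (t i) * w i n) = (\<Sum>i\<in>I. E n (t i) * w i n)" if "t a = 0" for n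
        using insert.hyps that by (simp add: Es)
      then show ?thesis using False R(2)[of t] by (cases "t a = 0") (auto simp: ua ext)
    qed
    then show ?thesis using R(1) by (intro exI[of _ "insert ua (ext ` R)"]) simp
  qed
qed

section \<open>Parametrised rational curves\<close>

lemma poly3_induct [case_names const X Y Z add mult]:
  assumes "\<And>c. R (const3 c)" "R varX" "R varY" "R varZ"
    and add: "\<And>F G. R F \<Longrightarrow> R G \<Longrightarrow> R (F + G)" and mult: "\<And>F G. R F \<Longrightarrow> R G \<Longrightarrow> R (F * G)"
  shows "R F"
proof -
  have 1: "const3 1 = 1" "const3 0 = 0" using rhom_const3 by (simp_all add: rhomD)
  have pow: "R (A ^ n)" if "R A" for A n
    by (induction n) (use that assms(1)[of 1] mult in \<open>simp_all add: 1\<close>)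
  have sum: "R (sum f A)" if "\<And>i. R (f i)" for f :: "nat \<Rightarrow> poly3" and A
    by (induction A rule: infinite_finite_induct) (use that assms(1)[of 0] add in \<open>simp_all add: 1\<close>)
  have "F = eval3 const3 (varX, varY, varZ) F" by (simp add: eval3_vars)
  also have "R \<dots>" unfolding eval3_sum[OF rhom_const3] by (intro sum mult pow assms(1-4))
  finally show ?thesis .
qed

lemma dvd_eval3_diff:
  assumes "G dvd fst a - fst b" "G dvd fst (snd a) - fst (snd b)" "G dvd snd (snd a) - snd (snd b)"
  shows "G dvd eval3 const3 a F - eval3 const3 b F"
proof (induction F rule: poly3_induct)
  case (add F H)
  have "eval3 const3 a (F + H) - eval3 const3 b (F + H) =
    (eval3 const3 a F - eval3 const3 b F) + (eval3 const3 a H - eval3 const3 b H)" by simp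
  then show ?case using add by (metis dvd_add)
next
  case (mult F H)
  have "eval3 const3 a (F * H) - eval3 const3 b (F * H) =
    eval3 const3 a F * (eval3 const3 a H - eval3 const3 b H) +
    (eval3 const3 a F - eval3 const3 b F) * eval3 const3 b H" by (simp add: algebra_simps)
  then show ?case using mult by (metis dvd_add dvd_mult dvd_mult2)
qed (use assms in simp_all)

text \<open>
  A triple of binary forms is a parametrised curve in the plane, or a point of the plane over the function
  field of the line.  Rational maps of the plane act on such points from the left, linear changes of
  the parameter from the right.
\<close>

definition push :: "poly3 \<times> poly3 \<times> poly3 \<Rightarrow> poly2 \<times> poly2 \<times> poly2 \<Rightarrow> poly2 \<times> poly2 \<times> poly2" where
  "push g p = map_triple (eval3 const2 p) g"

definition reparam :: "poly2 \<times> poly2 \<times> poly2 \<Rightarrow> mat \<Rightarrow> poly2 \<times> poly2 \<times> poly2" where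
  "reparam p A = map_triple (eval2 const2 (lin A)) p"

text \<open>
  At a generic point of the curve \<open>G = 0\<close> divisibility by \<open>G\<close> can be tested by evaluation.  In
  \<open>parametrises G u v\<close> the pair \<open>v\<close> recovers the parameter, first on \<open>u\<close> itself and then, as \<open>u(v(p)) = p\<close>, at
  all generic points; the latter makes every birational self-map of the curve a self-map of the line.
\<close>

definition generic_point :: "poly3 \<Rightarrow> poly2 \<times> poly2 \<times> poly2 \<Rightarrow> bool" where
  "generic_point G p \<longleftrightarrow> (\<exists>k. homogs2 k p) \<and> p \<noteq> (0, 0, 0) \<and>
     (\<forall>F k. homog3 k F \<longrightarrow> (eval3 const2 p F = 0 \<longleftrightarrow> G dvd F))"

definition parametrises ::
  "poly3 \<Rightarrow> poly2 \<times> poly2 \<times> poly2 \<Rightarrow> poly3 \<times> poly3 \<Rightarrow> bool" where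
  "parametrises G u v \<longleftrightarrow> generic_point G u \<and> (\<exists>e. homogp3 e v) \<and>
     sim2 (map_pair (eval3 const2 u) v) (varS, varT) \<and>
     (\<forall>p. generic_point G p \<longrightarrow> sim3 (map_triple (eval2 const2 (map_pair (eval3 const2 p) v)) u) p)"

lemma push_reparam: "reparam (push g p) A = push g (reparam p A)"
  by (simp add: push_def reparam_def map_triple_map_triple eval2_eval3[where h'' = const2])

lemma push_push: "push g (push h p) = push (subst3 g h) p"
  by (simp add: push_def eval3_subst3)

lemma reparam_reparam: "reparam (reparam p A) B = reparam p (mmul A B)"
  by (simp add: reparam_def map_triple_map_triple eval2_lin_lin)

lemma reparam_one: "reparam p (1, 0, 0, 1) = p"
  by (cases p) (simp add: reparam_def lin_one eval2_vars)

lemma push_vars: "push (varX, varY, varZ) p = p"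
  by (cases p) (simp add: push_def)

lemma sim3_push: "homogs3 k g \<Longrightarrow> sim3 p q \<Longrightarrow> sim3 (push g p) (push g q)"
  unfolding push_def by (rule sim3_eval3) simp_all

lemma sim3_reparam:
  assumes "mdet A \<noteq> 0" "sim3 p q"
  shows "sim3 (reparam p A) (reparam q A)"
  unfolding reparam_def by (rule sim3_hom) (use assms(2) eval2_lin_eq_0[OF assms(1)] in auto)

lemma reparam_nz:
  assumes "mdet A \<noteq> 0" "p \<noteq> (0, 0, 0)"
  shows "reparam p A \<noteq> (0, 0, 0)"
  using assms(2) eval2_lin_eq_0[OF assms(1)] by (cases p) (auto simp: reparam_def)

lemma reparam_mscal:
  assumes "homogs2 k p" "r \<noteq> 0"
  shows "sim3 (reparam p (mscal r A)) (reparam p A)"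
proof -
  have "lin (mscal r A) = map_pair ((*) (const2 r)) (lin A)"
    by (cases A) (simp add: lin_def mscal_def const2_simps algebra_simps)
  then have "sim2 (lin (mscal r A)) (lin A)" using sim2_smult[of "const2 r" "lin A"] assms(2) by simp
  then show ?thesis unfolding reparam_def by (intro sim3_eval2[OF assms(1)]) simp_all
qed

lemma reparam_scalar:
  assumes "homogs2 k p" "scalar A" "mdet A \<noteq> 0"
  shows "sim3 (reparam p A) p"
proof -
  obtain a where A: "A = (a, 0, 0, a)" using assms(2) by (cases A) (auto simp: scalar_def)
  then have "a \<noteq> 0" "A = mscal a (1, 0, 0, 1)" using assms(3) by (auto simp: mdet_def mscal_def)
  then show ?thesis using reparam_mscal[OF assms(1), of a "(1, 0, 0, 1)"] by (simp add: reparam_one)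
qed

lemma generic_pointD:
  assumes "generic_point G p"
  shows "\<exists>k. homogs2 k p" "p \<noteq> (0, 0, 0)" "homog3 k F \<Longrightarrow> eval3 const2 p F = 0 \<longleftrightarrow> G dvd F"
  using assms unfolding generic_point_def by blast+

text \<open>
  Modulo \<open>G\<close> the point \<open>u(v)\<close> is proportional to \<open>(X, Y, Z)\<close>.  So a form vanishing at \<open>u\<close> vanishes at
  \<open>u(v)\<close> and hence, up to a factor prime to \<open>G\<close>, is a multiple of \<open>G\<close>.
\<close>

lemma rational_curve_parametrised:
  assumes G: "prime_elem G" and rc: "rational_curve G"
  shows "\<exists>u v. parametrises G u v"
proof -
  obtain d e u0 u1 u2 v0 v1 where
    u: "homog2 d u0" "homog2 d u1" "homog2 d u2" "(u0, u1, u2) \<noteq> (0, 0, 0)"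
      "eval3 const2 (u0, u1, u2) G = 0" and
    v: "homog3 e v0" "homog3 e v1" "\<not> (G dvd v0 \<and> G dvd v1)" and
    vu: "(eval3 const2 (u0, u1, u2) v0, eval3 const2 (u0, u1, u2) v1) \<noteq> (0, 0)"
      "proportional2 (eval3 const2 (u0, u1, u2) v0, eval3 const2 (u0, u1, u2) v1) (varS, varT)" and
    uv: "\<not> (G dvd eval2 const3 (v0, v1) u0 \<and> G dvd eval2 const3 (v0, v1) u1 \<and> G dvd eval2 const3 (v0, v1) u2)"
      "G dvd eval2 const3 (v0, v1) u0 * varY - eval2 const3 (v0, v1) u1 * varX"
      "G dvd eval2 const3 (v0, v1) u0 * varZ - eval2 const3 (v0, v1) u2 * varX"
      "G dvd eval2 const3 (v0, v1) u1 * varZ - eval2 const3 (v0, v1) u2 * varY"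
    using rc unfolding rational_curve_def Let_def by blast
  define u where "u = (u0, u1, u2)"
  define w where "w = map_triple (eval2 const3 (v0, v1)) u"
  define w0 w1 w2 where "w0 = eval2 const3 (v0, v1) u0" and "w1 = eval2 const3 (v0, v1) u1"
    and "w2 = eval2 const3 (v0, v1) u2"
  note w = w0_def w1_def w2_def
  have w_eq: "w = (w0, w1, w2)" by (simp add: w_def u_def w)
  note uv = uv[folded w]
  have hw: "homog3 (d * e) w0" "homog3 (d * e) w1" "homog3 (d * e) w2"
    using u v by (simp_all add: w homog_eval2_const3)
  have ker: "G dvd F" if F: "homog3 k F" "eval3 const2 u F = 0" for F k
  proof -
    have "eval3 const3 w F = eval2 const3 (v0, v1) (eval3 const2 u F)"
      by (simp add: w_def eval2_eval3[where h'' = const3])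
    then have Fw: "eval3 const3 (w0, w1, w2) F = 0" using F by (simp add: w_eq)
    have *: "G dvd F" if "\<not> G dvd y" and
      *: "G dvd y * varX - x * w0" "G dvd y * varY - x * w1" "G dvd y * varZ - x * w2" for x y
    proof -
      have "G dvd eval3 const3 (y * varX, y * varY, y * varZ) F - eval3 const3 (x * w0, x * w1, x * w2) F"
        by (rule dvd_eval3_diff) (use * in simp_all)
      then have "G dvd y ^ k * F"
        by (simp add: homog3_scale[OF F(1)] eval3_vars Fw)
      then show ?thesis using G \<open>\<not> G dvd y\<close> by (meson prime_elem_dvd_mult_iff prime_elem_dvd_power)
    qed
    have "G dvd w1 * varX - varY * w0" "G dvd w2 * varX - varZ * w0" "G dvd w2 * varY - varZ * w1"
      using uv(2-4) by (metis dvd_minus_iff minus_diff_eq mult.commute)+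
    then show ?thesis
      using uv *[of w0 varX] *[of w1 varY] *[of w2 varZ] by (auto simp: mult.commute)
  qed
  have gu: "generic_point G u"
    unfolding generic_point_def
  proof (intro conjI allI impI iffI)
    show "\<exists>k. homogs2 k u" using u by (auto simp: homogs2_def u_def)
    show "u \<noteq> (0, 0, 0)" using u by (simp add: u_def)
    show "G dvd F" if "homog3 k F" "eval3 const2 u F = 0" for F k using that by (rule ker)
    show "eval3 const2 u F = 0" if "G dvd F" for F using that u(5) by (auto simp: u_def)
  qed
  have "sim3 (map_triple (eval2 const2 (map_pair (eval3 const2 p) (v0, v1))) u) p" if p: "generic_point G p" for p
  proof -
    have m: "map_triple (eval2 const2 (map_pair (eval3 const2 p) (v0, v1))) u = map_triple (eval3 const2 p) w"
      unfolding w_def map_triple_map_triple by (simp add: eval3_eval2[where h'' = const2] map_triple_def)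
    have "map_triple (eval3 const2 p) w \<noteq> (0, 0, 0)"
      using uv(1) generic_pointD(3)[OF p hw(1)] generic_pointD(3)[OF p hw(2)] generic_pointD(3)[OF p hw(3)]
      by (auto simp: w_eq)
    moreover have "homog3 (d * e + 1) (w0 * varY - w1 * varX)" "homog3 (d * e + 1) (w0 * varZ - w2 * varX)"
      "homog3 (d * e + 1) (w1 * varZ - w2 * varY)"
      using hw by (intro homog3_diff homog3_mult homog3_vars; simp)+
    then have "eval3 const2 p (w0 * varY - w1 * varX) = 0" "eval3 const2 p (w0 * varZ - w2 * varX) = 0"
      "eval3 const2 p (w1 * varZ - w2 * varY) = 0"
      using uv generic_pointD(3)[OF p] by blast+
    then have "proportional3 (map_triple (eval3 const2 p) w) p"
      by (cases p) (simp add: w_eq proportional3_def)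
    ultimately show ?thesis unfolding m using generic_pointD(2)[OF p] by (simp add: sim3_iff)
  qed
  moreover have "sim2 (map_pair (eval3 const2 u) (v0, v1)) (varS, varT)"
    using vu by (simp add: sim2_iff u_def)
  moreover have "homogp3 e (v0, v1)" using v by (simp add: homogp3_def)
  ultimately show ?thesis using gu unfolding parametrises_def by blast
qed

lemma homogp2_eval3:
  assumes "homogp3 e v" "homogs2 k p"
  shows "homogp2 (e * k) (map_pair (eval3 const2 p) v)"
  using assms by (cases p) (simp add: homogp2_def homogp3_def homogs2_def homog_eval3_const2)

text \<open>The inverse \<open>v\<close> reads the linear substitution off the reparametrised curve.\<close>

lemma reparam_inj:
  assumes par: "parametrises G u v" and AB: "mdet A \<noteq> 0" "mdet B \<noteq> 0"
    and sim: "sim3 (reparam u A) (reparam u B)"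
  shows "\<exists>r. r \<noteq> 0 \<and> A = mscal r B"
proof (rule lin_sim2[OF _ AB])
  obtain e where e: "homogp3 e v" using par by (auto simp: parametrises_def)
  have *: "sim2 (map_pair (eval3 const2 (reparam u C)) v) (lin C)" if "mdet C \<noteq> 0" for C
  proof -
    have "sim2 (map_pair (eval2 const2 (lin C)) (map_pair (eval3 const2 u) v))
        (map_pair (eval2 const2 (lin C)) (varS, varT))"
      using par eval2_lin_eq_0[OF that] by (intro sim2_hom) (auto simp: parametrises_def)
    then show ?thesis
      by (simp add: map_pair_map_pair eval2_eval3[where h'' = const2] reparam_def)
  qed
  have "sim2 (map_pair (eval3 const2 (reparam u A)) v) (map_pair (eval3 const2 (reparam u B)) v)"
    by (rule sim2_eval3[OF e rhom_const2 sim])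
  then show "sim2 (lin A) (lin B)" using * AB sim2_trans sim2_sym by blast
qed

text \<open>
  If a form vanishes at the image \<open>g(p)\<close>, its pullback by \<open>g\<close> is divisible by \<open>G\<close>; pulling back further by
  the inverse \<open>h\<close> recovers the form itself up to \<open>s\<close>, and divisibility by \<open>G\<close> becomes divisibility by \<open>G'\<close>.
\<close>

lemma generic_point_push:
  assumes G': "prime_elem G'" and p: "generic_point G p"
    and g: "homogs3 k g" and h: "homogs3 l h"
    and inv: "map_triple ((*) r) (subst3 g h) = map_triple ((*) s) (varX, varY, varZ)" "\<not> G' dvd s"
    and maps: "G dvd eval3 const3 g G'" "G' dvd eval3 const3 h G" and nz: "push g p \<noteq> (0, 0, 0)"
  shows "generic_point G' (push g p)"
  unfolding generic_point_def
proof (intro conjI allI impI iffI)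
  obtain j where j: "homogs2 j p" using generic_pointD(1)[OF p] by blast
  show "\<exists>k. homogs2 k (push g p)" unfolding push_def using homogs2_eval3[OF g j] by blast
  show "push g p \<noteq> (0, 0, 0)" by fact
  fix F i assume F: "homog3 i F"
  have e: "eval3 const2 (push g p) F = eval3 const2 p (eval3 const3 g F)"
    by (simp add: push_def eval3_eval3[where h'' = const2])
  have hF: "homog3 (i * k) (eval3 const3 g F)"
    using F g by (cases g) (simp add: homogs3_def homog_eval3_const3)
  show "eval3 const2 (push g p) F = 0" if "G' dvd F"
  proof -
    have "G dvd eval3 const3 g F" using that maps(1) by (auto simp: dvd_mult2)
    then show ?thesis using e generic_pointD(3)[OF p hF] by simp
  qed
  show "G' dvd F" if "eval3 const2 (push g p) F = 0"
  proof -
    have "G dvd eval3 const3 g F" using that e generic_pointD(3)[OF p hF] by simp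
    then obtain K where "eval3 const3 g F = G * K" by blast
    then have "eval3 const3 h (eval3 const3 g F) = eval3 const3 h G * eval3 const3 h K" by simp
    then have "G' dvd r ^ i * eval3 const3 (subst3 g h) F"
      using maps(2) by (simp add: subst3_eq eval3_eval3[where h'' = const3])
    also have "r ^ i * eval3 const3 (subst3 g h) F = s ^ i * F"
      using sim3_form_scale[OF F rhom_const3 inv(1)] by (simp add: eval3_vars)
    finally show ?thesis using inv(2) G' by (meson prime_elem_dvd_mult_iff prime_elem_dvd_power)
  qed
qed

section \<open>The fibration\<close>

locale fibration =
  fixes P Q :: poly3 and d :: nat
  assumes homPQ: "homog3 d P" "homog3 d Q"
    and coprime_PQ: "coprime P Q"
    and dominant_PQ: "\<And>k h. homog2 k h \<Longrightarrow> eval2 const3 (P, Q) h = 0 \<Longrightarrow> h = 0"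
    and general_fibre: "finite {c. \<not> (irreducible (P - const3 c * Q) \<and> rational_curve (P - const3 c * Q))}"
begin

definition fibre :: "complex \<Rightarrow> poly3" where "fibre c = P - const3 c * Q"

definition good :: "complex \<Rightarrow> bool" where
  "good c \<longleftrightarrow> prime_elem (fibre c) \<and> (\<exists>u v. parametrises (fibre c) u v)"

lemma finite_bad: "finite {c. \<not> good c}"
proof (rule rev_finite_subset[OF general_fibre], rule subsetI, clarify)
  fix c assume c: "\<not> good c" "irreducible (P - const3 c * Q)" "rational_curve (P - const3 c * Q)"
  then have "prime_elem (fibre c)" by (simp add: fibre_def prime_elem_iff_irreducible)
  moreover have "rational_curve (fibre c)" using c by (simp add: fibre_def)
  ultimately show False using c(1) rational_curve_parametrised unfolding good_def by blast
qed

lemma homog3_fibre: "homog3 d (fibre c)"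
  unfolding fibre_def by (intro homog3_diff homog3_cmult homPQ)

lemma PQ_nz: "P \<noteq> 0" "Q \<noteq> 0"
  using dominant_PQ[OF homog2_vars(1)] dominant_PQ[OF homog2_vars(2)] by auto

text \<open>Constant \<open>P\<close> and \<open>Q\<close> would satisfy a linear relation, against dominance.\<close>

lemma d_pos: "d > 0"
proof (rule ccontr)
  assume "\<not> d > 0"
  then have "homog3 0 P" "homog3 0 Q" using homPQ by auto
  moreover have "F = const3 (eval3 (\<lambda>c. c) (0, 0, 0) F)" if F: "homog3 0 F" for F
  proof -
    have "F = eval3 const3 (0 * varX, 0 * varY, 0 * varZ) F"
      unfolding homog3_scale[OF F rhom_const3] by (simp add: eval3_vars)
    also have "\<dots> = const3 (eval3 (\<lambda>c. c) (0, 0, 0) F)"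
      by (simp add: hom_eval3 rhomD[OF rhom_const3])
    finally show ?thesis .
  qed
  ultimately have "P = const3 (eval3 (\<lambda>c. c) (0, 0, 0) P)" "Q = const3 (eval3 (\<lambda>c. c) (0, 0, 0) Q)"
    by blast+
  then obtain a b where ab: "P = const3 a" "Q = const3 b" by blast
  have "eval2 const3 (P, Q) (const2 b * varS - const2 a * varT) = 0"
    by (simp add: ab mult.commute)
  then have "const2 b * varS - const2 a * varT = 0"
    by (rule dominant_PQ[OF homog2_diff[OF homog2_cmult[OF homog2_vars(1)] homog2_cmult[OF homog2_vars(2)]]])
  then have "b = 0" using const_pair_not_vars[of a b] by simp
  then show False using PQ_nz(2) ab by (simp add: const3_def)
qed

text \<open>Two different members of the pencil generate \<open>P\<close> and \<open>Q\<close>.\<close>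

lemma distinct_fibres_coprime:
  assumes "G dvd fibre a" "G dvd fibre b" "a \<noteq> b"
  shows "is_unit G"
proof -
  have "G dvd fibre a - fibre b" using assms by (rule_tac dvd_diff)
  also have "fibre a - fibre b = const3 (b - a) * Q"
    by (simp add: fibre_def rhomD[OF rhom_const3] algebra_simps)
  finally have "G dvd const3 (1 / (b - a)) * (const3 (b - a) * Q)" by (rule dvd_mult)
  also have "\<dots> = const3 1 * Q"
    using assms(3) by (simp only: mult.assoc[symmetric] flip: rhomD(4)[OF rhom_const3]) simp
  finally have Q: "G dvd Q" by (simp add: rhomD[OF rhom_const3])
  then have "G dvd fibre a + const3 a * Q" using assms(1) by simp
  then have "G dvd P" by (simp add: fibre_def)
  then show ?thesis using Q coprime_PQ by (rule_tac coprime_common_divisor)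
qed

text \<open>
  The fibres over good points are pairwise non-associated primes; this is what lets a polynomial
  identity be checked on infinitely many fibres.
\<close>

lemma finite_fibres_dvd:
  assumes "F \<noteq> 0"
  shows "finite {c. good c \<and> fibre c dvd F}"
proof (rule finite_imageD)
  have "(\<lambda>c. normalize (fibre c)) ` {c. good c \<and> fibre c dvd F} \<subseteq> {p. prime p \<and> p dvd F}"
    by (auto simp: good_def prime_def)
  then show "finite ((\<lambda>c. normalize (fibre c)) ` {c. good c \<and> fibre c dvd F})"
    using finite_prime_divisors[OF assms] finite_subset by blast
  show "inj_on (\<lambda>c. normalize (fibre c)) {c. good c \<and> fibre c dvd F}"
  proof (rule inj_onI, rule ccontr)
    fix a b assume ab: "a \<in> {c. good c \<and> fibre c dvd F}" "normalize (fibre a) = normalize (fibre b)" "a \<noteq> b"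
    then have "fibre a dvd fibre b" by (simp add: associated_iff_dvd)
    then have "is_unit (fibre a)" using distinct_fibres_coprime[of "fibre a" a b] ab by simp
    then show False using ab(1) by (simp add: good_def prime_elem_not_unit)
  qed
qed

text \<open>The equality \<open>f \<circ> g = A \<circ> f\<close> of rational maps to the line.\<close>

definition acts :: "mat \<Rightarrow> poly3 \<times> poly3 \<times> poly3 \<Rightarrow> bool" where
  "acts A g \<longleftrightarrow> sim2 (map_pair (eval3 const3 g) (P, Q)) (map_pair (eval2 const3 (P, Q)) (lin A))"

lemma acts_dvd:
  assumes "acts A g"
  shows "\<exists>r. r \<noteq> 0 \<and> (\<forall>c c' t. app A (c, 1) = (t * c', t) \<longrightarrow> fibre c dvd r * eval3 const3 g (fibre c'))"
proof -
  obtain r s where rs: "r \<noteq> 0" "s \<noteq> 0"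
    "map_pair ((*) r) (map_pair (eval3 const3 g) (P, Q)) = map_pair ((*) s) (map_pair (eval2 const3 (P, Q)) (lin A))"
    using assms by (auto simp: acts_def sim2_def)
  obtain a b e f where A: "A = (a, b, e, f)" by (cases A)
  have *: "r * eval3 const3 g P = s * (const3 a * P + const3 b * Q)"
    "r * eval3 const3 g Q = s * (const3 e * P + const3 f * Q)"
    using rs(3) by (simp_all add: A lin_def)
  have "fibre c dvd r * eval3 const3 g (fibre c')" if t: "app A (c, 1) = (t * c', t)" for c c' t
  proof -
    have "a * c + b = (e * c + f) * c'"
      using t by (simp add: A app_def mult.commute)
    then have "b - c' * f = - (c * (a - c' * e))" by algebra
    then have bf: "const3 b - const3 c' * const3 f = - (const3 c * (const3 a - const3 c' * const3 e))"
      by (simp flip: rhomD[OF rhom_const3])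
    have "r * eval3 const3 g (fibre c') = r * eval3 const3 g P - const3 c' * (r * eval3 const3 g Q)"
      by (simp add: fibre_def algebra_simps)
    also have "\<dots> = s * ((const3 a - const3 c' * const3 e) * P + (const3 b - const3 c' * const3 f) * Q)"
      unfolding * by (simp add: algebra_simps)
    also have "\<dots> = s * (const3 a - const3 c' * const3 e) * fibre c"
      unfolding bf by (simp add: fibre_def algebra_simps)
    finally show ?thesis by simp
  qed
  then show ?thesis using rs(1) by blast
qed

lemma lin_PQ:
  assumes "mdet A \<noteq> 0"
  shows "homogp3 d (map_pair (eval2 const3 (P, Q)) (lin A))" "map_pair (eval2 const3 (P, Q)) (lin A) \<noteq> (0, 0)"
proof -
  have l: "homog2 1 (fst (lin A))" "homog2 1 (snd (lin A))" using homogp2_lin by (simp_all add: homogp2_def)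
  show "homogp3 d (map_pair (eval2 const3 (P, Q)) (lin A))"
    using homog_eval2_const3[OF l(1) homPQ] homog_eval2_const3[OF l(2) homPQ] by (simp add: homogp3_def)
  show "map_pair (eval2 const3 (P, Q)) (lin A) \<noteq> (0, 0)"
  proof
    assume "map_pair (eval2 const3 (P, Q)) (lin A) = (0, 0)"
    then have "fst (lin A) = 0" "snd (lin A) = 0" using l dominant_PQ by (auto simp: map_pair_def)
    then have "eval2 const2 (lin A) varS = 0" "eval2 const2 (lin A) varT = 0" by simp_all
    then show False using eval2_lin_eq_0[OF assms] varS_nz by blast
  qed
qed

lemma homogp3_nz:
  assumes "F \<in> carrier BirP2" "g \<in> F" "homogp3 k x" "x \<noteq> (0, 0)"
  shows "map_pair (eval3 const3 g) x \<noteq> (0, 0)"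
  using assms BirP2_dominant[OF assms(1,2)] by (cases x) (auto simp: homogp3_def)

lemma acts_inv:
  assumes F: "F \<in> carrier BirP2" "g \<in> F" "h \<in> inv\<^bsub>BirP2\<^esub> F" and acts: "acts A g"
    and A: "mdet A \<noteq> 0" "mmul B A = (1, 0, 0, 1)"
  shows "acts B h"
proof -
  interpret group BirP2 by (rule group_BirP2)
  have PQ: "homogp3 d (P, Q)" using homPQ by (simp add: homogp3_def)
  define L R where "L = map_pair (eval3 const3 (subst3 g h)) (P, Q)"
    and "R = map_pair (eval2 const3 (eval3 const3 h P, eval3 const3 h Q)) (lin A)"
  have LR: "L = map_pair (eval3 const3 h) (map_pair (eval3 const3 g) (P, Q))"
    "R = map_pair (eval3 const3 h) (map_pair (eval2 const3 (P, Q)) (lin A))"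
    by (simp_all add: L_def R_def map_pair_map_pair subst3_eq eval3_eval3[where h'' = const3]
      eval3_eval2[where h'' = const3])
  have "proportional2 L R"
    unfolding LR using acts by (intro proportional2_hom proportional2_of_sim2) (simp_all add: acts_def)
  have L: "sim2 L (P, Q)"
    using sim2_eval3[OF PQ rhom_const3 BirP2_inv(1)[OF F]] by (simp add: L_def eval3_vars)
  have "L \<noteq> (0, 0)" using sim2_nz[OF L] PQ_nz by simp
  moreover have "R \<noteq> (0, 0)"
    unfolding LR by (rule homogp3_nz[OF inv_closed[OF F(1)] F(3) lin_PQ[OF A(1)]])
  ultimately have "sim2 L R" using \<open>proportional2 L R\<close> by (simp add: sim2_iff)
  then have "sim2 R (P, Q)" using L sim2_sym sim2_trans by blast
  then have "sim2 (map_pair (eval2 const3 R) (lin B)) (map_pair (eval2 const3 (P, Q)) (lin B))"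
    by (rule sim2_eval2[OF homogp2_lin rhom_const3])
  moreover have "map_pair (eval2 const3 R) (lin B) =
      map_pair (eval2 const3 (eval3 const3 h P, eval3 const3 h Q)) (map_pair (eval2 const2 (lin A)) (lin B))"
    by (simp add: R_def map_pair_map_pair eval2_eval2[where h'' = const3])
  ultimately show ?thesis by (simp add: lin_lin A(2) lin_one acts_def)
qed

lemma acts_mult:
  assumes F: "F \<in> carrier BirP2" "g \<in> F" and H: "H \<in> carrier BirP2" "h \<in> H"
    and acts: "acts A g" "acts B h" and A: "mdet A \<noteq> 0"
  shows "acts (mmul A B) (subst3 g h)"
proof -
  interpret group BirP2 by (rule group_BirP2)
  have PQ: "homogp3 d (P, Q)" using homPQ by (simp add: homogp3_def)
  define L R where "L = map_pair (eval3 const3 (subst3 g h)) (P, Q)"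
    and "R = map_pair (eval2 const3 (eval3 const3 h P, eval3 const3 h Q)) (lin A)"
  have LR: "L = map_pair (eval3 const3 h) (map_pair (eval3 const3 g) (P, Q))"
    "R = map_pair (eval3 const3 h) (map_pair (eval2 const3 (P, Q)) (lin A))"
    by (simp_all add: L_def R_def map_pair_map_pair subst3_eq eval3_eval3[where h'' = const3]
      eval3_eval2[where h'' = const3])
  have "proportional2 L R"
    unfolding LR using acts by (intro proportional2_hom proportional2_of_sim2) (simp_all add: acts_def)
  moreover have "L \<noteq> (0, 0)"
    unfolding L_def using PQ_nz homogp3_nz[OF _ BirP2_mult[OF F(1) H(1) F(2) H(2)] PQ] F(1) H(1) by simp
  moreover have "R \<noteq> (0, 0)"
    unfolding LR by (rule homogp3_nz[OF H lin_PQ[OF A]])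
  ultimately have "sim2 L R" by (simp add: sim2_iff)
  moreover have "sim2 R (map_pair (eval2 const3 (map_pair (eval2 const3 (P, Q)) (lin B))) (lin A))"
    unfolding R_def using acts(2) by (intro sim2_eval2[OF homogp2_lin]) (simp_all add: acts_def)
  ultimately have "sim2 L (map_pair (eval2 const3 (map_pair (eval2 const3 (P, Q)) (lin B))) (lin A))"
    by (rule sim2_trans)
  moreover have "map_pair (eval2 const3 (map_pair (eval2 const3 (P, Q)) (lin B))) (lin A) =
      map_pair (eval2 const3 (P, Q)) (map_pair (eval2 const2 (lin B)) (lin A))"
    by (simp add: map_pair_map_pair eval2_eval2[where h'' = const3])
  ultimately show ?thesis by (simp add: lin_lin acts_def L_def)
qed

lemma acts_cong:
  assumes "F \<in> carrier BirP2" "g \<in> F" "g' \<in> F" "acts A g"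
  shows "acts A g'"
proof -
  have "homogp3 d (P, Q)" using homPQ by (simp add: homogp3_def)
  then have "sim2 (map_pair (eval3 const3 g') (P, Q)) (map_pair (eval3 const3 g) (P, Q))"
    using BirP2_sim[OF assms(1,3,2)] by (intro sim2_eval3) simp_all
  then show ?thesis using assms(4) sim2_trans unfolding acts_def by blast
qed

lemma cofinite_not_dvd:
  assumes "F \<noteq> 0"
  shows "finite {c. good c \<longrightarrow> fibre c dvd F}"
proof -
  have "{c. good c \<longrightarrow> fibre c dvd F} = {c. \<not> good c} \<union> {c. good c \<and> fibre c dvd F}" by auto
  then show ?thesis using finite_bad finite_fibres_dvd[OF assms] by simp
qed

text \<open>
  The exceptional set \<open>S\<close> collects the fibres that divide one of a few polynomials attached to \<open>g\<close> and to its
  inverse \<open>h\<close>; composition with \<open>h\<close> shows that no other fibre is contracted.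
\<close>

lemma birational_generic_point:
  assumes F: "F \<in> carrier BirP2" "g \<in> F" "h \<in> inv\<^bsub>BirP2\<^esub> F" and acts: "acts A g" "acts B h"
    and AB: "mmul B A = (1, 0, 0, 1)"
  shows "\<exists>S. finite S \<and> (\<forall>c c' t p. c \<notin> S \<longrightarrow> c' \<notin> S \<longrightarrow> t \<noteq> 0 \<longrightarrow> app A (c, 1) = (t * c', t) \<longrightarrow>
    generic_point (fibre c) p \<longrightarrow> generic_point (fibre c') (push g p))"
proof -
  interpret group BirP2 by (rule group_BirP2)
  obtain k where k: "homogs3 k g" "g \<noteq> (0, 0, 0)" using BirP2_form[OF F(1,2)] by blast
  obtain l where l: "homogs3 l h" using BirP2_form[OF inv_closed[OF F(1)] F(3)] by blast
  obtain r s where rs: "r \<noteq> 0" "s \<noteq> 0" "map_triple ((*) r) (subst3 g h) = map_triple ((*) s) (varX, varY, varZ)"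
    using BirP2_inv(1)[OF F] by (auto simp: sim3_def)
  obtain q where q: "q \<noteq> 0" "\<And>c c' t. app A (c, 1) = (t * c', t) \<Longrightarrow> fibre c dvd q * eval3 const3 g (fibre c')"
    using acts_dvd[OF acts(1)] by blast
  obtain q' where q': "q' \<noteq> 0" "\<And>c c' t. app B (c, 1) = (t * c', t) \<Longrightarrow> fibre c dvd q' * eval3 const3 h (fibre c')"
    using acts_dvd[OF acts(2)] by blast
  obtain y where y: "y \<noteq> 0" "y = fst g \<or> y = fst (snd g) \<or> y = snd (snd g)" using k(2) by (cases g) auto
  define S where "S = {c. good c \<longrightarrow> fibre c dvd s * q * q' * y}"
  have "finite S" unfolding S_def using rs q q' y by (intro cofinite_not_dvd) simp
  moreover have "generic_point (fibre c') (push g p)"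
    if c: "c \<notin> S" "c' \<notin> S" "t \<noteq> 0" "app A (c, 1) = (t * c', t)" and p: "generic_point (fibre c) p" for c c' t p
  proof (rule generic_point_push[OF _ p k(1) l rs(3)])
    have pr: "prime_elem (fibre c)" "prime_elem (fibre c')" using c by (auto simp: S_def good_def)
    show "prime_elem (fibre c')" by fact
    show "\<not> fibre c' dvd s" using c(2) by (auto simp: S_def)
    show "fibre c dvd eval3 const3 g (fibre c')"
      using q(2)[OF c(4)] pr(1) c(1) by (auto simp: S_def prime_elem_dvd_mult_iff)
    have "app B (t * c', t) = (c, 1)" using app_mmul[of B A "(c, 1)"] by (simp add: AB c(4)) (simp add: app_def)
    then have "app B (c', 1) = (1 / t * c, 1 / t)"
      using c(3) by (cases B) (simp add: app_def field_simps)
    from q'(2)[OF this] show "fibre c' dvd eval3 const3 h (fibre c)"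
      using pr(2) c(2) by (auto simp: S_def prime_elem_dvd_mult_iff)
    have "homog3 k y" using y(2) k(1) by (auto simp: homogs3_def)
    moreover have "\<not> fibre c dvd y" using c(1) by (auto simp: S_def)
    ultimately have "eval3 const2 p y \<noteq> 0" using generic_pointD(3)[OF p] by blast
    then show "push g p \<noteq> (0, 0, 0)" using y(2) by (auto simp: push_def map_triple_def)
  qed
  ultimately show ?thesis by blast
qed

lemma preserves_iff:
  assumes "F \<in> carrier BirP2" "g \<in> F"
  shows "preserves_fibre_by_fibre (P, Q) F \<longleftrightarrow> acts (1, 0, 0, 1) g"
proof -
  have nz: "map_pair (eval3 const3 g) (P, Q) \<noteq> (0, 0)" if "g \<in> F" for g
    using BirP2_dominant[OF assms(1) that homPQ(1)] PQ_nz by auto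
  have 1: "acts (1, 0, 0, 1) g \<longleftrightarrow> proportional2 (map_pair (eval3 const3 g) (P, Q)) (P, Q)" if "g \<in> F" for g
    using sim2_iff[OF nz[OF that], of "(P, Q)"] PQ_nz by (simp add: acts_def lin_one)
  show ?thesis
  proof
    assume "preserves_fibre_by_fibre (P, Q) F"
    then obtain g' where g': "g' \<in> F"
      "proportional2 (eval3 const3 g' P, eval3 const3 g' Q) (P, Q)"
      unfolding preserves_fibre_by_fibre_def prod.case by blast
    then have "acts (1, 0, 0, 1) g'" using 1[OF g'(1)] by simp
    then show "acts (1, 0, 0, 1) g" by (rule acts_cong[OF assms(1) g'(1) assms(2)])
  next
    assume "acts (1, 0, 0, 1) g"
    then have "proportional2 (eval3 const3 g P, eval3 const3 g Q) (P, Q)" using 1[OF assms(2)] by simp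
    moreover have "(eval3 const3 g P, eval3 const3 g Q) \<noteq> (0, 0)" using nz[OF assms(2)] by simp
    ultimately show "preserves_fibre_by_fibre (P, Q) F"
      unfolding preserves_fibre_by_fibre_def prod.case using assms(2) by blast
  qed
qed

lemma push_proportional_dvd:
  assumes "generic_point G p" "homogs3 k x" "homogs3 l y" "proportional3 (push x p) (push y p)"
  shows "G dvd fst x * fst (snd y) - fst (snd x) * fst y" "G dvd fst x * snd (snd y) - snd (snd x) * fst y"
    "G dvd fst (snd x) * snd (snd y) - snd (snd x) * fst (snd y)"
proof -
  have h: "homog3 (k + l) (a * b - a' * b')" if "homog3 k a" "homog3 l b" "homog3 k a'" "homog3 l b'" for a b a' b'
    using that by (intro homog3_diff homog3_mult)
  show "G dvd fst x * fst (snd y) - fst (snd x) * fst y" "G dvd fst x * snd (snd y) - snd (snd x) * fst y"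
    "G dvd fst (snd x) * snd (snd y) - snd (snd x) * fst (snd y)"
    using assms(2-4) generic_pointD(3)[OF assms(1) h]
    by (auto simp: push_def homogs3_def proportional3_def map_triple_def)
qed

lemma proportional3_of_fibres:
  assumes "homogs3 k x" "homogs3 l y" "infinite C"
    and "\<And>c. c \<in> C \<Longrightarrow> good c \<and> (\<exists>p. generic_point (fibre c) p \<and> proportional3 (push x p) (push y p))"
  shows "proportional3 x y"
proof -
  have *: "F = 0" if "\<And>c. c \<in> C \<Longrightarrow> good c \<and> fibre c dvd F" for F
    using finite_fibres_dvd[of F] that assms(3) by (metis (mono_tags, lifting) mem_Collect_eq rev_finite_subset subsetI)
  have "fst x * fst (snd y) - fst (snd x) * fst y = 0" "fst x * snd (snd y) - snd (snd x) * fst y = 0"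
    "fst (snd x) * snd (snd y) - snd (snd x) * fst (snd y) = 0"
    by (rule *, use assms(4) push_proportional_dvd[OF _ assms(1,2)] in blast)+
  then show ?thesis by (cases x; cases y) (simp add: proportional3_def)
qed

text \<open>
  On the fibre over \<open>c\<close> the map \<open>g\<close> is described in the parameter by \<open>m = v(g(u))\<close> and its inverse \<open>h\<close> by
  \<open>m' = v(h(u))\<close>.  Since \<open>h \<circ> g\<close> is the identity, so is \<open>m' \<circ> m\<close>, and \<open>m\<close> is linear.
\<close>

lemma fibre_moebius:
  assumes F: "F \<in> carrier BirP2" "preserves_fibre_by_fibre (P, Q) F" "g \<in> F"
  shows "\<exists>S. finite S \<and> (\<forall>c u v. c \<notin> S \<longrightarrow> parametrises (fibre c) u v \<longrightarrow>
    (\<exists>A. mdet A \<noteq> 0 \<and> sim3 (push g u) (reparam u A)))"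
proof -
  interpret group BirP2 by (rule group_BirP2)
  have mm: "mmul (1, 0, 0, 1) (1, 0, 0, 1) = (1, 0, 0, 1)" by (simp add: mmul_def)
  define F' where "F' = inv\<^bsub>BirP2\<^esub> F"
  have F': "F' \<in> carrier BirP2" "inv\<^bsub>BirP2\<^esub> F' = F" using F(1) by (simp_all add: F'_def)
  obtain h l where h: "h \<in> F'" "homogs3 l h" using BirP2_rep[OF F'(1)] by blast
  obtain k where k: "homogs3 k g" using BirP2_form[OF F(1,3)] by blast
  have ag: "acts (1, 0, 0, 1) g" using F preserves_iff by blast
  have ah: "acts (1, 0, 0, 1) h"
    using acts_inv[OF F(1,3) h(1)[unfolded F'_def] ag _ mm] by (simp add: mdet_def)
  obtain S1 where S1: "finite S1" "\<And>c c' t p. c \<notin> S1 \<Longrightarrow> c' \<notin> S1 \<Longrightarrow> t \<noteq> 0 \<Longrightarrow>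
      app (1, 0, 0, 1) (c, 1) = (t * c', t) \<Longrightarrow> generic_point (fibre c) p \<Longrightarrow> generic_point (fibre c') (push g p)"
    using birational_generic_point[OF F(1,3) h(1)[unfolded F'_def] ag ah mm] by blast
  obtain S2 where S2: "finite S2" "\<And>c c' t p. c \<notin> S2 \<Longrightarrow> c' \<notin> S2 \<Longrightarrow> t \<noteq> 0 \<Longrightarrow>
      app (1, 0, 0, 1) (c, 1) = (t * c', t) \<Longrightarrow> generic_point (fibre c) p \<Longrightarrow> generic_point (fibre c') (push h p)"
    using birational_generic_point[OF F'(1) h(1) F(3)[folded F'(2)] ah ag mm] by blast
  have a1: "app (1, 0, 0, 1) (c, 1) = (1 * c, 1)" for c by (simp add: app_def)
  have "\<exists>A. mdet A \<noteq> 0 \<and> sim3 (push g u) (reparam u A)"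
    if c: "c \<notin> S1 \<union> S2" and par: "parametrises (fibre c) u v" for c u v
  proof -
    have gg: "generic_point (fibre c) (push g p)" and gh: "generic_point (fibre c) (push h p)"
      if "generic_point (fibre c) p" for p
      using that c S1(2)[OF _ _ _ a1, of c p] S2(2)[OF _ _ _ a1, of c p] by auto
    have u: "generic_point (fibre c) u" and vu: "sim2 (map_pair (eval3 const2 u) v) (varS, varT)"
      and uv: "\<And>p. generic_point (fibre c) p \<Longrightarrow> sim3 (map_triple (eval2 const2 (map_pair (eval3 const2 p) v)) u) p"
      using par by (auto simp: parametrises_def)
    obtain e where e: "homogp3 e v" using par by (auto simp: parametrises_def)
    obtain j where j: "homogs2 j u" using generic_pointD(1)[OF u] by blast
    define m m' where "m = map_pair (eval3 const2 (push g u)) v" and "m' = map_pair (eval3 const2 (push h u)) v"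
    have hm: "homogp2 (e * (k * j)) m" "homogp2 (e * (l * j)) m'"
      unfolding m_def m'_def push_def using homogp2_eval3[OF e] homogs2_eval3[OF k j] homogs2_eval3[OF h(2) j] by blast+
    have um: "sim3 (map_triple (eval2 const2 m) u) (push g u)"
      unfolding m_def by (rule uv[OF gg[OF u]])
    have "map_pair (eval2 const2 m) m' = map_pair (eval3 const2 (push h (map_triple (eval2 const2 m) u))) v"
      by (simp add: m'_def map_pair_def eval2_eval3[where h'' = const2] push_def map_triple_map_triple)
    moreover have "sim2 \<dots> (map_pair (eval3 const2 (push h (push g u))) v)"
      by (intro sim2_eval3[OF e] sim3_push[OF h(2)] um) simp
    moreover have "sim3 (push h (push g u)) u"
    proof -
      have "proportional3 (push (subst3 h g) u) (push (varX, varY, varZ) u)"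
        unfolding push_def using BirP2_inv(2)[OF F(1,3)] h(1)
        by (intro proportional3_hom proportional3_of_sim3) (simp_all add: F'_def)
      then show ?thesis
        using generic_pointD(2)[OF gh[OF gg[OF u]]] generic_pointD(2)[OF u]
        by (simp add: sim3_iff push_push push_vars)
    qed
    then have "sim2 (map_pair (eval3 const2 (push h (push g u))) v) (map_pair (eval3 const2 u) v)"
      by (intro sim2_eval3[OF e]) simp_all
    ultimately have s: "sim2 (map_pair (eval2 const2 m) m') (varS, varT)"
      using vu sim2_trans by metis
    obtain A where A: "mdet A \<noteq> 0" "sim2 m (lin A)"
      using moebius_of_left_inverse[OF hm _ proportional2_of_sim2[OF s]] sim2_nz[OF s] by auto
    have "sim3 (map_triple (eval2 const2 m) u) (reparam u A)"
      unfolding reparam_def by (rule sim3_eval2[OF j rhom_const2 A(2)])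
    then show ?thesis using A(1) um sim3_sym sim3_trans by blast
  qed
  then show ?thesis using S1(1) S2(1) by (intro exI[of _ "S1 \<union> S2"]) auto
qed

text \<open>
  On almost every fibre the three maps are Moebius transformations, and two transformations commuting
  with one that is not an involution commute.  An identity on infinitely many fibres holds on the plane.
\<close>

lemma fibrewise_centraliser_commutative:
  assumes F: "F \<in> carrier BirP2" "preserves_fibre_by_fibre (P, Q) F" "F \<otimes>\<^bsub>BirP2\<^esub> F \<noteq> \<one>\<^bsub>BirP2\<^esub>"
    and Z: "Z \<in> carrier BirP2" "preserves_fibre_by_fibre (P, Q) Z" "Z \<otimes>\<^bsub>BirP2\<^esub> F = F \<otimes>\<^bsub>BirP2\<^esub> Z"
    and Y: "Y \<in> carrier BirP2" "preserves_fibre_by_fibre (P, Q) Y" "Y \<otimes>\<^bsub>BirP2\<^esub> F = F \<otimes>\<^bsub>BirP2\<^esub> Y"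
  shows "Z \<otimes>\<^bsub>BirP2\<^esub> Y = Y \<otimes>\<^bsub>BirP2\<^esub> Z"
proof -
  interpret group BirP2 by (rule group_BirP2)
  obtain f k where f: "f \<in> F" "homogs3 k f" using BirP2_rep[OF F(1)] by blast
  obtain z l where z: "z \<in> Z" "homogs3 l z" using BirP2_rep[OF Z(1)] by blast
  obtain y n where y: "y \<in> Y" "homogs3 n y" using BirP2_rep[OF Y(1)] by blast
  obtain S1 where S1: "finite S1" "\<And>c u v. c \<notin> S1 \<Longrightarrow> parametrises (fibre c) u v \<Longrightarrow>
    \<exists>A. mdet A \<noteq> 0 \<and> sim3 (push f u) (reparam u A)" using fibre_moebius[OF F(1,2) f(1)] by blast
  obtain S2 where S2: "finite S2" "\<And>c u v. c \<notin> S2 \<Longrightarrow> parametrises (fibre c) u v \<Longrightarrow>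
    \<exists>A. mdet A \<noteq> 0 \<and> sim3 (push z u) (reparam u A)" using fibre_moebius[OF Z(1,2) z(1)] by blast
  obtain S3 where S3: "finite S3" "\<And>c u v. c \<notin> S3 \<Longrightarrow> parametrises (fibre c) u v \<Longrightarrow>
    \<exists>A. mdet A \<noteq> 0 \<and> sim3 (push y u) (reparam u A)" using fibre_moebius[OF Y(1,2) y(1)] by blast
  have hff: "homogs3 (k * k) (subst3 f f)" using homogs3_subst3 f(2) by blast
  have hX: "homogs3 1 (varX, varY, varZ)" by (simp add: homogs3_def del: One_nat_def)
  define S4 where "S4 = {c. good c \<and> (\<exists>p. generic_point (fibre c) p \<and>
    proportional3 (push (subst3 f f) p) (push (varX, varY, varZ) p))}"
  have "finite S4"
  proof (rule ccontr)
    assume "infinite S4"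
    then have "proportional3 (subst3 f f) (varX, varY, varZ)"
      by (rule proportional3_of_fibres[OF hff hX]) (auto simp: S4_def)
    then have "F \<otimes>\<^bsub>BirP2\<^esub> F = \<one>\<^bsub>BirP2\<^esub>"
      using BirP2_eqI[OF _ _ BirP2_mult[OF F(1) F(1) f(1) f(1)] BirP2_one] F(1) by simp
    then show False using F(3) by simp
  qed
  define C where "C = - (S1 \<union> S2 \<union> S3 \<union> S4 \<union> {c. \<not> good c})"
  have "infinite C"
    unfolding C_def using S1(1) S2(1) S3(1) \<open>finite S4\<close> finite_bad
    by (simp add: Compl_eq_Diff_UNIV Diff_infinite_finite infinite_UNIV_char_0 del: Un_Diff)
  have "proportional3 (subst3 z y) (subst3 y z)"
  proof (rule proportional3_of_fibres[OF homogs3_subst3[OF z(2) y(2)] homogs3_subst3[OF y(2) z(2)] \<open>infinite C\<close>])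
    fix c assume c: "c \<in> C"
    then obtain u v where par: "parametrises (fibre c) u v" by (auto simp: C_def good_def)
    have u: "generic_point (fibre c) u" using par by (simp add: parametrises_def)
    obtain j where j: "homogs2 j u" using generic_pointD(1)[OF u] by blast
    obtain M where M: "mdet M \<noteq> 0" "sim3 (push f u) (reparam u M)" using S1(2)[OF _ par] c by (auto simp: C_def)
    obtain A where A: "mdet A \<noteq> 0" "sim3 (push z u) (reparam u A)" using S2(2)[OF _ par] c by (auto simp: C_def)
    obtain B where B: "mdet B \<noteq> 0" "sim3 (push y u) (reparam u B)" using S3(2)[OF _ par] c by (auto simp: C_def)
    have comp: "sim3 (push (subst3 g h) u) (reparam u (mmul K L))"
      if "homogs3 i g" "sim3 (push g u) (reparam u K)" "sim3 (push h u) (reparam u L)" "mdet L \<noteq> 0" for g h K L i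
    proof -
      have "sim3 (push g (push h u)) (push g (reparam u L))" by (rule sim3_push[OF that(1,3)])
      moreover have "sim3 (push g (reparam u L)) (reparam (reparam u K) L)"
        using sim3_reparam[OF that(4,2)] by (simp add: push_reparam)
      ultimately show ?thesis unfolding push_push reparam_reparam by (rule sim3_trans)
    qed
    have commute: "mmul K M = mmul M K"
      if g: "homogs3 i g" "g \<in> X" "X \<in> carrier BirP2" "X \<otimes>\<^bsub>BirP2\<^esub> F = F \<otimes>\<^bsub>BirP2\<^esub> X"
        and K: "mdet K \<noteq> 0" "sim3 (push g u) (reparam u K)" for g X K i
    proof -
      have gf: "sim3 (push (subst3 g f) u) (reparam u (mmul K M))" "sim3 (push (subst3 f g) u) (reparam u (mmul M K))"
        using comp g(1) f(2) K M by blast+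
      have nz: "reparam u (mmul K M) \<noteq> (0, 0, 0)" "reparam u (mmul M K) \<noteq> (0, 0, 0)"
        using reparam_nz[OF _ generic_pointD(2)[OF u]] K M by (simp_all add: mdet_mmul)
      have "sim3 (subst3 g f) (subst3 f g)"
        using BirP2_sim[of "X \<otimes>\<^bsub>BirP2\<^esub> F"] BirP2_mult[OF g(3) F(1) g(2) f(1)] BirP2_mult[OF F(1) g(3) f(1) g(2)] g(3,4) F(1)
        by simp
      then have "proportional3 (push (subst3 g f) u) (push (subst3 f g) u)"
        unfolding push_def by (intro proportional3_hom proportional3_of_sim3) simp_all
      then have "sim3 (push (subst3 g f) u) (push (subst3 f g) u)"
        using sim3_nz[OF gf(1)] sim3_nz[OF gf(2)] nz by (simp add: sim3_iff)
      then have "sim3 (reparam u (mmul K M)) (reparam u (mmul M K))"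
        using gf sim3_sym sim3_trans by blast
      then obtain r where "mmul K M = mscal r (mmul M K)"
        using reparam_inj[OF par, of "mmul K M" "mmul M K"] K(1) M(1) by (auto simp: mdet_mmul)
      moreover have "\<not> scalar (mmul M M)"
      proof
        assume "scalar (mmul M M)"
        then have "sim3 (reparam u (mmul M M)) u" using reparam_scalar[OF j] M(1) by (simp add: mdet_mmul)
        then have "sim3 (push (subst3 f f) u) (push (varX, varY, varZ) u)"
          unfolding push_vars by (rule sim3_trans[OF comp[OF f(2) M(2) M(2,1)]])
        then have "c \<in> S4" using u c proportional3_of_sim3 unfolding S4_def C_def by blast
        then show False using c by (simp add: C_def)
      qed
      ultimately show ?thesis using commute_of_projectively_commute K M by blast
    qed
    have "\<not> scalar M"
    proof
      assume "scalar M"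
      then have "sim3 (reparam u M) u" using reparam_scalar[OF j] M(1) by simp
      then have "sim3 (push f u) u" using M(2) sim3_trans by blast
      then have "sim3 (push (subst3 f f) u) (push (varX, varY, varZ) u)"
        using sim3_trans[OF sim3_push[OF f(2)]] by (simp add: push_vars flip: push_push)
      then have "c \<in> S4" using u c proportional3_of_sim3 unfolding S4_def C_def by blast
      then show False using c by (simp add: C_def)
    qed
    then have AB: "mmul A B = mmul B A"
      using commute[OF z(2,1) Z(1,3) A] commute[OF y(2,1) Y(1,3) B] commute_of_common_commute by blast
    have "sim3 (push (subst3 z y) u) (push (subst3 y z) u)"
      by (rule sim3_trans[OF comp[OF z(2) A(2) B(2,1), unfolded AB] sim3_sym[OF comp[OF y(2) B(2) A(2,1)]]])
    then show "good c \<and> (\<exists>p. generic_point (fibre c) p \<and> proportional3 (push (subst3 z y) p) (push (subst3 y z) p))"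
      using c u proportional3_of_sim3 unfolding C_def by blast
  qed
  then show ?thesis
    using BirP2_eqI[OF _ _ BirP2_mult[OF Z(1) Y(1) z(1) y(1)] BirP2_mult[OF Y(1) Z(1) y(1) z(1)]] Z(1) Y(1) by simp
qed

end

lemma proportional2_sim2_left:
  fixes x y z :: "'r::idom \<times> 'r"
  assumes "sim2 x y" "proportional2 y z"
  shows "proportional2 x z"
proof (cases "x = (0, 0) \<or> z = (0, 0)")
  case True
  then show ?thesis by (cases x; cases z) (auto simp: proportional2_def)
next
  case False
  then show ?thesis using assms sim2_nz[OF assms(1)] sim2_iff sim2_trans proportional2_of_sim2 by metis
qed

context fibration
begin

section \<open>Maps commuting with a fibrewise map of infinite order\<close>

lemma homogp3_PQ: "homogp3 d (P, Q)"
  using homPQ by (simp add: homogp3_def)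

lemma acts_oneD: "acts (1, 0, 0, 1) g \<Longrightarrow> sim2 (map_pair (eval3 const3 g) (P, Q)) (P, Q)"
  by (simp add: acts_def lin_one)

lemma push_power:
  assumes F: "F \<in> carrier BirP2" "f \<in> F" and u: "homogs2 j u" "mdet M \<noteq> 0" "sim3 (push f u) (reparam u M)"
  shows "\<exists>g\<in>F [^]\<^bsub>BirP2\<^esub> (n::nat). sim3 (push g u) (reparam u (mpow M n))"
proof (induction n)
  case 0
  interpret group BirP2 by (rule group_BirP2)
  show ?case using BirP2_one by (intro bexI[of _ "(varX, varY, varZ)"]) (simp_all add: push_vars reparam_one)
next
  case (Suc n)
  interpret group BirP2 by (rule group_BirP2)
  obtain g where g: "g \<in> F [^]\<^bsub>BirP2\<^esub> n" "sim3 (push g u) (reparam u (mpow M n))" using Suc by blast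
  have Fn: "F [^]\<^bsub>BirP2\<^esub> n \<in> carrier BirP2" using F(1) by simp
  obtain k where k: "homogs3 k g" using BirP2_form[OF Fn g(1)] by blast
  have M: "mmul (mpow M n) M = mpow M (Suc n)"
  proof -
    have "mpow M 1 = M" by (cases M) (simp add: mmul_def)
    then show ?thesis using mpow_add[of M n 1] by simp
  qed
  have "sim3 (push (subst3 g f) u) (push g (reparam u M))"
    unfolding push_push[symmetric] by (rule sim3_push[OF k u(3)])
  also have "push g (reparam u M) = reparam (push g u) M" by (simp add: push_reparam)
  finally have "sim3 (push (subst3 g f) u) (reparam u (mpow M (Suc n)))"
    using sim3_trans[OF _ sim3_reparam[OF u(2) g(2)]] by (simp add: reparam_reparam M)
  moreover have "subst3 g f \<in> F [^]\<^bsub>BirP2\<^esub> Suc n"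
    using BirP2_mult[OF Fn F(1) g(1) F(2)] by simp
  ultimately show ?case by blast
qed

text \<open>
  An iterate of \<open>\<phi>\<close> that is not the identity is trivial on finitely many fibres only; so off a countable
  set of fibres all iterates are nontrivial.
\<close>

lemma very_general_fibre:
  assumes F: "F \<in> carrier BirP2" "preserves_fibre_by_fibre (P, Q) F" "f \<in> F"
    and inf: "\<And>n::nat. n \<ge> 1 \<Longrightarrow> F [^]\<^bsub>BirP2\<^esub> n \<noteq> \<one>\<^bsub>BirP2\<^esub>"
  shows "\<exists>S. countable S \<and> (\<forall>c. c \<notin> S \<longrightarrow> good c) \<and> (\<forall>c u v. c \<notin> S \<longrightarrow> parametrises (fibre c) u v \<longrightarrow>
    (\<exists>M. mdet M \<noteq> 0 \<and> sim3 (push f u) (reparam u M) \<and> (\<forall>n\<ge>1. \<not> scalar (mpow M n))))"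
proof -
  interpret group BirP2 by (rule group_BirP2)
  obtain S0 where S0: "finite S0" "\<And>c u v. c \<notin> S0 \<Longrightarrow> parametrises (fibre c) u v \<Longrightarrow>
    \<exists>A. mdet A \<noteq> 0 \<and> sim3 (push f u) (reparam u A)" using fibre_moebius[OF F] by blast
  have Fn: "F [^]\<^bsub>BirP2\<^esub> n \<in> carrier BirP2" for n :: nat using F(1) by simp
  have hX: "homogs3 1 (varX, varY, varZ)" by (simp add: homogs3_def del: One_nat_def)
  define S where "S n = {c. n \<ge> 1 \<and> good c \<and> (\<exists>p g. g \<in> F [^]\<^bsub>BirP2\<^esub> n \<and> generic_point (fibre c) p \<and>
    sim3 (push g p) p)}" for n :: nat
  have "finite (S n)" for n
  proof (cases "n \<ge> 1")
    case True
    obtain g k where g: "g \<in> F [^]\<^bsub>BirP2\<^esub> n" "homogs3 k g" using BirP2_rep[OF Fn] by blast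
    show ?thesis
    proof (rule ccontr)
      assume "infinite (S n)"
      then have "proportional3 g (varX, varY, varZ)"
      proof (rule proportional3_of_fibres[OF g(2) hX])
        fix c assume "c \<in> S n"
        then obtain p g' where p: "good c" "g' \<in> F [^]\<^bsub>BirP2\<^esub> n" "generic_point (fibre c) p" "sim3 (push g' p) p"
          by (auto simp: S_def)
        have "proportional3 (push g p) (push g' p)"
          unfolding push_def using BirP2_sim[OF Fn g(1) p(2)] by (intro proportional3_hom proportional3_of_sim3) simp_all
        moreover have "push g' p \<noteq> (0, 0, 0)" using sim3_nz[OF p(4)] generic_pointD(2)[OF p(3)] by simp
        ultimately have "proportional3 (push g p) p"
          using proportional3_trans[OF _ proportional3_of_sim3[OF p(4)]] by blast
        then show "good c \<and> (\<exists>p. generic_point (fibre c) p \<and> proportional3 (push g p) (push (varX, varY, varZ) p))"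
          using p unfolding push_vars by blast
      qed
      then show False using BirP2_eqI[OF Fn one_closed g(1) BirP2_one] inf[OF True] by simp
    qed
  qed (simp add: S_def)
  then have "countable (S0 \<union> {c. \<not> good c} \<union> (\<Union>n. S n))"
    using S0(1) finite_bad by (simp add: countable_finite)
  moreover have "\<exists>M. mdet M \<noteq> 0 \<and> sim3 (push f u) (reparam u M) \<and> (\<forall>n\<ge>1. \<not> scalar (mpow M n))"
    if c: "c \<notin> S0 \<union> {c. \<not> good c} \<union> (\<Union>n. S n)" and par: "parametrises (fibre c) u v" for c u v
  proof -
    obtain M where M: "mdet M \<noteq> 0" "sim3 (push f u) (reparam u M)" using S0(2)[OF _ par] c by blast
    have u: "generic_point (fibre c) u" using par by (simp add: parametrises_def)
    obtain j where j: "homogs2 j u" using generic_pointD(1)[OF u] by blast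
    have "\<not> scalar (mpow M n)" if "n \<ge> 1" for n
    proof
      assume sc: "scalar (mpow M n)"
      obtain g where g: "g \<in> F [^]\<^bsub>BirP2\<^esub> n" "sim3 (push g u) (reparam u (mpow M n))"
        using push_power[OF F(1,3) j M] by blast
      have "sim3 (push g u) u"
        using sim3_trans[OF g(2) reparam_scalar[OF j sc]] M(1) by (simp add: mdet_mpow)
      then have "c \<in> S n" unfolding S_def mem_Collect_eq using u g(1) c that by blast
      then show False using c by blast
    qed
    then show ?thesis using M by blast
  qed
  ultimately show ?thesis by (intro exI[of _ "S0 \<union> {c. \<not> good c} \<union> (\<Union>n. S n)"]) blast
qed

text \<open>
  If \<open>\<psi>\<close> commutes with \<open>\<phi>\<close>, the pullback of the fibration by \<open>\<psi>\<close> is again invariant under \<open>\<phi>\<close>; on a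
  very general fibre \<open>\<phi>\<close> is a Moebius transformation of infinite order, so the pullback is constant there.
\<close>

lemma pullback_constant_on_fibres:
  assumes F: "F \<in> carrier BirP2" "preserves_fibre_by_fibre (P, Q) F"
    and inf: "\<And>n::nat. n \<ge> 1 \<Longrightarrow> F [^]\<^bsub>BirP2\<^esub> n \<noteq> \<one>\<^bsub>BirP2\<^esub>"
    and H: "H \<in> carrier BirP2" "h \<in> H" "H \<otimes>\<^bsub>BirP2\<^esub> F = F \<otimes>\<^bsub>BirP2\<^esub> H"
  shows "\<exists>C. infinite C \<and> (\<forall>c\<in>C. good c \<and> (\<exists>p x y. generic_point (fibre c) p \<and> (x, y) \<noteq> (0, 0) \<and>
    const2 x * eval3 const2 p (eval3 const3 h P) = const2 y * eval3 const2 p (eval3 const3 h Q)))"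
proof -
  interpret group BirP2 by (rule group_BirP2)
  obtain f k where f: "f \<in> F" "homogs3 k f" using BirP2_rep[OF F(1)] by blast
  obtain l where h: "homogs3 l h" using BirP2_form[OF H(1,2)] by blast
  define R where "R = map_pair (eval3 const3 h) (P, Q)"
  have hR: "homogp3 (d * l) R"
    using h homPQ by (cases h) (simp add: R_def homogp3_def homogs3_def homog_eval3_const3)
  have Rnz: "R \<noteq> (0, 0)"
    unfolding R_def using PQ_nz by (intro homogp3_nz[OF H(1,2) homogp3_PQ]) simp
  have inv: "proportional2 (map_pair (eval3 const3 f) R) R"
  proof (rule proportional2_sim2_left)
    have "sim3 (subst3 h f) (subst3 f h)"
      using BirP2_sim[of "H \<otimes>\<^bsub>BirP2\<^esub> F"] BirP2_mult[OF H(1) F(1) H(2) f(1)] BirP2_mult[OF F(1) H(1) f(1) H(2)] H F(1)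
      by simp
    then have "sim2 (map_pair (eval3 const3 (subst3 h f)) (P, Q)) (map_pair (eval3 const3 (subst3 f h)) (P, Q))"
      by (intro sim2_eval3[OF homogp3_PQ]) simp_all
    then show "sim2 (map_pair (eval3 const3 f) R) (map_pair (eval3 const3 (subst3 f h)) (P, Q))"
      by (simp add: R_def subst3_eq eval3_eval3[where h'' = const3])
    have "acts (1, 0, 0, 1) f" using F f(1) preserves_iff by blast
    then have "proportional2 (map_pair (eval3 const3 h) (map_pair (eval3 const3 f) (P, Q))) R"
      unfolding R_def by (intro proportional2_hom proportional2_of_sim2 acts_oneD) simp_all
    then show "proportional2 (map_pair (eval3 const3 (subst3 f h)) (P, Q)) R"
      by (simp add: subst3_eq eval3_eval3[where h'' = const3])
  qed
  obtain S where S: "countable S" "\<And>c. c \<notin> S \<Longrightarrow> good c" "\<And>c u v. c \<notin> S \<Longrightarrow> parametrises (fibre c) u v \<Longrightarrow>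
    \<exists>M. mdet M \<noteq> 0 \<and> sim3 (push f u) (reparam u M) \<and> (\<forall>n\<ge>1. \<not> scalar (mpow M n))"
    using very_general_fibre[OF F f(1) inf] by blast
  obtain y where y: "y \<noteq> 0" "y = fst R \<or> y = snd R" using Rnz by (cases R) auto
  define C where "C = - (S \<union> {c. good c \<and> fibre c dvd y})"
  have "countable (- C)" unfolding C_def using S(1) finite_fibres_dvd[OF y(1)] by (simp add: countable_finite)
  have "infinite C"
  proof
    assume "finite C"
    then have "countable (C \<union> - C)" by (intro countable_Un countable_finite \<open>countable (- C)\<close>)
    then show False using uncountable_UNIV_complex by simp
  qed
  moreover have "good c \<and> (\<exists>p x y. generic_point (fibre c) p \<and> (x, y) \<noteq> (0, 0) \<and>
    const2 x * eval3 const2 p (eval3 const3 h P) = const2 y * eval3 const2 p (eval3 const3 h Q))" if c: "c \<in> C" for c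
  proof -
    have gc: "good c" using S(2) c by (simp add: C_def)
    then obtain u v where par: "parametrises (fibre c) u v" by (auto simp: good_def)
    have u: "generic_point (fibre c) u" using par by (simp add: parametrises_def)
    obtain j where j: "homogs2 j u" using generic_pointD(1)[OF u] by blast
    obtain M where M: "mdet M \<noteq> 0" "sim3 (push f u) (reparam u M)" "\<And>n. n \<ge> 1 \<Longrightarrow> \<not> scalar (mpow M n)"
      using S(3)[OF _ par] c by (auto simp: C_def)
    define r where "r = map_pair (eval3 const2 u) R"
    have hr: "homogp2 (d * l * j) r" unfolding r_def by (rule homogp2_eval3[OF hR j])
    have "homog3 (d * l) y" using y(2) hR by (auto simp: homogp3_def)
    then have "eval3 const2 u y \<noteq> 0" using generic_pointD(3)[OF u] c gc by (auto simp: C_def)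
    then have rnz: "r \<noteq> (0, 0)" using y(2) by (auto simp: r_def map_pair_def)
    have "proportional2 (map_pair (eval3 const2 (reparam u M)) R) r"
    proof (rule proportional2_sim2_left)
      show "sim2 (map_pair (eval3 const2 (reparam u M)) R) (map_pair (eval3 const2 (push f u)) R)"
        by (rule sim2_eval3[OF hR rhom_const2 sim3_sym[OF M(2)]])
      have "proportional2 (map_pair (eval3 const2 u) (map_pair (eval3 const3 f) R)) r"
        unfolding r_def using inv by (intro proportional2_hom) simp_all
      then show "proportional2 (map_pair (eval3 const2 (push f u)) R) r"
        by (simp add: push_def map_pair_map_pair eval3_eval3[where h'' = const2])
    qed
    moreover have "map_pair (eval3 const2 (reparam u M)) R = map_pair (eval2 const2 (lin M)) r"
      by (simp add: r_def reparam_def map_pair_map_pair eval2_eval3[where h'' = const2])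
    ultimately have "eval2 const2 (lin M) (fst r) * snd r = eval2 const2 (lin M) (snd r) * fst r"
      by (cases r) (simp add: proportional2_def)
    then obtain x z where xz: "(x, z) \<noteq> (0, 0)" "const2 x * fst r = const2 z * snd r"
      using invariant_ratio_constant[of "d * l * j" "fst r" "snd r" M] hr rnz M(1,3) by auto
    have "const2 x * eval3 const2 u (eval3 const3 h P) = const2 z * eval3 const2 u (eval3 const3 h Q)"
      using xz(2) by (simp add: r_def R_def)
    then show ?thesis using gc u xz(1) by blast
  qed
  ultimately show ?thesis by blast
qed

lemma many_fibres_degree:
  assumes "finite C" "\<And>c. c \<in> C \<Longrightarrow> good c \<and> fibre c dvd F" "F \<noteq> 0"
  shows "card C * d \<le> tdeg F"
  using assms
proof (induction C arbitrary: F rule: finite_induct)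
  case (insert c C)
  obtain K where K: "F = fibre c * K" using insert.prems by blast
  have "good a \<and> fibre a dvd K" if "a \<in> C" for a
  proof -
    have a: "good a" "fibre a dvd fibre c * K" using insert.prems(1)[of a] that K by auto
    then have "fibre a dvd fibre c \<or> fibre a dvd K" by (auto simp: good_def prime_elem_dvd_mult_iff)
    moreover have "\<not> fibre a dvd fibre c"
      using distinct_fibres_coprime[of "fibre a" a c] that insert.hyps(2) a(1)
      by (auto simp: good_def prime_elem_not_unit)
    ultimately show ?thesis using a by blast
  qed
  moreover have nz: "K \<noteq> 0" "fibre c \<noteq> 0" using insert.prems(2) K by auto
  ultimately have "card C * d \<le> tdeg K" using insert.IH by blast
  moreover have "tdeg F = d + tdeg K"
    unfolding K using nz tdeg_homog[OF homog3_fibre] by (simp add: tdeg_mult)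
  ultimately show ?case using insert.hyps by simp
qed simp

text \<open>
  That \<open>A(P, Q) P' = B(P, Q) Q'\<close> holds on a given fibre is one linear condition on the pair \<open>(A, B)\<close> of binary forms of degree \<open>k\<close>; these
  have \<open>2 k + 2\<close> coefficients, so \<open>A(P, Q) P' - B(P, Q) Q'\<close> can be made to vanish on \<open>2 k + 1\<close> fibres,
  more than its degree allows unless it is zero.
\<close>

lemma constant_on_fibres_imp_base_function:
  assumes R: "homog3 k P'" "homog3 k Q'" and C: "infinite C"
    and const: "\<And>c. c \<in> C \<Longrightarrow> good c \<and> (\<exists>p x y. generic_point (fibre c) p \<and> (x, y) \<noteq> (0, 0) \<and>
      const2 x * eval3 const2 p P' = const2 y * eval3 const2 p Q')"
  shows "\<exists>A B. homog2 k A \<and> homog2 k B \<and> (A, B) \<noteq> (0, 0) \<and>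
    eval2 const3 (P, Q) A * P' = eval2 const3 (P, Q) B * Q'"
proof -
  obtain C0 where C0: "C0 \<subseteq> C" "finite C0" "card C0 = 2 * k + 1"
    using infinite_arbitrarily_large[OF C] by blast
  obtain x y where xy: "\<And>c. c \<in> C \<Longrightarrow> \<exists>p. generic_point (fibre c) p \<and> (x c, y c) \<noteq> (0, 0) \<and>
      const2 (x c) * eval3 const2 p P' = const2 (y c) * eval3 const2 p Q'"
    using const by metis
  define e where "e = (\<lambda>(b, i) c. if b then c ^ i * y c else - (c ^ i * x c))"
  have cardI: "card C0 < card ((UNIV :: bool set) \<times> {..k})" using C0 by (simp add: card_cartesian_product)
  obtain t where t: "\<exists>i\<in>UNIV \<times> {..k}. t i \<noteq> 0" "\<And>c. c \<in> C0 \<Longrightarrow> (\<Sum>i\<in>UNIV \<times> {..k}. t i * e i c) = 0"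
    using underdetermined_system[OF C0(2) _ cardI, of e] by auto
  define a b where "a = (\<Sum>i\<le>k. monom (t (True, i)) i)" and "b = (\<Sum>i\<le>k. monom (t (False, i)) i)"
  have co: "coeff a i = (if i \<le> k then t (True, i) else 0)" "coeff b i = (if i \<le> k then t (False, i) else 0)" for i
    by (simp_all add: a_def b_def coeff_sum)
  have deg: "degree a \<le> k" "degree b \<le> k" by (rule degree_le; simp add: co)+
  have ab: "poly a c * y c = poly b c * x c" if "c \<in> C0" for c
  proof -
    have "(\<Sum>i\<in>UNIV \<times> {..k}. t i * e i c) = (\<Sum>b\<in>UNIV. \<Sum>i\<le>k. t (b, i) * e (b, i) c)"
      by (simp add: sum.cartesian_product split_def)
    also have "\<dots> = poly a c * y c - poly b c * x c"
      by (simp add: UNIV_bool e_def a_def b_def poly_sum poly_monom sum_distrib_left sum_distrib_right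
        sum_negf algebra_simps)
    finally show ?thesis using t(2)[OF that] by simp
  qed
  define A B where "A = homogenise k a" and "B = homogenise k b"
  have hAB: "homog2 k A" "homog2 k B" by (simp_all add: A_def B_def homog2_homogenise)
  have nz: "(A, B) \<noteq> (0, 0)"
  proof
    assume "(A, B) = (0, 0)"
    then have "a = 0" "b = 0" using dehomog_homogenise[OF deg(1)] dehomog_homogenise[OF deg(2)] by (auto simp: A_def B_def)
    then have "t (z, i) = 0" if "i \<le> k" for z i using co[of i] that by (cases z) simp_all
    then show False using t(1) by auto
  qed
  define F where "F = eval2 const3 (P, Q) A * P' - eval2 const3 (P, Q) B * Q'"
  have hF: "homog3 (k * d + k) F"
    unfolding F_def using R hAB homPQ by (intro homog3_diff homog3_mult homog_eval2_const3)
  have "good c \<and> fibre c dvd F" if c: "c \<in> C0" for c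
  proof -
    have cC: "c \<in> C" using c C0(1) by blast
    obtain p where p: "generic_point (fibre c) p" "(x c, y c) \<noteq> (0, 0)"
      "const2 (x c) * eval3 const2 p P' = const2 (y c) * eval3 const2 p Q'" using xy[OF cC] by blast
    define q r0 r1 where "q = eval3 const2 p Q" and "r0 = eval3 const2 p P'" and "r1 = eval3 const2 p Q'"
    have "eval3 const2 p (fibre c) = 0" using generic_pointD(3)[OF p(1) homog3_fibre] by simp
    then have Pp: "eval3 const2 p P = q * const2 c" by (simp add: fibre_def q_def mult.commute)
    have ev: "eval3 const2 p (eval2 const3 (P, Q) (homogenise k s)) = q ^ k * const2 (poly s c)" if "degree s \<le> k" for s
    proof -
      have "eval3 const2 p (eval2 const3 (P, Q) (homogenise k s)) = eval2 const2 (q * const2 c, q * 1) (homogenise k s)"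
        by (simp add: eval3_eval2[where h'' = const2] Pp flip: q_def)
      also have "\<dots> = q ^ k * eval2 const2 (const2 c, const2 1) (homogenise k s)"
        using homog2_scale[OF homog2_homogenise[of k s] rhom_const2, of q "const2 c" 1] by (simp add: const2_simps)
      also have "eval2 const2 (const2 c, const2 1) (homogenise k s) = const2 (poly (dehomog (homogenise k s)) c)"
        by (simp add: poly_dehomog hom_eval2)
      finally show ?thesis by (simp add: dehomog_homogenise[OF that])
    qed
    have "eval3 const2 p F = q ^ k * (const2 (poly a c) * r0 - const2 (poly b c) * r1)"
      by (simp add: F_def A_def B_def ev deg r0_def r1_def algebra_simps)
    moreover have "const2 (poly a c) * r0 - const2 (poly b c) * r1 = 0"
    proof -
      have e: "const2 (poly a c) * const2 (y c) = const2 (poly b c) * const2 (x c)"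
        using ab[OF c] by (simp flip: const2_simps)
      have "const2 (x c) * (const2 (poly a c) * r0 - const2 (poly b c) * r1) = 0"
        "const2 (y c) * (const2 (poly a c) * r0 - const2 (poly b c) * r1) = 0"
        using e p(3)[folded r0_def r1_def] by algebra+
      then show ?thesis using p(2) by auto
    qed
    ultimately have "eval3 const2 p F = 0" by simp
    then show ?thesis using generic_pointD(3)[OF p(1) hF] const[OF cC] by simp
  qed
  then have "F = 0"
  proof (rule_tac ccontr)
    assume F: "F \<noteq> 0" and "\<And>c. c \<in> C0 \<Longrightarrow> good c \<and> fibre c dvd F"
    then have "card C0 * d \<le> k * d + k" using many_fibres_degree[OF C0(2), of F] tdeg_homog[OF hF F] by simp
    then have "2 * (k * d) + d \<le> k * d + k" unfolding C0(3) by (simp add: algebra_simps)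
    moreover have "k * 1 \<le> k * d" using d_pos by (intro mult_le_mono2) simp
    ultimately show False using d_pos by linarith
  qed
  then show ?thesis using hAB nz by (intro exI[of _ A] exI[of _ B]) (simp add: F_def)
qed

lemma pullback_base_function:
  assumes F: "F \<in> carrier BirP2" "preserves_fibre_by_fibre (P, Q) F"
    and inf: "\<And>n::nat. n \<ge> 1 \<Longrightarrow> F [^]\<^bsub>BirP2\<^esub> n \<noteq> \<one>\<^bsub>BirP2\<^esub>"
    and H: "H \<in> carrier BirP2" "h \<in> H" "H \<otimes>\<^bsub>BirP2\<^esub> F = F \<otimes>\<^bsub>BirP2\<^esub> H"
  shows "\<exists>k m. homogp2 k m \<and> sim2 (map_pair (eval3 const3 h) (P, Q)) (map_pair (eval2 const3 (P, Q)) m)"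
proof -
  obtain l where h: "homogs3 l h" using BirP2_form[OF H(1,2)] by blast
  have hR: "homog3 (d * l) (eval3 const3 h P)" "homog3 (d * l) (eval3 const3 h Q)"
    using h homPQ by (cases h, simp add: homogs3_def homog_eval3_const3)+
  obtain C where C: "infinite C" "\<And>c. c \<in> C \<Longrightarrow> good c \<and> (\<exists>p x y. generic_point (fibre c) p \<and> (x, y) \<noteq> (0, 0) \<and>
    const2 x * eval3 const2 p (eval3 const3 h P) = const2 y * eval3 const2 p (eval3 const3 h Q))"
    using pullback_constant_on_fibres[OF F inf H] by blast
  obtain A B where AB: "homog2 (d * l) A" "homog2 (d * l) B" "(A, B) \<noteq> (0, 0)"
    "eval2 const3 (P, Q) A * eval3 const3 h P = eval2 const3 (P, Q) B * eval3 const3 h Q"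
    using constant_on_fibres_imp_base_function[OF hR C] by blast
  have "map_pair (eval3 const3 h) (P, Q) \<noteq> (0, 0)"
    using PQ_nz by (intro homogp3_nz[OF H(1,2) homogp3_PQ]) simp
  moreover have "map_pair (eval2 const3 (P, Q)) (B, A) \<noteq> (0, 0)"
    using AB dominant_PQ by auto
  moreover have "proportional2 (map_pair (eval3 const3 h) (P, Q)) (map_pair (eval2 const3 (P, Q)) (B, A))"
    using AB(4) by (simp add: proportional2_def mult.commute)
  ultimately have "sim2 (map_pair (eval3 const3 h) (P, Q)) (map_pair (eval2 const3 (P, Q)) (B, A))"
    by (simp add: sim2_iff)
  moreover have "homogp2 (d * l) (B, A)" using AB by (simp add: homogp2_def)
  ultimately show ?thesis by blast
qed

text \<open>
  The pullbacks by \<open>\<psi>\<close> and by its inverse are \<open>m \<circ> f\<close> and \<open>m' \<circ> f\<close>; composing them gives \<open>m' \<circ> m \<circ> f = f\<close>,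
  and \<open>m' \<circ> m\<close> is the identity because \<open>f\<close> is dominant.
\<close>

lemma centraliser_acts:
  assumes F: "F \<in> carrier BirP2" "preserves_fibre_by_fibre (P, Q) F"
    and inf: "\<And>n::nat. n \<ge> 1 \<Longrightarrow> F [^]\<^bsub>BirP2\<^esub> n \<noteq> \<one>\<^bsub>BirP2\<^esub>"
    and H: "H \<in> carrier BirP2" "h \<in> H" "H \<otimes>\<^bsub>BirP2\<^esub> F = F \<otimes>\<^bsub>BirP2\<^esub> H"
  shows "\<exists>A. mdet A \<noteq> 0 \<and> acts A h"
proof -
  interpret group BirP2 by (rule group_BirP2)
  define H' where "H' = inv\<^bsub>BirP2\<^esub> H"
  have H': "H' \<in> carrier BirP2" using H(1) by (simp add: H'_def)
  have comm': "H' \<otimes>\<^bsub>BirP2\<^esub> F = F \<otimes>\<^bsub>BirP2\<^esub> H'"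
    unfolding H'_def using H(1,3) F(1) by (metis inv_solve_left inv_solve_right inv_closed m_assoc m_closed)
  obtain h' where h': "h' \<in> H'" using BirP2_rep[OF H'] by blast
  obtain k m where m: "homogp2 k m" "sim2 (map_pair (eval3 const3 h) (P, Q)) (map_pair (eval2 const3 (P, Q)) m)"
    using pullback_base_function[OF F inf H] by blast
  obtain k' m' where m': "homogp2 k' m'" "sim2 (map_pair (eval3 const3 h') (P, Q)) (map_pair (eval2 const3 (P, Q)) m')"
    using pullback_base_function[OF F inf H' h' comm'] by blast
  define n where "n = map_pair (eval2 const2 m) m'"
  define L where "L = map_pair (eval3 const3 (subst3 h' h)) (P, Q)"
  have L: "sim2 L (P, Q)"
    using sim2_eval3[OF homogp3_PQ rhom_const3 BirP2_inv(2)[OF H(1,2) h'[unfolded H'_def]]]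
    by (simp add: L_def eval3_vars)
  have nzPQ: "(P, Q) \<noteq> (0, 0)" using PQ_nz by simp
  have mnz: "map_pair (eval2 const3 (P, Q)) m \<noteq> (0, 0)"
    using sim2_nz[OF m(2)] homogp3_nz[OF H(1,2) homogp3_PQ nzPQ] by blast
  have mnz': "map_pair (eval2 const3 (P, Q)) m' \<noteq> (0, 0)"
    using sim2_nz[OF m'(2)] homogp3_nz[OF H' h' homogp3_PQ nzPQ] by blast
  have "proportional2 L (map_pair (eval3 const3 h) (map_pair (eval2 const3 (P, Q)) m'))"
  proof -
    have "L = map_pair (eval3 const3 h) (map_pair (eval3 const3 h') (P, Q))"
      by (simp add: L_def map_pair_map_pair subst3_eq eval3_eval3[where h'' = const3])
    then show ?thesis using m'(2) by (simp only:) (intro proportional2_hom proportional2_of_sim2; simp)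
  qed
  moreover have "L \<noteq> (0, 0)" using sim2_nz[OF L] nzPQ by simp
  moreover have "map_pair (eval3 const3 h) (map_pair (eval2 const3 (P, Q)) m') \<noteq> (0, 0)"
  proof (rule homogp3_nz[OF H(1,2) _ mnz'])
    show "homogp3 (k' * d) (map_pair (eval2 const3 (P, Q)) m')"
      using m'(1) homPQ by (simp add: homogp3_def homogp2_def homog_eval2_const3)
  qed
  ultimately have "sim2 L (map_pair (eval3 const3 h) (map_pair (eval2 const3 (P, Q)) m'))" by (simp add: sim2_iff)
  also have "map_pair (eval3 const3 h) (map_pair (eval2 const3 (P, Q)) m') =
      map_pair (eval2 const3 (map_pair (eval3 const3 h) (P, Q))) m'"
    by (simp add: map_pair_map_pair eval3_eval2[where h'' = const3])
  finally have "sim2 L (map_pair (eval2 const3 (map_pair (eval3 const3 h) (P, Q))) m')" .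
  from sim2_trans[OF this sim2_eval2[OF m'(1) rhom_const3 m(2)]]
  have "sim2 L (map_pair (eval2 const3 (map_pair (eval2 const3 (P, Q)) m)) m')" .
  also have "map_pair (eval2 const3 (map_pair (eval2 const3 (P, Q)) m)) m' = map_pair (eval2 const3 (P, Q)) n"
    by (simp add: n_def map_pair_map_pair eval2_eval2[where h'' = const3])
  finally have n: "sim2 (P, Q) (map_pair (eval2 const3 (P, Q)) n)"
    using sim2_trans[OF sim2_sym[OF L]] by blast
  then have nnz: "n \<noteq> (0, 0)" using sim2_nz[OF n] nzPQ by auto
  have hn: "homogp2 (k' * k) n"
    using m(1) m'(1) by (cases m) (simp add: n_def homogp2_def homog_eval2_const2)
  have "eval2 const3 (P, Q) (varS * snd n - varT * fst n) = 0"
    using proportional2_of_sim2[OF n] by (simp add: proportional2_def map_pair_def)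
  moreover have "homog2 (1 + k' * k) (varS * snd n - varT * fst n)"
    using hn by (intro homog2_diff homog2_mult homog2_vars) (simp_all add: homogp2_def)
  ultimately have "varS * snd n - varT * fst n = 0" using dominant_PQ by blast
  then have "proportional2 n (varS, varT)" by (cases n) (simp add: proportional2_def mult.commute)
  then obtain A where A: "mdet A \<noteq> 0" "sim2 m (lin A)"
    using moebius_of_left_inverse[OF m(1) m'(1)] nnz by (auto simp: n_def)
  have "proportional2 (map_pair (eval2 const3 (P, Q)) m) (map_pair (eval2 const3 (P, Q)) (lin A))"
    using A(2) by (intro proportional2_hom proportional2_of_sim2) simp_all
  then have "sim2 (map_pair (eval2 const3 (P, Q)) m) (map_pair (eval2 const3 (P, Q)) (lin A))"
    using mnz lin_PQ(2)[OF A(1)] by (simp add: sim2_iff)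
  then show ?thesis using A(1) m(2) sim2_trans unfolding acts_def by blast
qed

end

section \<open>Bounding the degrees of the iterates\<close>

lemma coeff_dehomog3:
  assumes "homog3 d G"
  shows "coeff (coeff (eval3 const2 (1, varS, varT) G) k) j =
    (if j + k \<le> d then coeff (coeff (coeff G k) j) (d - j - k) else 0)"
proof -
  have one: "coeff (coeff (coeff G k) j) i = 0" if "i + j + k \<noteq> d" for i j k
    using assms that by (auto simp: homog3_def)
  have "coeff (coeff (eval3 const2 (1, varS, varT) G) k) j =
    (\<Sum>k'\<le>degree G. \<Sum>j'\<le>degree (coeff G k'). \<Sum>i\<le>degree (coeff (coeff G k') j').
      if k' = k then if j' = j then coeff (coeff (coeff G k) j) i else 0 else 0)"
    by (auto simp: eval3_sum coeff_sum mono2 intro!: sum.cong)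
  also have "\<dots> = (\<Sum>k'\<le>degree G. \<Sum>j'\<le>degree (coeff G k').
      if k' = k then if j' = j then \<Sum>i\<le>degree (coeff (coeff G k) j). coeff (coeff (coeff G k) j) i else 0 else 0)"
    by (intro sum.cong refl) auto
  also have "\<dots> = (\<Sum>k'\<le>degree G. if k' = k then
      if j \<le> degree (coeff G k) then \<Sum>i\<le>degree (coeff (coeff G k) j). coeff (coeff (coeff G k) j) i else 0 else 0)"
    by (intro sum.cong refl, rename_tac k', case_tac "k' = k") auto
  also have "\<dots> = (\<Sum>i\<le>degree (coeff (coeff G k) j). coeff (coeff (coeff G k) j) i)"
    by (auto simp: coeff_eq_0 not_le)
  also have "\<dots> = (\<Sum>i\<le>degree (coeff (coeff G k) j). if i = d - j - k then
      if j + k \<le> d then coeff (coeff (coeff G k) j) (d - j - k) else 0 else 0)"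
    by (intro sum.cong refl) (use one in \<open>auto intro!: one\<close>)
  also have "\<dots> = (if j + k \<le> d then coeff (coeff (coeff G k) j) (d - j - k) else 0)"
    by (auto simp: coeff_eq_0 not_le)
  finally show ?thesis .
qed

text \<open>
  Let \<open>a\<close> be a parametrisation of a plane curve of degree \<open>d\<close> from which the parameter can be recovered
  rationally.  The coordinate \<open>a\<^sub>1 / a\<^sub>0\<close> takes a general value \<open>\<xi>\<close> only at points of the curve on one line,
  hence at most \<open>d\<close> times, and so has degree at most \<open>d\<close>.
\<close>

lemma coordinate_degree_le:
  assumes G: "homog3 d G" "G \<noteq> 0" "eval3 const2 a G = 0"
    and a: "homogs2 j a" "fst a \<noteq> 0"
    and W: "homogp3 e W" "sim2 (map_pair (eval3 const2 a) W) (varS, varT)"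
  shows "\<exists>p q. homog2 d p \<and> homog2 d q \<and> p \<noteq> 0 \<and> fst a * q = fst (snd a) * p"
proof -
  obtain a0 a1 a2 where a012: "a = (a0, a1, a2)" by (cases a)
  have ha: "homog2 j a0" "homog2 j a1" "homog2 j a2" using a(1) by (simp_all add: homogs2_def a012)
  define w0 w1 where "w0 = eval3 const2 a (fst W)" and "w1 = eval3 const2 a (snd W)"
  have hw: "homog2 (e * j) w1"
    using W(1) ha by (simp add: w1_def a012 homogp3_def homog_eval3_const2)
  have wST: "w0 * varT = w1 * varS"
    using proportional2_of_sim2[OF W(2)] by (simp add: proportional2_def map_pair_def w0_def w1_def)
  have w1: "w1 \<noteq> 0"
    using sim2_nz[OF W(2)] wST by (auto simp: map_pair_def w0_def w1_def)
  define d0 d1 d2 b where "d0 = dehomog a0" and "d1 = dehomog a1" and "d2 = dehomog a2"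
    and "b = d0 * dehomog w1"
  have d0: "d0 \<noteq> 0" using a(2) ha by (simp add: d0_def dehomog_eq_0_iff a012)
  have b: "b \<noteq> 0" using d0 w1 hw by (simp add: b_def dehomog_eq_0_iff)
  have w0s: "poly (dehomog w0) s = poly (dehomog w1) s * s" for s
    using arg_cong[OF wST, of "\<lambda>F. poly (dehomog F) s"] by (simp add: mult.commute)
  define \<Gamma> where "\<Gamma> = eval3 const2 (1, varS, varT) G"
  have "\<Gamma> \<noteq> 0"
  proof
    assume 0: "\<Gamma> = 0"
    have "coeff (coeff (coeff G k) j) i = 0" for i j k
      using coeff_dehomog3[OF G(1), of k j] 0 G(1) by (cases "i + j + k = d") (auto simp: \<Gamma>_def homog3_def)
    then have "G = 0" by (intro poly_eqI) simp
    then show False using G(2) by simp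
  qed
  have deg: "degree \<Gamma> \<le> d"
    unfolding \<Gamma>_def by (intro degree_le allI impI poly_eqI) (simp add: coeff_dehomog3[OF G(1)])
  define sl where "sl \<xi> = map_poly (\<lambda>p. poly p \<xi>) \<Gamma>" for \<xi>
  have sl: "poly (sl \<xi>) z = eval3 (\<lambda>c. c) (1, \<xi>, z) G" for \<xi> z
  proof -
    have "eval1 (\<lambda>c. c) \<xi> = (\<lambda>p. poly p \<xi>)" by (simp add: eval1_def fun_eq_iff)
    then have "poly (sl \<xi>) z = eval2 (\<lambda>c. c) (\<xi>, z) \<Gamma>" by (simp add: sl_def eval2_def)
    then show ?thesis by (simp add: \<Gamma>_def eval2_eval3[where h'' = "\<lambda>c. c"])
  qed
  define B where "B = {\<xi>. poly (lead_coeff \<Gamma>) \<xi> = 0}"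
  have "finite B" unfolding B_def using \<open>\<Gamma> \<noteq> 0\<close> by (intro poly_roots_finite) simp
  have small: "finite {s. poly b s \<noteq> 0 \<and> poly d1 s = \<xi> * poly d0 s} \<and>
      card {s. poly b s \<noteq> 0 \<and> poly d1 s = \<xi> * poly d0 s} \<le> d" if xi: "\<xi> \<notin> B" for \<xi>
  proof -
    define S where "S = {s. poly b s \<noteq> 0 \<and> poly d1 s = \<xi> * poly d0 s}"
    define \<zeta> where "\<zeta> s = poly d2 s / poly d0 s" for s
    have ev: "eval2 (\<lambda>c. c) (s, 1) (eval3 const2 a F) = poly d0 s ^ m * eval3 (\<lambda>c. c) (1, \<xi>, \<zeta> s) F"
      if "s \<in> S" "homog3 m F" for s m F
    proof -
      have "poly d0 s \<noteq> 0" using that(1) by (auto simp: S_def b_def)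
      then have "map_triple (eval2 (\<lambda>c. c) (s, 1)) a = (poly d0 s * 1, poly d0 s * \<xi>, poly d0 s * \<zeta> s)"
        using that(1) by (simp add: a012 S_def d0_def d1_def d2_def \<zeta>_def poly_dehomog mult.commute)
      then show ?thesis
        using homog3_scale[OF that(2) rhom_id, of "poly d0 s" 1 \<xi> "\<zeta> s"]
        by (simp add: eval2_eval3[where h'' = "\<lambda>c. c"])
    qed
    have "inj_on \<zeta> S"
    proof (rule inj_onI)
      have *: "s = eval3 (\<lambda>c. c) (1, \<xi>, \<zeta> s) (fst W) / eval3 (\<lambda>c. c) (1, \<xi>, \<zeta> s) (snd W)" if "s \<in> S" for s
      proof -
        have e: "poly (dehomog w0) s = poly d0 s ^ e * eval3 (\<lambda>c. c) (1, \<xi>, \<zeta> s) (fst W)"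
          "poly (dehomog w1) s = poly d0 s ^ e * eval3 (\<lambda>c. c) (1, \<xi>, \<zeta> s) (snd W)"
          using ev[OF that] W(1) by (simp_all add: homogp3_def w0_def w1_def poly_dehomog)
        have "poly (dehomog w1) s \<noteq> 0" using that by (auto simp: S_def b_def)
        then show ?thesis using e w0s[of s] by (auto simp: nonzero_eq_divide_eq mult.commute)
      qed
      fix s s' assume "s \<in> S" "s' \<in> S" "\<zeta> s = \<zeta> s'"
      then show "s = s'" using *[of s] *[of s'] by simp
    qed
    moreover have "\<zeta> ` S \<subseteq> {z. poly (sl \<xi>) z = 0}"
    proof safe
      fix s assume s: "s \<in> S"
      then have "poly d0 s \<noteq> 0" by (auto simp: S_def b_def)
      then show "poly (sl \<xi>) (\<zeta> s) = 0" using ev[OF s G(1)] G(3) by (simp add: sl)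
    qed
    moreover have slnz: "sl \<xi> \<noteq> 0"
    proof
      assume "sl \<xi> = 0"
      then have "coeff (sl \<xi>) (degree \<Gamma>) = 0" by simp
      then show False using xi by (simp add: sl_def coeff_map_poly B_def)
    qed
    moreover have "finite {z. poly (sl \<xi>) z = 0}" by (rule poly_roots_finite[OF slnz])
    ultimately have "finite S" "card S \<le> card {z. poly (sl \<xi>) z = 0}"
      by (metis finite_imageD finite_subset, metis card_image card_mono)
    moreover have "card {z. poly (sl \<xi>) z = 0} \<le> degree (sl \<xi>)" by (rule card_poly_roots_bound[OF slnz])
    moreover have "degree (sl \<xi>) \<le> degree \<Gamma>" unfolding sl_def by (rule map_poly_degree_leq)
    ultimately show ?thesis using deg unfolding S_def by linarith
  qed
  obtain p q where pq: "coprime p q" "degree p \<le> d" "degree q \<le> d" "d0 * q = d1 * p"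
    using reduced_fraction_degree_le[of d0 d1 b B d] d0 b \<open>finite B\<close> small by blast
  have "p \<noteq> 0"
  proof
    assume p: "p = 0"
    then have "q = 0" using pq(4) d0 by simp
    then show False using p pq(1) by simp
  qed
  have "homogenise d p \<noteq> 0" using dehomog_homogenise[OF pq(2)] \<open>p \<noteq> 0\<close> by auto
  moreover have "a0 * homogenise d q = a1 * homogenise d p"
  proof (rule dehomog_inj)
    show "homog2 (j + d) (a0 * homogenise d q)" "homog2 (j + d) (a1 * homogenise d p)"
      using ha by (intro homog2_mult homog2_homogenise; simp)+
    show "dehomog (a0 * homogenise d q) = dehomog (a1 * homogenise d p)"
      using pq by (simp add: dehomog_homogenise d0_def d1_def)
  qed
  ultimately show ?thesis using homog2_homogenise by (auto simp: a012)
qed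

text \<open>The same for \<open>a\<^sub>2 / a\<^sub>0\<close>, by exchanging the last two coordinates of the plane.\<close>

lemma other_coordinate_degree_le:
  assumes G: "homog3 d G" "G \<noteq> 0" "eval3 const2 a G = 0"
    and a: "homogs2 j a" "fst a \<noteq> 0"
    and W: "homogp3 e W" "sim2 (map_pair (eval3 const2 a) W) (varS, varT)"
  shows "\<exists>p q. homog2 d p \<and> homog2 d q \<and> p \<noteq> 0 \<and> fst a * q = snd (snd a) * p"
proof -
  define sw where "sw = (varX, varZ, varY)"
  define a' where "a' = (fst a, snd (snd a), fst (snd a))"
  have sw: "eval3 const2 a' (eval3 const3 sw F) = eval3 const2 a F" for F
    by (cases a) (simp add: eval3_eval3[where h'' = const2] sw_def a'_def)
  have hsw: "homog3 k (eval3 const3 sw F)" if "homog3 k F" for k F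
    using homog_eval3_const3[OF that homog3_vars(1,3,2)] by (simp add: sw_def)
  have "eval3 const3 sw (eval3 const3 sw G) = G"
    by (simp add: eval3_eval3[where h'' = const3] sw_def eval3_vars)
  then have nz: "eval3 const3 sw G \<noteq> 0" using G(2) by auto
  have "\<exists>p q. homog2 d p \<and> homog2 d q \<and> p \<noteq> 0 \<and> fst a' * q = fst (snd a') * p"
  proof (rule coordinate_degree_le[OF hsw[OF G(1)] nz])
    show "eval3 const2 a' (eval3 const3 sw G) = 0" using G(3) by (simp add: sw)
    show "homogs2 j a'" "fst a' \<noteq> 0" using a by (auto simp: homogs2_def a'_def)
    show "homogp3 e (map_pair (eval3 const3 sw) W)" using W(1) hsw by (auto simp: homogp3_def)
    show "sim2 (map_pair (eval3 const2 a') (map_pair (eval3 const3 sw) W)) (varS, varT)"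
      using W(2) by (simp add: map_pair_map_pair sw)
  qed
  then show ?thesis by (simp add: a'_def)
qed

definition oneplus :: "complex \<Rightarrow> mat \<Rightarrow> mat" where
  "oneplus t = (\<lambda>(a, b, c, d). (t * a + 1, t * b, t * c, t * d + 1))"

text \<open>
  If \<open>M\<^sup>l = x M + y\<close>, then the scalar part of \<open>M\<^sup>l\<^sup>+\<^sup>1\<close> is \<open>- x det M\<close>, which vanishes only if \<open>M\<^sup>l\<close> is scalar.
\<close>

lemma mpow_oneplus:
  assumes "mdet M \<noteq> 0" "\<And>n. n \<ge> 1 \<Longrightarrow> \<not> scalar (mpow M n)" "k \<ge> 2"
  shows "\<exists>r t. r \<noteq> 0 \<and> mpow M k = mscal r (oneplus t M)"
proof -
  obtain l where l: "k = Suc l" "l \<ge> 1" using assms(3) by (cases k) auto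
  obtain a b c d where M: "M = (a, b, c, d)" by (cases M)
  obtain x y where xy: "mpow M l = (x * a + y, x * b, x * c, x * d + y)"
    using mpow_linear[of M l] by (auto simp: M)
  have "x \<noteq> 0" using assms(2)[OF l(2)] by (auto simp: xy scalar_def)
  define r where "r = - x * (a * d - b * c)"
  have r: "r \<noteq> 0" using \<open>x \<noteq> 0\<close> assms(1) by (simp add: r_def M mdet_def)
  have "mpow M k = ((x * (a + d) + y) * a + r, (x * (a + d) + y) * b, (x * (a + d) + y) * c, (x * (a + d) + y) * d + r)"
    using xy by (simp add: l(1) M mmul_def r_def algebra_simps)
  also have "\<dots> = mscal r (oneplus ((x * (a + d) + y) / r) M)"
    using r by (simp add: M mscal_def oneplus_def distrib_left)
  finally show ?thesis using r by blast
qed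

text \<open>The form \<open>p\<close> after the substitution \<open>1 + t M\<close>, as a polynomial in \<open>t\<close>.\<close>

definition pencil :: "mat \<Rightarrow> poly2 \<Rightarrow> poly2 poly" where
  "pencil M = eval2 (\<lambda>c. [:const2 c:]) ([:varS, fst (lin M):], [:varT, snd (lin M):])"

lemma poly_pencil: "poly (pencil M p) (const2 t) = eval2 const2 (lin (oneplus t M)) p"
proof -
  have "rhom (\<lambda>p. poly p (const2 t))" by (simp add: rhom_def)
  then have "poly (pencil M p) (const2 t) =
      eval2 const2 (varS + const2 t * fst (lin M), varT + const2 t * snd (lin M)) p"
    unfolding pencil_def by (subst hom_eval2) simp_all
  also have "(varS + const2 t * fst (lin M), varT + const2 t * snd (lin M)) = lin (oneplus t M)"
    by (cases M) (simp add: lin_def oneplus_def const2_simps algebra_simps)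
  finally show ?thesis .
qed

lemma degree_pencil:
  assumes "homog2 D p"
  shows "degree (pencil M p) \<le> D"
  unfolding pencil_def eval2_sum[OF rhom_const2_poly]
proof (intro degree_sum_le finite_atMost)
  fix i j
  show "degree ([:const2 (coeff (coeff p j) i):] * [:varS, fst (lin M):] ^ i * [:varT, snd (lin M):] ^ j) \<le> D"
  proof (cases "coeff (coeff p j) i = 0")
    case False
    have l: "degree ([:x, y:] ^ n) \<le> n" for x y :: poly2 and n
      using order_trans[OF degree_power_le[of "[:x, y:]" n]] by simp
    have "degree ([:const2 (coeff (coeff p j) i):] * [:varS, fst (lin M):] ^ i * [:varT, snd (lin M):] ^ j) \<le>
        0 + i + j"
      by (intro order_trans[OF degree_mult_le] add_mono l) simp_all
    also have "\<dots> = D" using assms False by (simp add: homog2_def)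
    finally show ?thesis .
  qed simp
qed

lemma pencil_expand:
  assumes "homog2 D p"
  shows "eval2 const2 (lin (oneplus t M)) p = (\<Sum>j\<le>D. const2 (t ^ j) * coeff (pencil M p) j)"
proof -
  have "poly (pencil M p) (const2 t) = (\<Sum>j\<le>degree (pencil M p). coeff (pencil M p) j * const2 t ^ j)"
    by (rule poly_altdef)
  also have "\<dots> = (\<Sum>j\<le>D. coeff (pencil M p) j * const2 t ^ j)"
    using degree_pencil[OF assms] by (intro sum.mono_neutral_left) (auto simp: coeff_eq_0)
  finally show ?thesis by (simp add: poly_pencil rhomD(7)[OF rhom_const2] mult.commute)
qed

lemma tdeg_sum_le: "(\<And>i. i \<in> A \<Longrightarrow> tdeg (f i) \<le> n) \<Longrightarrow> finite A \<Longrightarrow> tdeg (sum f A) \<le> n"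
  unfolding tdeg_def rhom_sum[OF rhom_grade3] by (rule degree_sum_le)

lemma tdeg_cmult_le: "tdeg (const3 c * F) \<le> tdeg F"
proof -
  have "grade3 (const3 c) = [:const3 c:]" by (simp add: grade3_def)
  then show ?thesis unfolding tdeg_def using degree_mult_le[of "[:const3 c:]" "grade3 F"] by simp
qed

text \<open>
  The values of a function field element on a sequence of curves are kept together in the germ of
  that sequence.  If \<open>g\<^sub>1 / g\<^sub>0\<close> restricts on the curves to \<open>q / p\<close> after the substitution \<open>1 + t M\<close>, then
  \<open>g\<^sub>1\<close> and \<open>-g\<^sub>0\<close> times powers of \<open>t\<close> are the coefficients of a relation between germs that do not depend
  on \<open>t\<close>.  All these relations are solutions of one finite linear system over the polynomial ring,
  whence \<open>g\<^sub>1 / g\<^sub>0 = U / V\<close> with \<open>V\<close> of bounded degree.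
\<close>

lemma bounded_denominator:
  fixes a :: "nat \<Rightarrow> poly2 \<times> poly2 \<times> poly2" and p q :: "nat \<Rightarrow> poly2"
  assumes generic: "\<forall>F k. homog3 k F \<longrightarrow> F \<noteq> 0 \<longrightarrow> (\<forall>\<^sub>F n in sequentially. eval3 const2 (a n) F \<noteq> 0)"
    and pq: "\<And>n. homog2 D (p n)" "\<And>n. homog2 D (q n)" "\<And>n. p n \<noteq> 0"
  shows "\<exists>b. \<forall>t e g0 g1. homog3 e g0 \<longrightarrow> homog3 e g1 \<longrightarrow> mdet (oneplus t M) \<noteq> 0 \<longrightarrow>
    (\<forall>n. eval3 const2 (a n) g1 * eval2 const2 (lin (oneplus t M)) (p n) =
         eval3 const2 (a n) g0 * eval2 const2 (lin (oneplus t M)) (q n)) \<longrightarrow>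
    (\<exists>U V. V \<noteq> 0 \<and> g1 * V = g0 * U \<and> tdeg V \<le> b)"
proof -
  \<comment> \<open>keeping the homogeneous components apart makes \<open>E n\<close> vanish only on multiples of the equation of the curve\<close>
  define E where "E n F = map_poly (eval3 const2 (a n)) (grade3 F)" for n F
  define w where "w = (\<lambda>(z, j) n. [:coeff (pencil M (if z then p n else q n)) j:])"
  have E: "rhom (E n)" for n
  proof -
    have *: "poly (map_poly (\<lambda>c. [:eval3 const2 (a n) c:]) x) [:0, 1:] = map_poly (eval3 const2 (a n)) x" for x
    proof -
      have "map_poly (\<lambda>c. [:eval3 const2 (a n) c:]) x = map_poly (\<lambda>c. [:c:]) (map_poly (eval3 const2 (a n)) x)"
        by (simp add: map_poly_map_poly o_def)
      then show ?thesis using pcompose_altdef[of "map_poly (eval3 const2 (a n)) x" "[:0, 1:]"]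
        by (simp add: pcompose_idR)
    qed
    have "rhom (\<lambda>x. poly (map_poly (\<lambda>c. [:eval3 const2 (a n) c:]) x) [:0, 1:])"
      by (intro rhom_poly_map_poly rhom_comp[OF rhom_const]) simp
    then show ?thesis unfolding E_def by (intro rhom_comp[OF _ rhom_grade3]) (simp add: *)
  qed
  have Enz: "\<forall>\<^sub>F n in sequentially. E n F \<noteq> 0" if "F \<noteq> 0" for F
  proof -
    obtain k where k: "coeff (grade3 F) k \<noteq> 0"
      using \<open>F \<noteq> 0\<close> by (metis grade3_eq_0_iff poly_eqI coeff_0)
    have "\<forall>\<^sub>F n in sequentially. eval3 const2 (a n) (coeff (grade3 F) k) \<noteq> 0"
      by (rule generic[rule_format, OF homog3_coeff_grade3 k])
    then show ?thesis
    proof eventually_elim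
      case (elim n)
      then have "coeff (E n F) k \<noteq> 0" by (simp add: E_def coeff_map_poly)
      then show ?case by auto
    qed
  qed
  have Ehom: "E n F = monom (eval3 const2 (a n) F) k" if "homog3 k F" for n F k
    using that by (simp add: E_def homog3_iff map_poly_monom)
  define I where "I = (UNIV :: bool set) \<times> {..D}"
  have "finite I" by (simp add: I_def)
  from eventual_relations_matrix[of E I w, OF E Enz this]
  obtain rows where rows: "finite rows" "\<And>t. (\<forall>\<^sub>F n in sequentially. (\<Sum>i\<in>I. E n (t i) * w i n) = 0) \<longleftrightarrow>
      (\<forall>l\<in>rows. (\<Sum>i\<in>I. t i * l i) = 0)" by blast
  have sumI: "sum f I = (\<Sum>j\<le>D. f (True, j)) + (\<Sum>j\<le>D. f (False, j))" for f :: "bool \<times> nat \<Rightarrow> 'x::comm_monoid_add"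
  proof -
    have "sum f I = (\<Sum>z\<in>UNIV. \<Sum>j\<le>D. f (z, j))" by (simp add: I_def sum.cartesian_product split_def)
    then show ?thesis by (simp add: UNIV_bool add.commute)
  qed
  define b where "b = (\<Sum>l\<in>rows. \<Sum>j\<le>D. tdeg (l (True, j)))"
  have "\<exists>U V. V \<noteq> 0 \<and> g1 * V = g0 * U \<and> tdeg V \<le> b"
    if h: "homog3 e g0" "homog3 e g1" and det: "mdet (oneplus t M) \<noteq> 0" and
      eq: "\<And>n. eval3 const2 (a n) g1 * eval2 const2 (lin (oneplus t M)) (p n) =
         eval3 const2 (a n) g0 * eval2 const2 (lin (oneplus t M)) (q n)" for t e g0 g1
  proof -
    define V U where "V l = (\<Sum>j\<le>D. const3 (t ^ j) * l (True, j))"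
      and "U l = (\<Sum>j\<le>D. const3 (t ^ j) * l (False, j))" for l :: "bool \<times> nat \<Rightarrow> poly3"
    define T where "T = (\<lambda>(z, j). const3 (t ^ j) * (if z then g1 else - g0))"
    have hm: "homog3 e (- g0)" using homog3_diff[OF homog3_0 h(1)] by simp
    have ET: "E n (const3 c * g) = [:const2 c:] * monom (eval3 const2 (a n) g) e" if "homog3 e g" for n c g
      by (simp add: Ehom[OF homog3_cmult[OF that]] smult_monom)
    have "(\<Sum>i\<in>I. E n (T i) * w i n) = 0" for n
    proof -
      have 1: "(\<Sum>j\<le>D. E n (const3 (t ^ j) * g) * [:coeff (pencil M x) j:]) =
          monom (eval3 const2 (a n) g * eval2 const2 (lin (oneplus t M)) x) e"
        if "homog3 e g" "homog2 D x" for g x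
      proof -
        have "(\<Sum>j\<le>D. E n (const3 (t ^ j) * g) * [:coeff (pencil M x) j:]) =
          (\<Sum>j\<le>D. monom (eval3 const2 (a n) g * (const2 (t ^ j) * coeff (pencil M x) j)) e)"
          by (intro sum.cong refl, subst ET[OF that(1)]) (simp add: smult_monom ac_simps)
        also have "\<dots> = monom (eval3 const2 (a n) g * eval2 const2 (lin (oneplus t M)) x) e"
          unfolding pencil_expand[OF that(2)] sum_distrib_left
          by (induction D) (simp_all add: add_monom)
        finally show ?thesis .
      qed
      have "(\<Sum>i\<in>I. E n (T i) * w i n) =
          monom (eval3 const2 (a n) g1 * eval2 const2 (lin (oneplus t M)) (p n)) e +
          monom (eval3 const2 (a n) (- g0) * eval2 const2 (lin (oneplus t M)) (q n)) e"
        unfolding sumI using 1[OF h(2) pq(1)] 1[OF hm pq(2)] by (simp add: T_def w_def)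
      then show ?thesis using eq[of n] by (simp add: add_monom)
    qed
    then have "\<forall>l\<in>rows. (\<Sum>i\<in>I. T i * l i) = 0" using rows(2)[of T] by simp
    moreover have "(\<Sum>i\<in>I. T i * l i) = g1 * V l - g0 * U l" for l
      unfolding sumI by (simp add: T_def V_def U_def sum_distrib_left sum_negf ac_simps)
    ultimately have gV: "g1 * V l = g0 * U l" if "l \<in> rows" for l using that by simp
    have "\<exists>l\<in>rows. V l \<noteq> 0"
    proof (rule ccontr)
      assume "\<not> (\<exists>l\<in>rows. V l \<noteq> 0)"
      then have V0: "V l = 0" if "l \<in> rows" for l using that by blast
      define T' where "T' = (\<lambda>(z, j). if z then const3 (t ^ j) else 0)"
      have "(\<Sum>i\<in>I. T' i * l i) = V l" for l unfolding sumI by (simp add: T'_def V_def)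
      then have "\<forall>\<^sub>F n in sequentially. (\<Sum>i\<in>I. E n (T' i) * w i n) = 0" using rows(2)[of T'] V0 by simp
      then obtain n where "(\<Sum>i\<in>I. E n (T' i) * w i n) = 0" by (auto simp: eventually_sequentially)
      then have "(\<Sum>j\<le>D. [:const2 (t ^ j):] * [:coeff (pencil M (p n)) j:]) = 0"
        unfolding sumI using Ehom[OF homog3_const3] by (simp add: T'_def w_def rhomD[OF E] monom_0)
      moreover have "(\<Sum>j\<le>D. [:const2 (t ^ j):] * [:coeff (pencil M (p n)) j:]) =
          [:\<Sum>j\<le>D. const2 (t ^ j) * coeff (pencil M (p n)) j:]"
        by (induction D) simp_all
      ultimately have "eval2 const2 (lin (oneplus t M)) (p n) = 0" by (simp add: pencil_expand[OF pq(1)])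
      then show False using eval2_lin_eq_0[OF det] pq(3) by blast
    qed
    then obtain l where l: "l \<in> rows" "V l \<noteq> 0" by blast
    have "tdeg (V l) \<le> b"
      unfolding V_def
    proof (rule tdeg_sum_le)
      fix j assume j: "j \<in> {..D}"
      have "tdeg (const3 (t ^ j) * l (True, j)) \<le> tdeg (l (True, j))" by (rule tdeg_cmult_le)
      also have "\<dots> \<le> (\<Sum>j\<le>D. tdeg (l (True, j)))" using j by (intro member_le_sum) auto
      also have "\<dots> \<le> b" unfolding b_def using l(1) rows(1) by (intro member_le_sum) auto
      finally show "tdeg (const3 (t ^ j) * l (True, j)) \<le> b" .
    qed simp
    then show ?thesis using l gV by blast
  qed
  then show ?thesis by blast
qed

lemma mat_inverse:
  assumes "mdet A \<noteq> 0"
  shows "\<exists>B. mmul A B = (1, 0, 0, 1) \<and> mmul B A = (1, 0, 0, 1) \<and> mdet B \<noteq> 0"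
proof -
  obtain a b c d where A: "A = (a, b, c, d)" by (cases A)
  define q where "q = inverse (a * d - b * c)"
  have q: "q * (a * d - b * c) = 1" using assms by (simp add: q_def A mdet_def)
  define B where "B = (q * d, - q * b, - q * c, q * a)"
  have "mmul A B = (q * (a * d - b * c), 0, 0, q * (a * d - b * c))"
    "mmul B A = (q * (a * d - b * c), 0, 0, q * (a * d - b * c))"
    by (simp_all add: A B_def mmul_def algebra_simps)
  then have 1: "mmul A B = (1, 0, 0, 1)" "mmul B A = (1, 0, 0, 1)" by (simp_all only: q)
  have "mdet A * mdet B = 1" unfolding mdet_mmul[symmetric] 1 by (simp add: mdet_def)
  then show ?thesis using 1 by (intro exI[of _ B]) auto
qed

lemma finite_moebius_poles:
  assumes "mdet A \<noteq> 0"
  shows "finite {c. snd (app A (c, 1)) = 0}"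
proof -
  obtain a b e f where A: "A = (a, b, e, f)" by (cases A)
  have "[:f, e:] \<noteq> 0" using assms by (auto simp: A mdet_def)
  then have "finite {c. poly [:f, e:] c = 0}" by (rule poly_roots_finite)
  then show ?thesis by (simp add: A app_def algebra_simps)
qed

lemma moebius_inj:
  assumes "mdet A \<noteq> 0" "fst (app A (c, 1)) * snd (app A (c', 1)) = snd (app A (c, 1)) * fst (app A (c', 1))"
  shows "c = c'"
proof -
  obtain a b e f where A: "A = (a, b, e, f)" by (cases A)
  have "(a * c + b) * (e * c' + f) = (e * c + f) * (a * c' + b)" using assms(2) by (simp add: A app_def)
  then have "(a * f - b * e) * (c - c') = 0" by algebra
  then show ?thesis using assms(1) by (simp add: A mdet_def)
qed

lemma finite_moebius_coincidences:
  assumes "mdet A \<noteq> 0" "mdet B \<noteq> 0" "\<And>r. r \<noteq> 0 \<Longrightarrow> A \<noteq> mscal r B"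
  shows "finite {c. fst (app A (c, 1)) * snd (app B (c, 1)) = snd (app A (c, 1)) * fst (app B (c, 1))}"
proof -
  obtain a b e f where A: "A = (a, b, e, f)" by (cases A)
  obtain a' b' e' f' where B: "B = (a', b', e', f')" by (cases B)
  define x where "x = [:b * f' - f * b', a * f' + b * e' - e * b' - f * a', a * e' - e * a':]"
  have lnz: "lin C \<noteq> (0, 0)" if "mdet C \<noteq> 0" for C
  proof
    assume "lin C = (0, 0)"
    then have "eval2 const2 (lin C) varS = 0" by simp
    then show False using eval2_lin_eq_0[OF that] varS_nz by blast
  qed
  have "x \<noteq> 0"
  proof
    assume "x = 0"
    then have z: "b * f' - f * b' = 0" "a * f' + b * e' - e * b' - f * a' = 0" "a * e' - e * a' = 0"
      by (simp_all add: x_def)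
    have "fst (lin A) * snd (lin B) - snd (lin A) * fst (lin B) =
        const2 (a * e' - e * a') * varS ^ 2 + const2 (a * f' + b * e' - e * b' - f * a') * (varS * varT)
          + const2 (b * f' - f * b') * varT ^ 2"
      by (simp add: A B lin_def const2_simps algebra_simps power2_eq_square)
    then have "proportional2 (lin A) (lin B)" unfolding z by (simp add: proportional2_def const2_simps split_def)
    then have "sim2 (lin A) (lin B)" using lnz assms(1,2) by (simp add: sim2_iff)
    then show False using lin_sim2 assms by blast
  qed
  then have "finite {c. poly x c = 0}" by (rule poly_roots_finite)
  then show ?thesis by (rule rev_finite_subset) (auto simp: A B app_def x_def algebra_simps)
qed

context fibration
begin

text \<open>
  All curves \<open>a\<^sub>n = \<psi>\<^sub>n \<circ> u\<close> come from one fibre, so \<open>\<phi>\<close> acts on each of them through the same matrix \<open>M\<close>.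
  The base point \<open>c\<close> avoids countably many values: those where some \<open>\<psi>\<^sub>n\<close> degenerates, and those
  where two of the induced Moebius transformations agree.  A reduced triple \<open>(g\<^sub>0 : g\<^sub>1 : g\<^sub>2)\<close> of an
  iterate satisfies \<open>g\<^sub>1 V\<^sub>1 = g\<^sub>0 U\<^sub>1\<close> and \<open>g\<^sub>2 V\<^sub>2 = g\<^sub>0 U\<^sub>2\<close>, so \<open>g\<^sub>0\<close> divides \<open>V\<^sub>1 V\<^sub>2\<close>.
\<close>

lemma iterates_bounded:
  fixes H :: "nat \<Rightarrow> rmap"
  assumes F: "F \<in> carrier BirP2" "preserves_fibre_by_fibre (P, Q) F"
    and inf: "\<And>n::nat. n \<ge> 1 \<Longrightarrow> F [^]\<^bsub>BirP2\<^esub> n \<noteq> \<one>\<^bsub>BirP2\<^esub>"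
    and H: "\<And>n. H n \<in> carrier BirP2" "\<And>n. h n \<in> H n" "\<And>n. H n \<otimes>\<^bsub>BirP2\<^esub> F = F \<otimes>\<^bsub>BirP2\<^esub> H n"
    and A: "\<And>n. mdet (A n) \<noteq> 0" "\<And>n. acts (A n) (h n)" "\<And>i j r. i \<noteq> j \<Longrightarrow> r \<noteq> 0 \<Longrightarrow> A i \<noteq> mscal r (A j)"
  shows "\<exists>b. \<forall>k::nat. k \<ge> 2 \<longrightarrow> rmap_degree (F [^]\<^bsub>BirP2\<^esub> k) \<le> b"
proof -
  interpret group BirP2 by (rule group_BirP2)
  obtain f where f: "f \<in> F" using BirP2_rep[OF F(1)] by blast
  obtain S where S: "countable S" "\<And>c. c \<notin> S \<Longrightarrow> good c" "\<And>c u v. c \<notin> S \<Longrightarrow> parametrises (fibre c) u v \<Longrightarrow>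
    \<exists>M. mdet M \<noteq> 0 \<and> sim3 (push f u) (reparam u M) \<and> (\<forall>n\<ge>1. \<not> scalar (mpow M n))"
    using very_general_fibre[OF F f inf] by blast
  have "\<forall>n. \<exists>B. mmul (A n) B = (1, 0, 0, 1) \<and> mmul B (A n) = (1, 0, 0, 1) \<and> mdet B \<noteq> 0"
    using mat_inverse[OF A(1)] by blast
  from choice[OF this] obtain B where
    B: "\<And>n. mmul (A n) (B n) = (1, 0, 0, 1)" "\<And>n. mmul (B n) (A n) = (1, 0, 0, 1)" "\<And>n. mdet (B n) \<noteq> 0"
    by blast
  define H' where "H' n = inv\<^bsub>BirP2\<^esub> (H n)" for n
  have H': "H' n \<in> carrier BirP2" "inv\<^bsub>BirP2\<^esub> (H' n) = H n" for n using H(1) by (simp_all add: H'_def)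
  have "\<forall>n. \<exists>g. g \<in> H' n" using BirP2_rep[OF H'(1)] by blast
  from choice[OF this] obtain h' where h': "\<And>n. h' n \<in> H' n" by blast
  have aB: "acts (B n) (h' n)" for n
    by (rule acts_inv[OF H(1,2) h'[unfolded H'_def] A(2,1) B(2)])
  have "\<forall>n. \<exists>S. finite S \<and> (\<forall>c c' t p. c \<notin> S \<longrightarrow> c' \<notin> S \<longrightarrow> t \<noteq> 0 \<longrightarrow> app (A n) (c, 1) = (t * c', t) \<longrightarrow>
    generic_point (fibre c) p \<longrightarrow> generic_point (fibre c') (push (h n) p))"
    using birational_generic_point[OF H(1,2) h'[unfolded H'_def] A(2) aB B(2)] by blast
  from choice[OF this] obtain T1 where T1': "\<forall>n. finite (T1 n) \<and> (\<forall>c c' t p. c \<notin> T1 n \<longrightarrow> c' \<notin> T1 n \<longrightarrow>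
      t \<noteq> 0 \<longrightarrow> app (A n) (c, 1) = (t * c', t) \<longrightarrow> generic_point (fibre c) p \<longrightarrow>
      generic_point (fibre c') (push (h n) p))"
    by (elim exE) (rule that)
  have T1: "finite (T1 n)" "c \<notin> T1 n \<Longrightarrow> c' \<notin> T1 n \<Longrightarrow> t \<noteq> 0 \<Longrightarrow> app (A n) (c, 1) = (t * c', t) \<Longrightarrow>
      generic_point (fibre c) p \<Longrightarrow> generic_point (fibre c') (push (h n) p)" for n c c' t p
    by (rule conjunct1[OF spec[OF T1']], rule conjunct2[OF spec[OF T1'], rule_format])
  have "\<forall>n. \<exists>S. finite S \<and> (\<forall>c c' t p. c \<notin> S \<longrightarrow> c' \<notin> S \<longrightarrow> t \<noteq> 0 \<longrightarrow> app (B n) (c, 1) = (t * c', t) \<longrightarrow>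
    generic_point (fibre c) p \<longrightarrow> generic_point (fibre c') (push (h' n) p))"
    using birational_generic_point[OF H'(1) h' H(2)[folded H'(2)] aB A(2) B(1)] by blast
  from choice[OF this] obtain T2 where T2': "\<forall>n. finite (T2 n) \<and> (\<forall>c c' t p. c \<notin> T2 n \<longrightarrow> c' \<notin> T2 n \<longrightarrow>
      t \<noteq> 0 \<longrightarrow> app (B n) (c, 1) = (t * c', t) \<longrightarrow> generic_point (fibre c) p \<longrightarrow>
      generic_point (fibre c') (push (h' n) p))"
    by (elim exE) (rule that)
  have T2: "finite (T2 n)" "c \<notin> T2 n \<Longrightarrow> c' \<notin> T2 n \<Longrightarrow> t \<noteq> 0 \<Longrightarrow> app (B n) (c, 1) = (t * c', t) \<Longrightarrow>
      generic_point (fibre c) p \<Longrightarrow> generic_point (fibre c') (push (h' n) p)" for n c c' t p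
    by (rule conjunct1[OF spec[OF T2']], rule conjunct2[OF spec[OF T2'], rule_format])
  define T where "T n = T1 n \<union> T2 n \<union> {c. good c \<longrightarrow> fibre c dvd varX}" for n
  have finT: "finite (T n)" for n unfolding T_def using T1(1) T2(1) cofinite_not_dvd[OF varX_nz] by simp
  \<comment> \<open>\<open>val n\<close> is the action of \<open>H n\<close> on the base\<close>
  define den where "den n c = snd (app (A n) (c, 1))" for n c
  define val where "val n c = fst (app (A n) (c, 1)) / den n c" for n c
  define N1 N2 N3 where "N1 n = {c. den n c = 0}" and "N2 n = {c. den n c \<noteq> 0 \<and> val n c \<in> T n}"
    and "N3 = (\<lambda>(i, j). {c. i \<noteq> j \<and> den i c \<noteq> 0 \<and> den j c \<noteq> 0 \<and> val i c = val j c})" for n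
  have "finite (N1 n)" for n unfolding N1_def den_def by (rule finite_moebius_poles[OF A(1)])
  moreover have "finite (N2 n)" for n
  proof -
    have "inj_on (val n) {c. den n c \<noteq> 0}"
    proof (rule inj_onI)
      fix c c' assume "c \<in> {c. den n c \<noteq> 0}" "c' \<in> {c. den n c \<noteq> 0}" "val n c = val n c'"
      then have "fst (app (A n) (c, 1)) * den n c' = fst (app (A n) (c', 1)) * den n c"
        by (simp only: val_def mem_Collect_eq frac_eq_eq not_False_eq_True)
      then have "fst (app (A n) (c, 1)) * snd (app (A n) (c', 1)) = snd (app (A n) (c, 1)) * fst (app (A n) (c', 1))"
        unfolding den_def by (simp only: mult.commute)
      then show "c = c'" by (rule moebius_inj[OF A(1)])
    qed
    from finite_vimage_IntI[OF finT[of n] this] show ?thesis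
      by (rule rev_finite_subset) (auto simp: N2_def)
  qed
  moreover have "finite (N3 ij)" for ij
  proof -
    obtain i j where ij: "ij = (i, j)" by (cases ij)
    show ?thesis
    proof (cases "i = j")
      case False
      have "finite {c. fst (app (A i) (c, 1)) * snd (app (A j) (c, 1)) = snd (app (A i) (c, 1)) * fst (app (A j) (c, 1))}"
        by (rule finite_moebius_coincidences[OF A(1,1) A(3)[OF False]])
      then show ?thesis
        by (rule rev_finite_subset) (auto simp: ij N3_def val_def den_def field_simps)
    qed (simp add: N3_def ij)
  qed
  ultimately have "countable (S \<union> (\<Union>n. T n \<union> N1 n \<union> N2 n) \<union> (\<Union>ij. N3 ij))"
    using finT S(1) by (intro countable_Un countable_UN) (auto intro: countable_finite)
  then obtain c where c: "c \<notin> S \<union> (\<Union>n. T n \<union> N1 n \<union> N2 n) \<union> (\<Union>ij. N3 ij)"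
    using uncountable_UNIV_complex by (metis UNIV_eq_I)
  have cS: "c \<notin> S" and cT: "c \<notin> T n" and den: "den n c \<noteq> 0" and valT: "val n c \<notin> T n" for n
    using c by (auto simp: N1_def N2_def)
  have valinj: "val i c \<noteq> val j c" if "i \<noteq> j" for i j
  proof
    assume "val i c = val j c"
    then have "c \<in> N3 (i, j)" using that den by (simp add: N3_def)
    then show False using c by blast
  qed
  obtain u v where par: "parametrises (fibre c) u v" using S(2)[OF cS] by (auto simp: good_def)
  obtain M where M: "mdet M \<noteq> 0" "sim3 (push f u) (reparam u M)" "\<And>n. n \<ge> 1 \<Longrightarrow> \<not> scalar (mpow M n)"
    using S(3)[OF cS par] by blast
  have u: "generic_point (fibre c) u" and vu: "sim2 (map_pair (eval3 const2 u) v) (varS, varT)"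
    using par by (simp_all add: parametrises_def)
  obtain e where e: "homogp3 e v" using par by (auto simp: parametrises_def)
  obtain j where j: "homogs2 j u" using generic_pointD(1)[OF u] by blast
  define a where "a n = push (h n) u" for n
  have appA: "app (A n) (c, 1) = (den n c * val n c, den n c)" for n
    using den[of n] by (simp add: val_def den_def)
  have ga: "generic_point (fibre (val n c)) (a n)" for n
    unfolding a_def using T1(2)[OF _ _ den appA u] cT valT by (simp add: T_def)
  have appB: "app (B n) (val n c, 1) = (1 / den n c * c, 1 / den n c)" for n
  proof -
    have "app (B n) (den n c * val n c, den n c) = (c, 1)"
      using app_mmul[of "B n" "A n" "(c, 1)"] by (simp add: B(2) appA) (simp add: app_def)
    then show ?thesis using den[of n] by (cases "B n") (simp add: app_def field_simps)
  qed
  have gb: "generic_point (fibre c) (push (h' n) (a n))" for n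
    using T2(2)[OF _ _ _ appB ga] cT valT den by (simp add: T_def)
  have ba: "sim3 (push (h' n) (a n)) u" for n
  proof -
    have "proportional3 (push (subst3 (h' n) (h n)) u) (push (varX, varY, varZ) u)"
      unfolding push_def using BirP2_inv(2)[OF H(1,2) h'[unfolded H'_def]]
      by (intro proportional3_hom proportional3_of_sim3) simp_all
    then show ?thesis
      using generic_pointD(2)[OF gb] generic_pointD(2)[OF u] by (simp add: sim3_iff a_def push_push push_vars)
  qed
  define W where "W n = map_pair (eval3 const3 (h' n)) v" for n
  have Wa: "sim2 (map_pair (eval3 const2 (a n)) (W n)) (varS, varT)" for n
  proof -
    have "map_pair (eval3 const2 (a n)) (W n) = map_pair (eval3 const2 (push (h' n) (a n))) v"
      by (simp add: W_def map_pair_map_pair eval3_eval3[where h'' = const2] push_def)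
    then show ?thesis using sim2_trans[OF sim2_eval3[OF e rhom_const2 ba] vu] by simp
  qed
  have hW: "\<exists>k. homogp3 k (W n)" for n
  proof -
    obtain l where l: "homogs3 l (h' n)" using BirP2_form[OF H'(1) h'] by blast
    then have "homogp3 (e * l) (W n)"
      using e by (cases "h' n") (simp add: W_def homogp3_def homogs3_def homog_eval3_const3)
    then show ?thesis by blast
  qed
  have a0: "fst (a n) \<noteq> 0" for n
  proof -
    have "\<not> fibre (val n c) dvd varX" using valT[of n] by (auto simp: T_def)
    then have "eval3 const2 (a n) varX \<noteq> 0" using generic_pointD(3)[OF ga homog3_vars(1)] by simp
    then show ?thesis by simp
  qed
  have ha: "\<exists>k. homogs2 k (a n)" for n using generic_pointD(1)[OF ga] .
  have Ga: "fibre (val n c) \<noteq> 0" "eval3 const2 (a n) (fibre (val n c)) = 0" for n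
    using generic_pointD(3)[OF ga homog3_fibre] valT[of n] by (auto simp: T_def good_def)
  have "\<forall>n. \<exists>pq. homog2 d (fst pq) \<and> homog2 d (snd pq) \<and> fst pq \<noteq> 0 \<and> fst (a n) * snd pq = fst (snd (a n)) * fst pq"
    using coordinate_degree_le[OF homog3_fibre Ga _ a0 _ Wa] ha hW by (metis fst_conv snd_conv)
  from choice[OF this] obtain pq where pq: "\<And>n. homog2 d (fst (pq n))" "\<And>n. homog2 d (snd (pq n))"
    "\<And>n. fst (pq n) \<noteq> 0" "\<And>n. fst (a n) * snd (pq n) = fst (snd (a n)) * fst (pq n)" by blast
  have "\<forall>n. \<exists>pq. homog2 d (fst pq) \<and> homog2 d (snd pq) \<and> fst pq \<noteq> 0 \<and> fst (a n) * snd pq = snd (snd (a n)) * fst pq"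
    using other_coordinate_degree_le[OF homog3_fibre Ga _ a0 _ Wa] ha hW by (metis fst_conv snd_conv)
  from choice[OF this] obtain rs where rs: "\<And>n. homog2 d (fst (rs n))" "\<And>n. homog2 d (snd (rs n))"
    "\<And>n. fst (rs n) \<noteq> 0" "\<And>n. fst (a n) * snd (rs n) = snd (snd (a n)) * fst (rs n)" by blast
  have "\<forall>\<^sub>F n in sequentially. eval3 const2 (a n) G \<noteq> 0" if G: "homog3 k G" "G \<noteq> 0" for G k
  proof -
    have "inj (\<lambda>n. val n c)" using valinj by (auto simp: inj_def)
    then have "finite ((\<lambda>n. val n c) -` {c. good c \<and> fibre c dvd G})"
      using finite_fibres_dvd[OF G(2)] by (rule_tac finite_vimageI)
    then have "finite {n. \<not> eval3 const2 (a n) G \<noteq> 0}"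
      by (rule rev_finite_subset) (use generic_pointD(3)[OF ga G(1)] valT in \<open>auto simp: T_def\<close>)
    then show ?thesis by (simp flip: cofinite_eq_sequentially add: eventually_cofinite)
  qed
  then have generic: "\<forall>G k. homog3 k G \<longrightarrow> G \<noteq> 0 \<longrightarrow> (\<forall>\<^sub>F n in sequentially. eval3 const2 (a n) G \<noteq> 0)"
    by blast
  from bounded_denominator[of a d "\<lambda>n. fst (pq n)" "\<lambda>n. snd (pq n)" M, OF generic pq(1-3)]
  obtain b1 where b1: "\<forall>t e g0 g1. homog3 e g0 \<longrightarrow> homog3 e g1 \<longrightarrow> mdet (oneplus t M) \<noteq> 0 \<longrightarrow>
    (\<forall>n. eval3 const2 (a n) g1 * eval2 const2 (lin (oneplus t M)) (fst (pq n)) =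
         eval3 const2 (a n) g0 * eval2 const2 (lin (oneplus t M)) (snd (pq n))) \<longrightarrow>
    (\<exists>U V. V \<noteq> 0 \<and> g1 * V = g0 * U \<and> tdeg V \<le> b1)"
    by (elim exE) (rule that)
  from bounded_denominator[of a d "\<lambda>n. fst (rs n)" "\<lambda>n. snd (rs n)" M, OF generic rs(1-3)]
  obtain b2 where b2: "\<forall>t e g0 g1. homog3 e g0 \<longrightarrow> homog3 e g1 \<longrightarrow> mdet (oneplus t M) \<noteq> 0 \<longrightarrow>
    (\<forall>n. eval3 const2 (a n) g1 * eval2 const2 (lin (oneplus t M)) (fst (rs n)) =
         eval3 const2 (a n) g0 * eval2 const2 (lin (oneplus t M)) (snd (rs n))) \<longrightarrow>
    (\<exists>U V. V \<noteq> 0 \<and> g1 * V = g0 * U \<and> tdeg V \<le> b2)"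
    by (elim exE) (rule that)
  have "rmap_degree (F [^]\<^bsub>BirP2\<^esub> k) \<le> b1 + b2" if k: "k \<ge> 2" for k :: nat
  proof -
    define D where "D = rmap_degree (F [^]\<^bsub>BirP2\<^esub> k)"
    have Fk: "F [^]\<^bsub>BirP2\<^esub> k \<in> carrier BirP2" using F(1) by simp
    obtain g where g: "g \<in> F [^]\<^bsub>BirP2\<^esub> k" "form_triple D g" "no_common_factor g"
      using rmap_degree_rep[OF BirP2_carrier(1)[OF Fk]] by (auto simp: D_def)
    obtain g0 g1 g2 where g012: "g = (g0, g1, g2)" by (cases g)
    have hg: "homog3 D g0" "homog3 D g1" "homog3 D g2" using g(2) by (simp_all add: form_triple_def g012)
    obtain r t where rt: "r \<noteq> 0" "mpow M k = mscal r (oneplus t M)"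
      using mpow_oneplus[OF M(1) M(3) k] by blast
    have det: "mdet (oneplus t M) \<noteq> 0"
      using M(1) mdet_mpow[of M k] by (auto simp: rt(2) mdet_mscal)
    obtain g' where g': "g' \<in> F [^]\<^bsub>BirP2\<^esub> k" "sim3 (push g' u) (reparam u (mpow M k))"
      using push_power[OF F(1) f j M(1,2)] by blast
    have pr: "proportional3 (push g (a n)) (reparam (a n) (oneplus t M))" for n
    proof -
      obtain l where l: "homogs3 l (h n)" using BirP2_form[OF H(1,2)] by blast
      have c1: "H n \<otimes>\<^bsub>BirP2\<^esub> F [^]\<^bsub>BirP2\<^esub> k = F [^]\<^bsub>BirP2\<^esub> k \<otimes>\<^bsub>BirP2\<^esub> H n"
      proof (induction k)
        case (Suc k)
        have "H n \<otimes>\<^bsub>BirP2\<^esub> F [^]\<^bsub>BirP2\<^esub> Suc k = (H n \<otimes>\<^bsub>BirP2\<^esub> F [^]\<^bsub>BirP2\<^esub> k) \<otimes>\<^bsub>BirP2\<^esub> F"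
          using H(1) F(1) by (simp add: m_assoc)
        also have "\<dots> = F [^]\<^bsub>BirP2\<^esub> k \<otimes>\<^bsub>BirP2\<^esub> (H n \<otimes>\<^bsub>BirP2\<^esub> F)"
          using H(1) F(1) by (simp add: Suc m_assoc)
        also have "\<dots> = F [^]\<^bsub>BirP2\<^esub> Suc k \<otimes>\<^bsub>BirP2\<^esub> H n"
          using H(1) F(1) by (simp add: H(3) m_assoc)
        finally show ?case .
      qed (use H(1) in simp)
      have "sim3 (subst3 g (h n)) (subst3 (h n) g')"
        using BirP2_sim[OF m_closed[OF Fk H(1)] BirP2_mult[OF Fk H(1) g(1) H(2)]]
          BirP2_mult[OF H(1) Fk H(2) g'(1), of n, unfolded c1] by blast
      then have p: "proportional3 (push (subst3 g (h n)) u) (push (subst3 (h n) g') u)"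
        unfolding push_def by (intro proportional3_hom proportional3_of_sim3) simp_all
      have "sim3 (push (h n) (push g' u)) (push (h n) (reparam u (mpow M k)))"
        by (rule sim3_push[OF l g'(2)])
      then have q: "sim3 (push (subst3 (h n) g') u) (reparam (a n) (mpow M k))"
        by (simp add: push_push a_def push_reparam)
      obtain i where i: "homogs2 i (a n)" using ha by blast
      have q': "sim3 (reparam (a n) (mpow M k)) (reparam (a n) (oneplus t M))"
        unfolding rt(2) by (rule reparam_mscal[OF i rt(1)])
      have "reparam (a n) (oneplus t M) \<noteq> (0, 0, 0)" by (rule reparam_nz[OF det generic_pointD(2)[OF ga]])
      then have "push (subst3 (h n) g') u \<noteq> (0, 0, 0)" using sim3_nz[OF sim3_trans[OF q q']] by simp
      then have "proportional3 (push (subst3 g (h n)) u) (reparam (a n) (oneplus t M))"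
        by (rule proportional3_trans[OF p proportional3_of_sim3[OF sim3_trans[OF q q']]])
      then show ?thesis by (simp add: a_def push_push)
    qed
    have cancel: "x1 * eval2 const2 N p = x0 * eval2 const2 N q"
      if "x0 * eval2 const2 N y1 = x1 * eval2 const2 N y0" "y0 * q = y1 * p" "eval2 const2 N y0 \<noteq> 0"
      for x0 x1 y0 y1 p q :: poly2 and N
    proof -
      have "eval2 const2 N y0 * eval2 const2 N q = eval2 const2 N y1 * eval2 const2 N p"
        using arg_cong[OF that(2), of "eval2 const2 N"] by simp
      then have "eval2 const2 N y0 * (x1 * eval2 const2 N p - x0 * eval2 const2 N q) = 0"
        using that(1) by algebra
      then show ?thesis using that(3) by simp
    qed
    have a0N: "eval2 const2 (lin (oneplus t M)) (fst (a n)) \<noteq> 0" for n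
      using eval2_lin_eq_0[OF det] a0 by blast
    have e1: "eval3 const2 (a n) g0 * eval2 const2 (lin (oneplus t M)) (fst (snd (a n))) =
        eval3 const2 (a n) g1 * eval2 const2 (lin (oneplus t M)) (fst (a n))"
      and e2: "eval3 const2 (a n) g0 * eval2 const2 (lin (oneplus t M)) (snd (snd (a n))) =
        eval3 const2 (a n) g2 * eval2 const2 (lin (oneplus t M)) (fst (a n))" for n
      using pr[of n] by (simp_all add: proportional3_def push_def reparam_def map_triple_def g012)
    obtain U1 V1 where UV1: "V1 \<noteq> 0" "g1 * V1 = g0 * U1" "tdeg V1 \<le> b1"
      using b1 hg(1,2) det allI[OF cancel[OF e1 pq(4) a0N]] by metis
    obtain U2 V2 where UV2: "V2 \<noteq> 0" "g2 * V2 = g0 * U2" "tdeg V2 \<le> b2"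
      using b2 hg(1,3) det allI[OF cancel[OF e2 rs(4) a0N]] by metis
    have "g0 dvd V1 * V2"
    proof (rule no_common_factor_dvd[OF g(3)[unfolded g012]])
      have "g1 * (V1 * V2) = g0 * (U1 * V2)" by (metis UV1(2) mult.assoc)
      then show "g0 dvd g1 * (V1 * V2)" by (rule dvdI)
      have "g2 * (V1 * V2) = (g2 * V2) * V1" by (simp only: ac_simps)
      then have "g2 * (V1 * V2) = g0 * (U2 * V1)" by (simp only: UV2(2) mult.assoc)
      then show "g0 dvd g2 * (V1 * V2)" by (rule dvdI)
    qed simp
    then have "tdeg g0 \<le> tdeg (V1 * V2)" using UV1(1) UV2(1) by (intro tdeg_dvd) simp_all
    moreover have "g0 \<noteq> 0"
      using BirP2_dominant[OF Fk g(1) homog3_vars(1)] by (auto simp: g012)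
    ultimately show ?thesis
      using UV1 UV2 tdeg_homog[OF hg(1)] by (simp add: tdeg_mult D_def)
  qed
  then show ?thesis by blast
qed

section \<open>The centraliser\<close>

lemma acts_mscal:
  assumes "acts (mscal r A) g" "r \<noteq> 0"
  shows "acts A g"
proof -
  have l: "lin (mscal r A) = map_pair ((*) (const2 r)) (lin A)"
    by (cases A) (simp add: lin_def mscal_def const2_simps algebra_simps)
  have "map_pair (eval2 const3 (P, Q)) (lin (mscal r A)) =
      map_pair ((*) (const3 r)) (map_pair (eval2 const3 (P, Q)) (lin A))"
    unfolding l by (simp add: map_pair_def)
  moreover have "const3 r \<noteq> 0" using assms(2) by (simp add: const3_def)
  ultimately have "sim2 (map_pair (eval2 const3 (P, Q)) (lin (mscal r A))) (map_pair (eval2 const3 (P, Q)) (lin A))"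
    using sim2_smult by simp
  then show ?thesis using assms(1) sim2_trans unfolding acts_def by blast
qed

lemma one_mat: "mdet (1, 0, 0, 1) \<noteq> 0" "mmul (1, 0, 0, 1) A = A" "mmul A (1, 0, 0, 1) = A"
  by (simp add: mdet_def, (cases A, simp add: mmul_def)+)

lemma subgroup_fibrewise: "subgroup {F \<in> carrier BirP2. preserves_fibre_by_fibre (P, Q) F} BirP2"
proof -
  interpret group BirP2 by (rule group_BirP2)
  show ?thesis
  proof (rule subgroupI)
    have "acts (1, 0, 0, 1) (varX, varY, varZ)" by (simp add: acts_def lin_one eval3_vars)
    then have "\<one>\<^bsub>BirP2\<^esub> \<in> {F \<in> carrier BirP2. preserves_fibre_by_fibre (P, Q) F}"
      using preserves_iff[OF one_closed BirP2_one] by simp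
    then show "{F \<in> carrier BirP2. preserves_fibre_by_fibre (P, Q) F} \<noteq> {}" by blast
  next
    fix F assume F: "F \<in> {F \<in> carrier BirP2. preserves_fibre_by_fibre (P, Q) F}"
    then have Fc: "F \<in> carrier BirP2" by simp
    obtain g where g: "g \<in> F" using BirP2_rep[OF Fc] by blast
    obtain h where h: "h \<in> inv\<^bsub>BirP2\<^esub> F" using BirP2_rep[OF inv_closed[OF Fc]] by blast
    have "acts (1, 0, 0, 1) h"
      using acts_inv[OF Fc g h _ one_mat(1,2)] F preserves_iff[OF Fc g] by simp
    then show "inv\<^bsub>BirP2\<^esub> F \<in> {F \<in> carrier BirP2. preserves_fibre_by_fibre (P, Q) F}"
      using preserves_iff[OF inv_closed[OF Fc] h] Fc by simp
  next
    fix F G assume FG: "F \<in> {F \<in> carrier BirP2. preserves_fibre_by_fibre (P, Q) F}"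
      "G \<in> {F \<in> carrier BirP2. preserves_fibre_by_fibre (P, Q) F}"
    then have c: "F \<in> carrier BirP2" "G \<in> carrier BirP2" by auto
    obtain f where f: "f \<in> F" using BirP2_rep[OF c(1)] by blast
    obtain g where g: "g \<in> G" using BirP2_rep[OF c(2)] by blast
    have "acts (mmul (1, 0, 0, 1) (1, 0, 0, 1)) (subst3 f g)"
      using FG preserves_iff[OF c(1) f] preserves_iff[OF c(2) g]
      by (intro acts_mult[OF c(1) f c(2) g _ _ one_mat(1)]) simp_all
    then show "F \<otimes>\<^bsub>BirP2\<^esub> G \<in> {F \<in> carrier BirP2. preserves_fibre_by_fibre (P, Q) F}"
      using preserves_iff[OF m_closed[OF c] BirP2_mult[OF c f g]] c by (simp add: one_mat(2))
  qed blast
qed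

definition fibre_centraliser :: "rmap \<Rightarrow> rmap set" where
  "fibre_centraliser F = {G \<in> carrier BirP2. preserves_fibre_by_fibre (P, Q) G \<and> G \<otimes>\<^bsub>BirP2\<^esub> F = F \<otimes>\<^bsub>BirP2\<^esub> G}"

end

lemma (in group) subgroup_centraliser:
  assumes "x \<in> carrier G"
  shows "subgroup {h \<in> carrier G. h \<otimes> x = x \<otimes> h} G"
proof (rule subgroupI)
  fix h assume "h \<in> {h \<in> carrier G. h \<otimes> x = x \<otimes> h}"
  then show "inv h \<in> {h \<in> carrier G. h \<otimes> x = x \<otimes> h}"
  proof -
    have h: "h \<in> carrier G" "h \<otimes> x = x \<otimes> h" using \<open>h \<in> _\<close> by auto
    have "inv h \<otimes> x = inv h \<otimes> (x \<otimes> h) \<otimes> inv h" using h(1) assms by (simp add: m_assoc)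
    also have "\<dots> = (inv h \<otimes> h) \<otimes> x \<otimes> inv h"
      unfolding h(2)[symmetric] using h(1) assms by (simp only: m_assoc m_closed inv_closed)
    also have "\<dots> = x \<otimes> inv h" using h(1) assms by simp
    finally show ?thesis using h(1) by simp
  qed
next
  fix h k assume hk: "h \<in> {h \<in> carrier G. h \<otimes> x = x \<otimes> h}" "k \<in> {h \<in> carrier G. h \<otimes> x = x \<otimes> h}"
  then have "h \<otimes> k \<otimes> x = h \<otimes> (x \<otimes> k)" using assms by (simp add: m_assoc)
  also have "\<dots> = x \<otimes> (h \<otimes> k)" using hk assms by (simp add: m_assoc[symmetric])
  finally show "h \<otimes> k \<in> {h \<in> carrier G. h \<otimes> x = x \<otimes> h}" using hk by simp
qed (use assms in auto)

context fibration
begin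

context
  fixes F
  assumes F: "F \<in> carrier BirP2" "preserves_fibre_by_fibre (P, Q) F"
    and inf: "\<And>n::nat. n \<ge> 1 \<Longrightarrow> F [^]\<^bsub>BirP2\<^esub> n \<noteq> \<one>\<^bsub>BirP2\<^esub>"
begin

interpretation BirP2: group BirP2 by (rule group_BirP2)

lemma subgroup_fibre_centraliser: "subgroup (fibre_centraliser F) BirP2"
proof -
  have "fibre_centraliser F = {F \<in> carrier BirP2. preserves_fibre_by_fibre (P, Q) F} \<inter>
      {h \<in> carrier BirP2. h \<otimes>\<^bsub>BirP2\<^esub> F = F \<otimes>\<^bsub>BirP2\<^esub> h}"
    by (auto simp: fibre_centraliser_def)
  then show ?thesis
    using BirP2.subgroups_Inter_pair[OF subgroup_fibrewise BirP2.subgroup_centraliser[OF F(1)]] by simp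
qed

lemma F_in_fibre_centraliser: "F \<in> fibre_centraliser F"
  using F by (simp add: fibre_centraliser_def)

lemma infinite_fibre_centraliser: "infinite (fibre_centraliser F)"
proof
  interpret Z: subgroup "fibre_centraliser F" BirP2 by (rule subgroup_fibre_centraliser)
  assume fin: "finite (fibre_centraliser F)"
  have "F [^]\<^bsub>BirP2\<^esub> n \<in> fibre_centraliser F" for n :: nat
    by (induction n) (use F_in_fibre_centraliser in auto)
  moreover have "inj (\<lambda>n::nat. F [^]\<^bsub>BirP2\<^esub> n)"
  proof (rule linorder_injI)
    fix m n :: nat assume mn: "m < n"
    show "F [^]\<^bsub>BirP2\<^esub> m \<noteq> F [^]\<^bsub>BirP2\<^esub> n"
    proof
      assume eq: "F [^]\<^bsub>BirP2\<^esub> m = F [^]\<^bsub>BirP2\<^esub> n"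
      have "F [^]\<^bsub>BirP2\<^esub> m \<otimes>\<^bsub>BirP2\<^esub> F [^]\<^bsub>BirP2\<^esub> (n - m) = F [^]\<^bsub>BirP2\<^esub> n"
        using BirP2.nat_pow_mult[OF F(1), of m "n - m"] mn by simp
      then have "F [^]\<^bsub>BirP2\<^esub> m \<otimes>\<^bsub>BirP2\<^esub> F [^]\<^bsub>BirP2\<^esub> (n - m) = F [^]\<^bsub>BirP2\<^esub> m \<otimes>\<^bsub>BirP2\<^esub> \<one>\<^bsub>BirP2\<^esub>"
        using eq F(1) by simp
      then have "F [^]\<^bsub>BirP2\<^esub> (n - m) = \<one>\<^bsub>BirP2\<^esub>"
        using F(1) BirP2.Units_l_cancel[of "F [^]\<^bsub>BirP2\<^esub> m"] by simp
      then show False using inf[of "n - m"] mn by simp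
    qed
  qed
  ultimately show False using fin by (meson finite_subset image_subsetI infinite_UNIV_nat finite_imageD)
qed

lemma commutative_fibre_centraliser:
  assumes "Z \<in> fibre_centraliser F" "Y \<in> fibre_centraliser F"
  shows "Z \<otimes>\<^bsub>BirP2\<^esub> Y = Y \<otimes>\<^bsub>BirP2\<^esub> Z"
proof (rule fibrewise_centraliser_commutative[OF F])
  have "F [^]\<^bsub>BirP2\<^esub> (2::nat) = F \<otimes>\<^bsub>BirP2\<^esub> F" using F(1) by (simp add: numeral_2_eq_2)
  then show "F \<otimes>\<^bsub>BirP2\<^esub> F \<noteq> \<one>\<^bsub>BirP2\<^esub>" using inf[of 2] by simp
qed (use assms in \<open>auto simp: fibre_centraliser_def\<close>)

text \<open>
  Every abelian group of fibrewise maps containing \<open>\<phi>\<close> lies in the fibrewise centraliser, which is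
  itself abelian; so the latter is the unique maximal one.
\<close>

lemma Ab_eq: "Ab (P, Q) F = fibre_centraliser F"
proof -
  define K where "K = {F \<in> carrier BirP2. preserves_fibre_by_fibre (P, Q) F}"
  have K: "subgroup K BirP2" unfolding K_def by (rule subgroup_fibrewise)
  have fg: "fibre_group (P, Q) = BirP2\<lparr>carrier := K\<rparr>" by (simp add: fibre_group_def K_def)
  have ZK: "fibre_centraliser F \<subseteq> K" by (auto simp: fibre_centraliser_def K_def)
  have max: "infinite_abelian_subgroup_containing (fibre_group (P, Q)) F (fibre_centraliser F)"
    unfolding infinite_abelian_subgroup_containing_def fg
    using BirP2.subgroup_incl[OF subgroup_fibre_centraliser K ZK] infinite_fibre_centraliser
      commutative_fibre_centraliser F_in_fibre_centraliser by simp
  have sub: "B \<subseteq> fibre_centraliser F"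
    if B: "infinite_abelian_subgroup_containing (fibre_group (P, Q)) F B" for B
  proof -
    have "subgroup B (BirP2\<lparr>carrier := K\<rparr>)" "F \<in> B" "\<And>a b. a \<in> B \<Longrightarrow> b \<in> B \<Longrightarrow> a \<otimes>\<^bsub>BirP2\<^esub> b = b \<otimes>\<^bsub>BirP2\<^esub> a"
      using B by (auto simp: infinite_abelian_subgroup_containing_def fg)
    then show ?thesis using subgroup.subset[of B "BirP2\<lparr>carrier := K\<rparr>"] by (auto simp: fibre_centraliser_def K_def)
  qed
  show ?thesis
    unfolding Ab_def by (rule the_equality) (use max sub in blast)+
qed

lemma finite_extension_fibre_centraliser:
  assumes unbounded: "\<And>b. \<exists>k::nat. k \<ge> 2 \<and> rmap_degree (F [^]\<^bsub>BirP2\<^esub> k) > b"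
  shows "finite_extension (centraliser BirP2 F) (fibre_centraliser F)"
proof -
  define K where "K = {h \<in> carrier BirP2. h \<otimes>\<^bsub>BirP2\<^esub> F = F \<otimes>\<^bsub>BirP2\<^esub> h}"
  have sK: "subgroup K BirP2" unfolding K_def by (rule BirP2.subgroup_centraliser[OF F(1)])
  have CK: "centraliser BirP2 F = BirP2\<lparr>carrier := K\<rparr>" by (simp add: centraliser_def K_def)
  interpret C: group "centraliser BirP2 F"
    unfolding CK by (rule subgroup.subgroup_is_group[OF sK group_BirP2])
  have Kc: "carrier (centraliser BirP2 F) = K" "mult (centraliser BirP2 F) = mult BirP2" by (simp_all add: CK)
  have inv: "inv\<^bsub>centraliser BirP2 F\<^esub> x = inv\<^bsub>BirP2\<^esub> x" if "x \<in> K" for x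
    unfolding CK using BirP2.m_inv_consistent[OF sK that] .
  have ZK: "fibre_centraliser F \<subseteq> K" by (auto simp: fibre_centraliser_def K_def)
  have sZ: "subgroup (fibre_centraliser F) (centraliser BirP2 F)"
    unfolding CK by (rule BirP2.subgroup_incl[OF subgroup_fibre_centraliser sK ZK])
  have rep: "\<exists>h A. h \<in> x \<and> mdet A \<noteq> 0 \<and> acts A h" if "x \<in> K" for x
  proof -
    have x: "x \<in> carrier BirP2" "x \<otimes>\<^bsub>BirP2\<^esub> F = F \<otimes>\<^bsub>BirP2\<^esub> x" using that by (auto simp: K_def)
    obtain h where "h \<in> x" using BirP2_rep[OF x(1)] by blast
    then show ?thesis using centraliser_acts[OF F inf x(1) _ x(2)] by blast
  qed
  have quot: "x \<otimes>\<^bsub>BirP2\<^esub> inv\<^bsub>BirP2\<^esub> y \<in> fibre_centraliser F"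
    if x: "x \<in> K" "h \<in> x" "acts A h" and y: "y \<in> K" "k \<in> y" "acts B k" and det: "mdet A \<noteq> 0" "mdet B \<noteq> 0"
      and AB: "A = mscal r B" "r \<noteq> 0" for x y h k A B r
  proof -
    have xy: "x \<in> carrier BirP2" "y \<in> carrier BirP2" using x y by (auto simp: K_def)
    obtain B' where B': "mmul B B' = (1, 0, 0, 1)" "mmul B' B = (1, 0, 0, 1)" using mat_inverse[OF det(2)] by blast
    obtain k' where k': "k' \<in> inv\<^bsub>BirP2\<^esub> y" using BirP2_rep[OF BirP2.inv_closed[OF xy(2)]] by blast
    have "acts B' k'" by (rule acts_inv[OF xy(2) y(2) k' y(3) det(2) B'(2)])
    then have "acts (mmul A B') (subst3 h k')"
      by (rule acts_mult[OF xy(1) x(2) BirP2.inv_closed[OF xy(2)] k' x(3) _ det(1)])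
    moreover have "mmul A B' = mscal r (mmul B B')"
      unfolding AB(1) by (cases B; cases B') (simp add: mmul_def mscal_def algebra_simps)
    ultimately have "acts (mscal r (1, 0, 0, 1)) (subst3 h k')" by (simp add: B'(1))
    then have "acts (1, 0, 0, 1) (subst3 h k')" using acts_mscal AB(2) by blast
    moreover have "x \<otimes>\<^bsub>BirP2\<^esub> inv\<^bsub>BirP2\<^esub> y \<in> K"
      using x(1) y(1) sK by (simp add: subgroup.m_closed subgroup.m_inv_closed)
    ultimately show ?thesis
      using preserves_iff[OF _ BirP2_mult[OF xy(1) BirP2.inv_closed[OF xy(2)] x(2) k']] xy
      by (simp add: fibre_centraliser_def K_def)
  qed
  have "fibre_centraliser F \<lhd> centraliser BirP2 F"
  proof (rule C.normal_invI[OF sZ])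
    fix x z assume "x \<in> carrier (centraliser BirP2 F)" and z: "z \<in> fibre_centraliser F"
    then have x: "x \<in> K" by (simp add: Kc)
    have zK: "z \<in> K" using z ZK by blast
    have xz: "x \<in> carrier BirP2" "z \<in> carrier BirP2" using x zK by (auto simp: K_def)
    obtain h A where hA: "h \<in> x" "mdet A \<noteq> 0" "acts A h" using rep[OF x] by blast
    obtain g where g: "g \<in> z" using BirP2_rep[OF xz(2)] by blast
    have "acts (1, 0, 0, 1) g" using z preserves_iff[OF xz(2) g] by (simp add: fibre_centraliser_def)
    then have "acts A (subst3 h g)"
      using acts_mult[OF xz(1) hA(1) xz(2) g hA(3) _ hA(2)] by (fastforce simp: one_mat(3))
    then have "x \<otimes>\<^bsub>BirP2\<^esub> z \<otimes>\<^bsub>BirP2\<^esub> inv\<^bsub>BirP2\<^esub> x \<in> fibre_centraliser F"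
      using quot[of "x \<otimes>\<^bsub>BirP2\<^esub> z" "subst3 h g" A x h A 1] x zK sK hA BirP2_mult[OF xz hA(1) g]
      by (cases A) (simp add: subgroup.m_closed mscal_def)
    then show "x \<otimes>\<^bsub>centraliser BirP2 F\<^esub> z \<otimes>\<^bsub>centraliser BirP2 F\<^esub> inv\<^bsub>centraliser BirP2 F\<^esub> x \<in> fibre_centraliser F"
      using inv[OF x] by (simp add: Kc)
  qed
  moreover have "finite (rcosets\<^bsub>centraliser BirP2 F\<^esub> fibre_centraliser F)"
  proof (rule ccontr)
    assume "infinite (rcosets\<^bsub>centraliser BirP2 F\<^esub> fibre_centraliser F)"
    then obtain co :: "nat \<Rightarrow> rmap set" where co: "inj co"
      "range co \<subseteq> rcosets\<^bsub>centraliser BirP2 F\<^esub> fibre_centraliser F"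
      using infinite_countable_subset by blast
    have "\<forall>n. \<exists>x. x \<in> K \<and> co n = fibre_centraliser F #>\<^bsub>centraliser BirP2 F\<^esub> x"
      using co(2) by (auto simp: RCOSETS_def Kc)
    from choice[OF this] obtain x where x: "\<And>n. x n \<in> K" "\<And>n. co n = fibre_centraliser F #>\<^bsub>centraliser BirP2 F\<^esub> x n"
      by blast
    have xc: "x n \<in> carrier BirP2" "x n \<otimes>\<^bsub>BirP2\<^esub> F = F \<otimes>\<^bsub>BirP2\<^esub> x n" for n using x(1)[of n] by (auto simp: K_def)
    have "\<forall>n. \<exists>h. h \<in> x n \<and> (\<exists>A. mdet A \<noteq> 0 \<and> acts A h)" using rep[OF x(1)] by blast
    from choice[OF this] obtain h where h: "\<And>n. h n \<in> x n" "\<And>n. \<exists>A. mdet A \<noteq> 0 \<and> acts A (h n)" by blast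
    have "\<forall>n. \<exists>A. mdet A \<noteq> 0 \<and> acts A (h n)" using h(2) by blast
    from choice[OF this] obtain A where A: "\<And>n. mdet (A n) \<noteq> 0" "\<And>n. acts (A n) (h n)" by blast
    \<comment> \<open>maps inducing the same transformation of the base lie in one coset\<close>
    have np: "A i \<noteq> mscal r (A j)" if ij: "i \<noteq> j" "r \<noteq> 0" for i j r
    proof
      assume "A i = mscal r (A j)"
      then have "x i \<otimes>\<^bsub>BirP2\<^esub> inv\<^bsub>BirP2\<^esub> x j \<in> fibre_centraliser F"
        by (intro quot[OF x(1) h(1) A(2) x(1) h(1) A(2) A(1) A(1) _ ij(2)])
      then have "x i \<otimes>\<^bsub>BirP2\<^esub> inv\<^bsub>BirP2\<^esub> x j \<otimes>\<^bsub>BirP2\<^esub> x j \<in> fibre_centraliser F #>\<^bsub>centraliser BirP2 F\<^esub> x j"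
        by (auto simp: r_coset_def Kc)
      moreover have "x i \<otimes>\<^bsub>BirP2\<^esub> inv\<^bsub>BirP2\<^esub> x j \<otimes>\<^bsub>BirP2\<^esub> x j = x i"
        using xc by (simp add: BirP2.m_assoc)
      ultimately have "co j = co i"
        unfolding x(2) using C.repr_independence[OF _ _ sZ] x(1) Kc(1) by simp
      then show False using co(1) ij by (simp add: inj_eq)
    qed
    have "\<exists>b. \<forall>k::nat. k \<ge> 2 \<longrightarrow> rmap_degree (F [^]\<^bsub>BirP2\<^esub> k) \<le> b"
      by (rule iterates_bounded[where H = x and h = h and A = A, OF F]) (use inf np xc h(1) A in blast)+
    then obtain b where b: "\<forall>k::nat. k \<ge> 2 \<longrightarrow> rmap_degree (F [^]\<^bsub>BirP2\<^esub> k) \<le> b" ..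
    then show False using unbounded[of b] by (meson not_less)
  qed
  ultimately show ?thesis by (simp add: finite_extension_def)
qed

end

end

lemma fibration_of_rational_fibration:
  assumes "rational_fibration (P, Q)"
  shows "\<exists>d. fibration P Q d"
  using assms unfolding rational_fibration_def fibration_def eventually_cofinite by auto

lemma linear_growth_unbounded:
  assumes "linear_growth F" "n \<ge> 1"
  shows "\<exists>k::nat. k \<ge> 2 \<and> n dvd k \<and> rmap_degree (F [^]\<^bsub>BirP2\<^esub> k) > b"
proof -
  obtain c C where c: "0 < c" "\<forall>\<^sub>F k in sequentially. c * real k \<le> real (rmap_degree (F [^]\<^bsub>BirP2\<^esub> k)) \<and>
    real (rmap_degree (F [^]\<^bsub>BirP2\<^esub> k)) \<le> C * real k"
    using assms(1) by (auto simp: linear_growth_def)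
  obtain N where N: "\<And>k. k \<ge> N \<Longrightarrow> c * real k \<le> real (rmap_degree (F [^]\<^bsub>BirP2\<^esub> k))"
    using c(2) by (auto simp: eventually_sequentially)
  obtain q where q: "real b / c < real q" using reals_Archimedean2 by blast
  define k where "k = n * (q + N + 2)"
  have "1 * (q + N + 2) \<le> k" unfolding k_def using assms(2) by (rule mult_le_mono1)
  then have le: "q + N + 2 \<le> k" by simp
  have "real b < c * real q" using q c(1) by (simp add: field_simps)
  also have "\<dots> \<le> c * real k" using le c(1) by simp
  also have "\<dots> \<le> real (rmap_degree (F [^]\<^bsub>BirP2\<^esub> k))" using N le by simp
  finally have "b < rmap_degree (F [^]\<^bsub>BirP2\<^esub> k)" by simp
  moreover have "n dvd k" by (simp add: k_def)
  ultimately show ?thesis using le by (intro exI[of _ k]) simp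
qed

lemma linear_growth_infinite_order:
  assumes "F \<in> carrier BirP2" "linear_growth F" "n \<ge> 1"
  shows "F [^]\<^bsub>BirP2\<^esub> (n::nat) \<noteq> \<one>\<^bsub>BirP2\<^esub>"
proof
  interpret group BirP2 by (rule group_BirP2)
  assume 1: "F [^]\<^bsub>BirP2\<^esub> n = \<one>\<^bsub>BirP2\<^esub>"
  obtain k where k: "n dvd k" "rmap_degree (F [^]\<^bsub>BirP2\<^esub> k) > rmap_degree \<one>\<^bsub>BirP2\<^esub>"
    using linear_growth_unbounded[OF assms(2,3)] by blast
  then obtain q where "k = n * q" by blast
  then have "F [^]\<^bsub>BirP2\<^esub> k = \<one>\<^bsub>BirP2\<^esub>" using nat_pow_pow[OF assms(1), of n q] 1 by simp
  then show False using k(2) by simp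
qed

theorem mainTheorem2:
  fixes \<phi> :: rmap and f :: "poly3 \<times> poly3"
  assumes "\<phi> \<in> carrier BirP2"
    and "rational_fibration f"
    and "preserves_fibre_by_fibre f \<phi>"
    and "linear_growth \<phi>"
  shows "finite_extension (centraliser BirP2 \<phi>) (Ab f \<phi>)"
proof -
  obtain P Q where f: "f = (P, Q)" by (cases f)
  obtain d where "fibration P Q d" using fibration_of_rational_fibration assms(2) f by blast
  then interpret fibration P Q d .
  have \<phi>: "preserves_fibre_by_fibre (P, Q) \<phi>" using assms(3) f by simp
  have inf: "\<phi> [^]\<^bsub>BirP2\<^esub> n \<noteq> \<one>\<^bsub>BirP2\<^esub>" if "n \<ge> 1" for n :: nat
    by (rule linear_growth_infinite_order[OF assms(1,4) that])
  have unbounded: "\<exists>k::nat. k \<ge> 2 \<and> rmap_degree (\<phi> [^]\<^bsub>BirP2\<^esub> k) > b" for b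
    using linear_growth_unbounded[OF assms(4) order_refl] by blast
  have "Ab (P, Q) \<phi> = fibre_centraliser \<phi>"
    by (rule Ab_eq[OF assms(1) \<phi>]) (rule inf)
  moreover have "finite_extension (centraliser BirP2 \<phi>) (fibre_centraliser \<phi>)"
    by (rule finite_extension_fibre_centraliser[OF assms(1) \<phi> _ unbounded]) (rule inf)
  ultimately show ?thesis by (simp add: f)
qed

end
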